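(* For every $n\ge 1$ there is a constant $c_n>0$ depending only on $n$ such that the following holds. Let $0<\delta<1$, let $1\le p<\frac{n}{\delta}$, let $w\in A_1$, and define $p_\delta^*$ by $\frac1p-\frac1{p_\delta^*}=\frac{\delta}{n}$. Then, for every cube $Q$ in $\mathbb{R}^n$ and every $u\in L^1_{\mathrm{loc}}(\mathbb{R}^n)$, $$\inf_{c\in\mathbb{R}}\left(\frac{1}{w(Q)}\int_Q |u(x)-c|^{p_{\delta}^*}\,w(x)\,dx\right)^{\frac{1}{p_{\delta}^*}}\le c_n\,p_\delta^*\,(1-\delta)^{\frac1p}\,[w]_{A_1}^{\frac{\delta}{n}+1+\frac1p}\,\ell(Q)^\delta\left(\frac{1}{w(Q)}\int_Q\int_Q\frac{|u(x)-u(y)|^p}{|x-y|^{n+p\delta}}\,dy\,w(x)\,dx\right)^{\frac1p}.$$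
   Context: A cube $Q\subset\mathbb{R}^n$ is a cartesian product of $n$ intervals of the same side length $\ell(Q)$. A weight is a function $w\in L^1_{\mathrm{loc}}(\mathbb{R}^n)$ with $w(x)>0$ for almost every $x$; $w(E)=\int_E w\,dx$. A weight $w$ is in $A_1$ if there is $C>0$ with $\frac1{|Q|}\int_Q w\,dx\le C\,\operatorname{ess\,inf}_{x\in Q}w(x)$ for every cube $Q$; $[w]_{A_1}$ is the smallest such $C$. *)

theory Defs
  imports "HOL-Analysis.Analysis" "HOL-Probability.Essential_Supremum"
begin

text \<open>The intervals may be open, closed or half-open, independently in each coordinate;
  the side length is required to be positive.\<close>

definition cube_of_side :: "real \<Rightarrow> (real ^ 'n::finite) set \<Rightarrow> bool" where
  "cube_of_side l Q \<longleftrightarrow> 0 < l \<and>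
     (\<exists>I. (\<forall>i. \<exists>a. I i \<in> {{a..a + l}, {a<..<a + l}, {a..<a + l}, {a<..a + l}}) \<and>
          Q = {x. \<forall>i. x $ i \<in> I i})"

definition locally_L1 :: "(real ^ 'n::finite \<Rightarrow> real) \<Rightarrow> bool" where
  "locally_L1 f \<longleftrightarrow> (\<forall>K. compact K \<longrightarrow> set_integrable lebesgue K f)"

definition weight :: "(real ^ 'n::finite \<Rightarrow> real) \<Rightarrow> bool" where
  "weight w \<longleftrightarrow> locally_L1 w \<and> (AE x in lebesgue. 0 < w x)"

text \<open>The Bochner integral is 0 for non-integrable functions, so this is the intended \<open>w(E)\<close>
  only where \<open>w\<close> is integrable over \<open>E\<close>, as for a weight over a cube.\<close>

definition weight_of :: "(real ^ 'n::finite \<Rightarrow> real) \<Rightarrow> (real ^ 'n) set \<Rightarrow> real" where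
  "weight_of w E = (LINT x:E|lebesgue. w x)"

definition ess_inf_on :: "(real ^ 'n::finite) set \<Rightarrow> (real ^ 'n \<Rightarrow> real) \<Rightarrow> ereal" where
  "ess_inf_on E f = - esssup (lebesgue_on E) (\<lambda>x. - ereal (f x))"

definition A1_bound :: "(real ^ 'n::finite \<Rightarrow> real) \<Rightarrow> real \<Rightarrow> bool" where
  "A1_bound w C \<longleftrightarrow> 0 < C \<and>
     (\<forall>l Q. cube_of_side l Q \<longrightarrow>
        ereal (1 / measure lebesgue Q * (LINT x:Q|lebesgue. w x)) \<le> ereal C * ess_inf_on Q w)"

definition A1 :: "(real ^ 'n::finite \<Rightarrow> real) set" where
  "A1 = {w. weight w \<and> (\<exists>C. A1_bound w C)}"

text \<open>For \<open>w \<in> A1\<close> the infimum is attained.\<close>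

definition A1_const :: "(real ^ 'n::finite \<Rightarrow> real) \<Rightarrow> real" where
  "A1_const w = Inf {C. A1_bound w C}"

text \<open>Both sides of the inequality may be infinite, so real powers of extended nonnegative
  numbers are needed; the definition is meant for exponents \<open>a > 0\<close> only.\<close>

definition ennpowr :: "ennreal \<Rightarrow> real \<Rightarrow> ennreal" where
  "ennpowr x a = (if x = \<infinity> then \<infinity> else ennreal (enn2real x powr a))"

end

theory Submission
  imports Defs
begin

text \<open>
  Write \<open>n\<close> for the dimension, \<open>C\<close> for the \<open>A\<^sub>1\<close> constant of \<open>w\<close>, and \<open>E\<close> for the weighted double
  integral on the right-hand side. The inequality is obtained by truncating \<open>u\<close> at a sequence of
  levels and applying, to each truncation, a weighted Poincare inequality on a grid whose mesh is
  adapted to the size of the level set. Three ingredients carry the constants.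

  \<^bold>\<open>The factor \<open>1 - \<delta>\<close>.\<close> On a convex set the increments \<open>H(h) = \<integral> |v(x + h) - v(x)|\<^sup>p dx\<close> satisfy
  \<open>H(2h) \<le> 2\<^sup>p H(h)\<close>, because the step \<open>2h\<close> can be split into two steps \<open>h\<close>. Hence shrinking the range
  of \<open>h\<close> by a factor 2 loses at most the fraction \<open>1 - 2 powr (- p(1 - \<delta>)) \<le> p(1 - \<delta>)\<close> of the fractional
  energy; that is, the increments in any dyadic annulus account for at most this fraction. Summing
  over annuli gives the unweighted inequality \<open>fractional_poincare_convex\<close>.

  \<^bold>\<open>The weight.\<close> Averaging \<open>w\<close> over the cells of a grid is a self-adjoint operation, and the
  \<open>A\<^sub>1\<close> condition says that the averaged weight is at most \<open>C w\<close>. Passing from the mean of \<open>w\<close> over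
  coarse cells to \<open>w\<close> itself through dyadic refinements, with an error at each scale that is
  controlled by \<open>fractional_poincare_convex\<close>, yields \<open>fractional_poincare_cells\<close>: if \<open>v\<close> vanishes on at least half of
  every cell of side \<open>r\<close>, then \<open>\<integral> |v|\<^sup>p w\<close> is at most a constant times
  \<open>(1 - \<delta>) C r powr (p \<delta>)\<close> times the weighted energy. The errors decay like \<open>2 powr (- k \<delta>)\<close>, so the
  chain is used only for \<open>\<delta> > 1/2\<close>; for \<open>\<delta> \<le> 1/2\<close>, where \<open>1 - \<delta>\<close> is bounded below, comparing \<open>v\<close>
  with its zero set is enough. This keeps the constant bounded as \<open>\<delta>\<close> tends to 0.

  \<^bold>\<open>The exponent \<open>q\<close>.\<close> Let \<open>m\<close> be a median of \<open>u\<close> and \<open>f\<close> the positive or negative part of \<open>u - m\<close>.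
  For levels \<open>\<sigma> < \<tau>\<close>, the layer of \<open>f\<close> between \<open>\<sigma>\<close> and \<open>\<tau>\<close> vanishes off \<open>{f > \<sigma>}\<close>. Choosing the mesh
  with \<open>r ^ n\<close> comparable to \<open>|{f > \<sigma>}|\<close>, and bounding this measure by \<open>w({f > \<sigma>})\<close> through \<open>A\<^sub>1\<close>, gives
  (\<open>level_estimate\<close>)
  \<open>(\<tau> - \<sigma>) powr p * w({f > \<tau>}) \<le> \<Gamma> * e * w({f > \<sigma>}) powr (p \<delta> / n)\<close>
  where \<open>e\<close> is the energy of the layer. The energies of consecutive layers add up to at most \<open>E\<close>,
  so summing over geometric levels turns this into a strong \<open>L\<^sup>q\<close> bound
  (\<open>strong_type_from_levels\<close>). With ratio 2 the constant would grow exponentially in \<open>q\<close>; the ratio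
  \<open>1 + 1/q\<close> makes it linear.

  The power \<open>\<delta>/n + 1/p\<close> of \<open>C\<close> that this produces is raised to the one in the theorem by \<open>C \<ge> 1\<close>.\<close>

section \<open>Increments and the fractional energy\<close>

text \<open>Convexity of \<open>t powr p\<close>. The weights \<open>a\<close>, \<open>b\<close> are free so that, when the \<open>p\<close>-th powers of \<open>x\<close> and
  \<open>y\<close> integrate to at most \<open>a powr p\<close> and \<open>b powr p\<close> times some \<open>B\<close>, the right-hand side integrates to
  exactly \<open>(a + b) powr p\<close> times \<open>B\<close>. This is how Minkowski's inequality enters below.\<close>

lemma powr_add_le_weighted:
  fixes a b x y p :: real
  assumes "1 \<le> p" "0 < a" "0 < b" "0 \<le> x" "0 \<le> y"
  shows "(x + y) powr p
    \<le> (a + b) powr (p - 1) * (a powr (1 - p) * x powr p + b powr (1 - p) * y powr p)"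
proof -
  have one: "z powr p \<le> (a' + b') powr (p - 1) * (b' powr (1 - p) * z powr p)"
    if "0 < a'" "0 < b'" "0 \<le> z" for a' b' z :: real
  proof -
    have "1 \<le> ((a' + b') / b') powr (p - 1)"
      using that assms by (intro ge_one_powr_ge_zero) auto
    also have "\<dots> = (a' + b') powr (p - 1) * inverse (b' powr (p - 1))"
      using that by (simp add: powr_divide) (simp add: divide_inverse)
    also have "inverse (b' powr (p - 1)) = b' powr (1 - p)"
      by (simp add: powr_minus [symmetric])
    finally have "1 * z powr p \<le> (a' + b') powr (p - 1) * b' powr (1 - p) * z powr p"
      by (intro mult_right_mono) auto
    then show ?thesis by (simp add: mult.assoc)
  qed
  consider "x = 0" | "y = 0" | "0 < x" "0 < y" using assms by linarith
  then show ?thesis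
  proof cases
    case 1
    then show ?thesis using one[of a b y] assms by simp
  next
    case 2
    then show ?thesis using one[of b a x] assms by (simp add: add.commute)
  next
    case 3
    have cv: "convex_on {0<..} (\<lambda>x::real. x powr p)" using assms by (intro powr_convex)
    have ab: "1 - b / (a + b) = a / (a + b)" using assms by (simp add: field_simps)
    have e: "(x + y) / (a + b) = (1 - b / (a + b)) * (x / a) + b / (a + b) * (y / b)"
      unfolding ab using assms by (simp add: add_divide_distrib)
    have "((x + y) / (a + b)) powr p
        \<le> a / (a + b) * (x / a) powr p + b / (a + b) * (y / b) powr p"
      unfolding e ab[symmetric]
      using convex_onD[OF cv, of "b / (a + b)" "x / a" "y / b"] 3 assms by simp
    then have "(a + b) powr p * ((x + y) / (a + b)) powr p
        \<le> (a + b) powr p * (a / (a + b) * (x / a) powr p + b / (a + b) * (y / b) powr p)"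
      by (intro mult_left_mono) auto
    moreover have "(a + b) powr p * ((x + y) / (a + b)) powr p = (x + y) powr p"
      using assms 3 by (simp add: powr_divide)
    moreover have "a * (x / a) powr p = a powr (1 - p) * x powr p"
      using assms 3 by (simp add: powr_divide powr_diff)
    moreover have "b * (y / b) powr p = b powr (1 - p) * y powr p"
      using assms 3 by (simp add: powr_divide powr_diff)
    moreover have "(a + b) powr p * (a / (a + b) * X + b / (a + b) * Y)
        = (a + b) powr (p - 1) * (a * X + b * Y)" for X Y
    proof -
      have "(a + b) powr p = (a + b) powr (p - 1) * (a + b)"
        using assms by (simp add: powr_diff)
      moreover have "(a + b) * (a / (a + b) * X + b / (a + b) * Y) = a * X + b * Y"
        using assms by (simp add: distrib_left)
      ultimately show ?thesis by (simp add: mult.assoc)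
    qed
    ultimately show ?thesis by metis
  qed
qed

lemma nn_integral_lborel_scale:
  fixes f :: "'a::euclidean_space \<Rightarrow> ennreal"
  assumes [measurable]: "f \<in> borel_measurable borel" and "0 < c"
  shows "(\<integral>\<^sup>+x. f x \<partial>lborel) = ennreal (c ^ DIM('a)) * (\<integral>\<^sup>+x. f (c *\<^sub>R x) \<partial>lborel)"
proof -
  have "(\<integral>\<^sup>+x. f x \<partial>lborel) =
     (\<integral>\<^sup>+x. f x \<partial>density (distr lborel borel (\<lambda>x. 0 + c *\<^sub>R x)) (\<lambda>_. \<bar>c\<bar> ^ DIM('a)))"
    using lborel_affine[of c "0::'a"] assms by simp
  also have "\<dots> = (\<integral>\<^sup>+x. ennreal (c ^ DIM('a)) * f (c *\<^sub>R x) \<partial>lborel)"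
    using assms by (simp add: nn_integral_density nn_integral_distr)
  finally show ?thesis by (simp add: nn_integral_cmult)
qed

lemma nn_integral_lborel_translate:
  fixes f :: "'a::euclidean_space \<Rightarrow> ennreal"
  assumes [measurable]: "f \<in> borel_measurable borel"
  shows "(\<integral>\<^sup>+x. f (c + x) \<partial>lborel) = (\<integral>\<^sup>+x. f x \<partial>lborel)"
proof -
  have "(\<integral>\<^sup>+x. f x \<partial>lborel) = (\<integral>\<^sup>+x. f x \<partial>distr lborel borel ((+) c))"
    by (simp add: lborel_distr_plus)
  then show ?thesis by (simp add: nn_integral_distr)
qed

text \<open>The exponent \<open>s\<close> is \<open>n + p \<delta>\<close> in all applications. On the diagonal the value is 0.\<close>

definition frac_kernel :: "real \<Rightarrow> real \<Rightarrow> ('a::euclidean_space \<Rightarrow> real) \<Rightarrow> 'a \<Rightarrow> 'a \<Rightarrow> real" where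
  "frac_kernel p s v x y = \<bar>v x - v y\<bar> powr p / norm (x - y) powr s"

lemma frac_kernel_measurable [measurable]:
  assumes [measurable]: "v \<in> borel_measurable borel"
    and [measurable]: "f \<in> measurable M borel" "g \<in> measurable M borel"
  shows "(\<lambda>z. frac_kernel p s v (f z) (g z)) \<in> borel_measurable M"
  unfolding frac_kernel_def by measurable

lemma frac_kernel_nonneg [simp]: "0 \<le> frac_kernel p s v x y"
  by (simp add: frac_kernel_def)

text \<open>Integrated over \<open>h\<close> against \<open>|h| powr (- s)\<close>, this gives the fractional energy of \<open>v\<close> on \<open>D\<close>.\<close>

definition shift_energy :: "real \<Rightarrow> ('a::euclidean_space \<Rightarrow> real) \<Rightarrow> 'a set \<Rightarrow> 'a \<Rightarrow> ennreal" where
  "shift_energy p v D h =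
     (\<integral>\<^sup>+x. indicator D x * indicator D (x + h) * ennreal (\<bar>v (x + h) - v x\<bar> powr p) \<partial>lborel)"

lemma shift_energy_measurable [measurable]:
  assumes [measurable]: "v \<in> borel_measurable borel" "D \<in> sets borel"
  shows "shift_energy p v D \<in> borel_measurable borel"
  unfolding shift_energy_def by measurable

text \<open>If \<open>x\<close> and \<open>x + 2h\<close> lie in \<open>D\<close>, then so does the midpoint \<open>x + h\<close>; the increment over \<open>2h\<close> is the sum
  of two increments over \<open>h\<close>, and translation invariance identifies their integrals.\<close>

lemma shift_energy_double:
  fixes v :: "'a::euclidean_space \<Rightarrow> real"
  assumes [measurable]: "v \<in> borel_measurable borel" "D \<in> sets borel"
    and "convex D" "1 \<le> p"
  shows "shift_energy p v D (2 *\<^sub>R h) \<le> ennreal (2 powr p) * shift_energy p v D h"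
proof -
  define I where "I x = indicator D x * indicator D (x + h) * ennreal (\<bar>v (x + h) - v x\<bar> powr p)" for x
  have [measurable]: "I \<in> borel_measurable borel" unfolding I_def by measurable
  have "shift_energy p v D (2 *\<^sub>R h) \<le> (\<integral>\<^sup>+x. ennreal (2 powr (p - 1)) * (I x + I (h + x)) \<partial>lborel)"
    unfolding shift_energy_def
  proof (rule nn_integral_mono)
    fix x
    show "indicator D x * indicator D (x + 2 *\<^sub>R h) * ennreal (\<bar>v (x + 2 *\<^sub>R h) - v x\<bar> powr p)
        \<le> ennreal (2 powr (p - 1)) * (I x + I (h + x))"
    proof (cases "x \<in> D \<and> x + 2 *\<^sub>R h \<in> D")
      case True
      have "x + h = (1 / 2) *\<^sub>R x + (1 / 2) *\<^sub>R (x + 2 *\<^sub>R h)"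
        by (simp add: algebra_simps flip: scaleR_2)
      then have m: "x + h \<in> D" using \<open>convex D\<close> True
        by (simp add: convexD)
      have eq: "x + h + h = x + 2 *\<^sub>R h" by (simp add: scaleR_2)
      have "\<bar>v (x + 2 *\<^sub>R h) - v x\<bar> powr p
          \<le> (\<bar>v (x + h) - v x\<bar> + \<bar>v (x + 2 *\<^sub>R h) - v (x + h)\<bar>) powr p"
        using assms by (intro powr_mono2) auto
      also have "\<dots> \<le> (1 + 1) powr (p - 1) * (1 powr (1 - p) * \<bar>v (x + h) - v x\<bar> powr p
          + 1 powr (1 - p) * \<bar>v (x + 2 *\<^sub>R h) - v (x + h)\<bar> powr p)"
        using assms by (intro powr_add_le_weighted) auto
      finally have "\<bar>v (x + 2 *\<^sub>R h) - v x\<bar> powr p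
         \<le> 2 powr (p - 1) * (\<bar>v (x + h) - v x\<bar> powr p + \<bar>v (x + 2 *\<^sub>R h) - v (x + h)\<bar> powr p)"
        by simp
      then show ?thesis using True m
        by (simp add: I_def eq add.commute[of h x] ennreal_plus[symmetric] ennreal_mult[symmetric]
            del: ennreal_plus)
    qed (auto simp: indicator_def)
  qed
  also have "\<dots> = ennreal (2 powr (p - 1)) * ((\<integral>\<^sup>+x. I x \<partial>lborel) + (\<integral>\<^sup>+x. I (h + x) \<partial>lborel))"
    by (simp add: nn_integral_cmult nn_integral_add)
  also have "(\<integral>\<^sup>+x. I (h + x) \<partial>lborel) = (\<integral>\<^sup>+x. I x \<partial>lborel)"
    by (rule nn_integral_lborel_translate) simp
  also have "(\<integral>\<^sup>+x. I x \<partial>lborel) = shift_energy p v D h"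
    by (simp add: I_def shift_energy_def)
  also have "ennreal (2 powr (p - 1)) * (shift_energy p v D h + shift_energy p v D h)
      = ennreal (2 powr (p - 1)) * ennreal 2 * shift_energy p v D h"
    by (simp add: mult_2[symmetric] mult.assoc)
  also have "ennreal (2 powr (p - 1)) * ennreal 2 = ennreal (2 powr p)"
    by (subst ennreal_mult[symmetric]) (auto simp: powr_diff)
  finally show ?thesis .
qed

text \<open>The substitution \<open>y = x + h\<close> and Fubini: a double integral over \<open>D\<close> of a function of \<open>x - y\<close> against
  the increments of \<open>v\<close> becomes an integral in the single variable \<open>h\<close>.\<close>

lemma double_integral_shift:
  fixes v :: "'a::euclidean_space \<Rightarrow> real" and \<phi> :: "'a \<Rightarrow> ennreal"
  assumes [measurable]: "v \<in> borel_measurable borel" "D \<in> sets borel" "\<phi> \<in> borel_measurable borel"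
    and even: "\<And>h. \<phi> (- h) = \<phi> h"
  shows "(\<integral>\<^sup>+x\<in>D. (\<integral>\<^sup>+y\<in>D. \<phi> (x - y) * ennreal (\<bar>v x - v y\<bar> powr p) \<partial>lborel) \<partial>lborel)
    = (\<integral>\<^sup>+h. \<phi> h * shift_energy p v D h \<partial>lborel)"
proof -
  define f where "f x h = \<phi> h * (indicator D x * indicator D (x + h) * ennreal (\<bar>v (x + h) - v x\<bar> powr p))"
    for x h
  have "(\<integral>\<^sup>+x\<in>D. (\<integral>\<^sup>+y\<in>D. \<phi> (x - y) * ennreal (\<bar>v x - v y\<bar> powr p) \<partial>lborel) \<partial>lborel)
     = (\<integral>\<^sup>+x. (\<integral>\<^sup>+y. \<phi> (x - y) * ennreal (\<bar>v x - v y\<bar> powr p) * indicator D y * indicator D x \<partial>lborel) \<partial>lborel)"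
    by (intro nn_integral_cong) (auto simp: nn_integral_multc)
  also have "\<dots> = (\<integral>\<^sup>+x. (\<integral>\<^sup>+h. f x h \<partial>lborel) \<partial>lborel)"
  proof (rule nn_integral_cong)
    fix x
    have "(\<integral>\<^sup>+y. \<phi> (x - y) * ennreal (\<bar>v x - v y\<bar> powr p) * indicator D y * indicator D x \<partial>lborel)
      = (\<integral>\<^sup>+h. \<phi> (x - (x + h)) * ennreal (\<bar>v x - v (x + h)\<bar> powr p) * indicator D (x + h) * indicator D x \<partial>lborel)"
      by (rule nn_integral_lborel_translate[symmetric]) measurable
    then show "(\<integral>\<^sup>+y. \<phi> (x - y) * ennreal (\<bar>v x - v y\<bar> powr p) * indicator D y * indicator D x \<partial>lborel)
      = (\<integral>\<^sup>+h. f x h \<partial>lborel)"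
      by (simp add: f_def even abs_minus_commute mult_ac)
  qed
  also have "\<dots> = (\<integral>\<^sup>+h. (\<integral>\<^sup>+x. f x h \<partial>lborel) \<partial>lborel)"
    unfolding f_def by (rule lborel_pair.Fubini') measurable
  also have "\<dots> = (\<integral>\<^sup>+h. \<phi> h * shift_energy p v D h \<partial>lborel)"
    unfolding f_def shift_energy_def by (intro nn_integral_cong nn_integral_cmult) measurable
  finally show ?thesis .
qed

lemma one_minus_two_powr_le:
  fixes t :: real
  assumes "0 \<le> t"
  shows "1 - 2 powr (- t) \<le> t"
proof -
  have "1 + (- t * ln 2) \<le> exp (- t * ln 2)" by (rule exp_ge_add_one_self)
  moreover have "t * ln 2 \<le> t * 1"
    using assms ln_2_less_1 by (intro mult_left_mono) auto
  ultimately show ?thesis by (simp add: powr_def)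
qed

text \<open>The unweighted inequality with the factor \<open>1 - \<delta>\<close>. In terms of increments, with \<open>F(r)\<close> the part of
  the energy carried by \<open>|h| < r\<close>, doubling gives \<open>F(r) \<le> 2 powr (p(1 - \<delta>)) * F(r/2)\<close>. So the annulus
  \<open>r/2 \<le> |h| < r\<close> carries at most \<open>p(1 - \<delta>)\<close> times the energy, and on it the weight \<open>|h| powr (- s)\<close>
  costs only \<open>r powr s\<close>; these costs form a convergent series as \<open>r\<close> is halved.\<close>

theorem fractional_poincare_convex:
  fixes v :: "'a::euclidean_space \<Rightarrow> real"
  assumes [measurable]: "v \<in> borel_measurable borel" "D \<in> sets borel"
    and "convex D" and diam: "\<And>x y. x \<in> D \<Longrightarrow> y \<in> D \<Longrightarrow> norm (x - y) < R" and "0 < R"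
    and p: "1 \<le> p" and \<delta>: "0 < \<delta>" "\<delta> < 1"
    and s: "s = real DIM('a) + p * \<delta>"
  shows "(\<integral>\<^sup>+x\<in>D. (\<integral>\<^sup>+y\<in>D. ennreal (\<bar>v x - v y\<bar> powr p) \<partial>lborel) \<partial>lborel)
    \<le> ennreal (3 * (p * (1 - \<delta>)) * R powr s)
       * (\<integral>\<^sup>+x\<in>D. (\<integral>\<^sup>+y\<in>D. ennreal (frac_kernel p s v x y) \<partial>lborel) \<partial>lborel)"
    (is "?L \<le> ennreal ?K * ?E")
proof (cases "?E = \<infinity>")
  case True
  have "0 < ?K" using assms by simp
  then have "ennreal ?K \<noteq> 0" by (metis ennreal_eq_0_iff not_le)
  then have "ennreal ?K * ?E = \<infinity>" unfolding True by (simp add: ennreal_mult_eq_top_iff)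
  then show ?thesis by simp
next
  case False
  define H where "H = shift_energy p v D"
  define k where "k h = ennreal (1 / norm h powr s)" for h :: 'a
  define F where "F r = (\<integral>\<^sup>+h. indicator {h. norm h < r} h * (k h * H h) \<partial>lborel)" for r :: real
  define G where "G r = (\<integral>\<^sup>+h. indicator {h. r / 2 \<le> norm h \<and> norm h < r} h * (k h * H h) \<partial>lborel)" for r :: real
  define J where "J r = (\<integral>\<^sup>+h. indicator {h. norm h < r} h * H h \<partial>lborel)" for r :: real
  define e where "e = enn2real ?E"
  define c where "c = p * (1 - \<delta>)"
  have c: "0 < c" using assms by (simp add: c_def)
  have s1: "1 \<le> s"
  proof -
    have "1 \<le> real DIM('a)" using DIM_positive[where 'a='a] by linarith
    moreover have "0 < p * \<delta>" using assms by simp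
    ultimately show ?thesis unfolding s by linarith
  qed
  have e: "?E = ennreal e" "0 \<le> e" using False by (auto simp: e_def less_top)
  have [measurable]: "H \<in> borel_measurable borel" unfolding H_def by measurable
  have [measurable]: "k \<in> borel_measurable borel" unfolding k_def by measurable
  have E: "?E = (\<integral>\<^sup>+h. k h * H h \<partial>lborel)"
    unfolding H_def
    by (subst double_integral_shift[symmetric])
       (auto simp: k_def frac_kernel_def ennreal_mult[symmetric])
  have L: "?L = J R"
  proof -
    have "J R = (\<integral>\<^sup>+x\<in>D. (\<integral>\<^sup>+y\<in>D. indicator {h. norm h < R} (x - y) * ennreal (\<bar>v x - v y\<bar> powr p) \<partial>lborel) \<partial>lborel)"
      unfolding J_def H_def by (subst double_integral_shift) (auto simp: indicator_def)
    also have "\<dots> = ?L"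
      using diam by (intro set_nn_integral_cong refl) (auto simp: indicator_def intro!: nn_integral_cong)
    finally show ?thesis by simp
  qed
  have FE: "F r \<le> ennreal e" for r
    unfolding F_def e(1)[symmetric] E by (intro nn_integral_mono) (auto simp: indicator_def)
  \<comment> \<open>Substitute \<open>2h\<close> for \<open>h\<close>: the volume element and the kernel give \<open>2 powr (n - s)\<close>, the doubling
    inequality gives \<open>2 powr p\<close>.\<close>
  have Fhalf: "F r \<le> ennreal (2 powr c) * F (r / 2)" for r
  proof -
    have "F r = ennreal (2 ^ DIM('a)) *
        (\<integral>\<^sup>+h. indicator {h. norm h < r} (2 *\<^sub>R h) * (k (2 *\<^sub>R h) * H (2 *\<^sub>R h)) \<partial>lborel)"
      unfolding F_def by (rule nn_integral_lborel_scale) auto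
    also have "\<dots> \<le> ennreal (2 ^ DIM('a)) *
        (\<integral>\<^sup>+h. ennreal (2 powr (p - s)) * (indicator {h. norm h < r / 2} h * (k h * H h)) \<partial>lborel)"
    proof (intro mult_left_mono nn_integral_mono)
      fix h :: 'a
      have "k (2 *\<^sub>R h) = ennreal (2 powr (- s)) * k h"
        by (simp add: k_def powr_mult powr_minus divide_inverse ennreal_mult[symmetric])
      then have "k (2 *\<^sub>R h) * H (2 *\<^sub>R h) \<le> (ennreal (2 powr (- s)) * k h) * (ennreal (2 powr p) * H h)"
        unfolding H_def using assms by (intro mult_mono shift_energy_double) auto
      also have "\<dots> = (ennreal (2 powr (- s)) * ennreal (2 powr p)) * (k h * H h)"
        by (simp only: ac_simps)
      also have "ennreal (2 powr (- s)) * ennreal (2 powr p) = ennreal (2 powr (p - s))"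
        by (subst ennreal_mult[symmetric]) (auto simp: powr_add[symmetric])
      finally show "indicator {h. norm h < r} (2 *\<^sub>R h) * (k (2 *\<^sub>R h) * H (2 *\<^sub>R h))
         \<le> ennreal (2 powr (p - s)) * (indicator {h. norm h < r / 2} h * (k h * H h))"
        by (auto simp: indicator_def)
    qed auto
    also have "\<dots> = (ennreal (2 ^ DIM('a)) * ennreal (2 powr (p - s))) * F (r / 2)"
      by (simp add: nn_integral_cmult F_def mult.assoc)
    also have "ennreal (2 ^ DIM('a)) * ennreal (2 powr (p - s)) = ennreal (2 powr c)"
      by (subst ennreal_mult[symmetric])
         (auto simp: powr_realpow[symmetric] powr_add[symmetric] s c_def algebra_simps simp del: powr_realpow)
    finally show ?thesis .
  qed
  \<comment> \<open>Finiteness of the energy allows the subtraction \<open>F r - F (r / 2)\<close>.\<close>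
  have Gsmall: "G r \<le> ennreal (c * e)" for r
  proof -
    have add: "F r = F (r / 2) + G r" if "0 < r"
    proof -
      have "F r = (\<integral>\<^sup>+h. indicator {h. norm h < r / 2} h * (k h * H h)
          + indicator {h. r / 2 \<le> norm h \<and> norm h < r} h * (k h * H h) \<partial>lborel)"
        unfolding F_def using that by (intro nn_integral_cong) (auto simp: indicator_def)
      then show ?thesis by (simp add: nn_integral_add F_def G_def)
    qed
    show ?thesis
    proof (cases "0 < r")
      case True
      obtain f1 where f1: "F r = ennreal f1" "0 \<le> f1"
        using FE[of r] by (metis ennreal_cases ennreal_neq_top neq_top_trans top.extremum_uniqueI)
      obtain f2 where f2: "F (r / 2) = ennreal f2" "0 \<le> f2"
        using FE[of "r/2"] by (metis ennreal_cases ennreal_neq_top neq_top_trans top.extremum_uniqueI)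
      obtain g where g: "G r = ennreal g" "0 \<le> g"
        using add[OF True] f1 by (metis ennreal_cases ennreal_neq_top add_top_right_ennreal ennreal_add_eq_top)
      have "f1 = f2 + g" using add[OF True] f1 f2 g by (simp add: ennreal_plus[symmetric] del: ennreal_plus)
      moreover have "f1 \<le> 2 powr c * f2"
        using Fhalf[of r] f1 f2 by (simp add: ennreal_mult[symmetric])
      then have "2 powr (- c) * f1 \<le> f2"
        by (simp add: powr_minus field_simps)
      moreover have "f1 \<le> e" using FE[of r] f1 e by simp
      ultimately have "g \<le> (1 - 2 powr (- c)) * f1" by (simp add: algebra_simps)
      also have "\<dots> \<le> c * f1"
        using one_minus_two_powr_le[of c] c f1 by (intro mult_right_mono) auto
      also have "\<dots> \<le> c * e" using \<open>f1 \<le> e\<close> c by simp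
      finally show ?thesis using g by (simp add: ennreal_leI)
    next
      case False
      then have "\<not> norm h < r" for h :: 'a using norm_ge_zero[of h] by linarith
      then have "G r = 0" unfolding G_def by simp
      then show ?thesis by simp
    qed
  qed
  have Hk: "H h \<le> ennreal (r powr s) * (k h * H h)" if "norm h < r" for r h
  proof (cases "h = 0")
    case True
    have "H 0 = 0" using p by (simp add: H_def shift_energy_def)
    then show ?thesis using True by simp
  next
    case False
    have "1 \<le> r powr s * (1 / norm h powr s)"
      using that False s1 by (simp add: powr_mono2)
    then have "1 \<le> ennreal (r powr s) * k h"
      unfolding k_def by (subst ennreal_mult[symmetric]) auto
    from mult_right_mono[OF this, of "H h"] show ?thesis by (simp add: mult.assoc)
  qed
  have Jstep: "J r \<le> J (r / 2) + ennreal (r powr s * (c * e))" for r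
  proof -
    have "J r \<le> (\<integral>\<^sup>+h. indicator {h. norm h < r / 2} h * H h
        + ennreal (r powr s) * (indicator {h. r / 2 \<le> norm h \<and> norm h < r} h * (k h * H h)) \<partial>lborel)"
      unfolding J_def using Hk[of _ r] by (intro nn_integral_mono) (auto simp: indicator_def)
    also have "\<dots> = J (r / 2) + ennreal (r powr s) * G r"
      by (simp add: nn_integral_add nn_integral_cmult J_def G_def)
    also have "\<dots> \<le> J (r / 2) + ennreal (r powr s) * ennreal (c * e)"
      by (intro add_left_mono mult_left_mono Gsmall) auto
    finally show ?thesis using c e by (simp add: ennreal_mult[symmetric])
  qed
  have shrink: "(R / 2 ^ m) powr s \<le> (1 / 2) ^ m * R powr s" for m
  proof -
    have "(R / 2 ^ m) powr s = R powr s * ((1 / 2) ^ m) powr s"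
      using \<open>0 < R\<close> by (simp add: powr_divide power_divide powr_mult)
    also have "((1 / 2 :: real) ^ m) powr s \<le> ((1 / 2) ^ m) powr 1"
      using s1 by (intro powr_mono') (auto simp: power_le_one)
    finally show ?thesis using \<open>0 < R\<close> by (simp add: mult.commute)
  qed
  \<comment> \<open>Finitely many halvings suffice: what remains is bounded by \<open>(1 / 2) ^ m\<close> times the full energy,
    and this is below \<open>c\<close> times the energy for large \<open>m\<close>.\<close>
  have iter: "J R \<le> J (R / 2 ^ m) + ennreal (2 * (1 - (1 / 2) ^ m) * R powr s * (c * e))" for m
  proof (induction m)
    case (Suc m)
    let ?A = "(1 / 2) ^ m * R powr s * (c * e)"
    let ?B = "2 * (1 - (1 / 2) ^ m) * R powr s * (c * e)"
    have nn: "0 \<le> ?A" "0 \<le> ?B"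
      using c e by (auto intro!: mult_nonneg_nonneg simp: power_le_one)
    have "(R / 2 ^ m) powr s * (c * e) \<le> ?A"
      using shrink[of m] c e by (intro mult_right_mono) auto
    then have "J (R / 2 ^ m) \<le> J (R / 2 ^ m / 2) + ennreal ?A"
      using Jstep[of "R / 2 ^ m"] by (meson add_left_mono ennreal_leI order_trans)
    then have "J R \<le> (J (R / 2 ^ m / 2) + ennreal ?A) + ennreal ?B"
      using Suc by (meson add_right_mono order_trans)
    also have "\<dots> = J (R / 2 ^ m / 2) + ennreal (?A + ?B)"
      using nn by (simp add: add.assoc)
    also have "?A + ?B = 2 * (1 - (1 / 2) ^ Suc m) * R powr s * (c * e)"
      by (simp add: algebra_simps)
    also have "R / 2 ^ m / 2 = R / 2 ^ Suc m" by simp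
    finally show ?case .
  qed simp
  obtain m where m: "(1 / 2 :: real) ^ m < c" using c real_arch_pow_inv[of c "1/2"] by auto
  have "J (R / 2 ^ m) \<le> ennreal ((R / 2 ^ m) powr s) * ?E"
    unfolding J_def E using Hk[of _ "R / 2 ^ m"]
    by (subst nn_integral_cmult[symmetric]) (auto intro!: nn_integral_mono simp: indicator_def)
  also have "\<dots> \<le> ennreal (c * R powr s) * ennreal e"
    unfolding e(1)
  proof (intro mult_right_mono ennreal_leI)
    show "(R / 2 ^ m) powr s \<le> c * R powr s"
      using shrink[of m] mult_right_mono[of "(1/2)^m" c "R powr s"] m by simp
  qed auto
  also have "\<dots> = ennreal (R powr s * (c * e))"
    using c e by (subst ennreal_mult[symmetric]) (auto simp: mult_ac)
  finally have tail: "J (R / 2 ^ m) \<le> ennreal (R powr s * (c * e))" .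
  have "?L \<le> ennreal (R powr s * (c * e)) + ennreal (2 * (1 - (1 / 2) ^ m) * R powr s * (c * e))"
    unfolding L using iter[of m] tail by (meson add_right_mono order_trans)
  also have "\<dots> = ennreal (R powr s * (c * e) + 2 * (1 - (1 / 2) ^ m) * R powr s * (c * e))"
    using c e by (intro ennreal_plus[symmetric] mult_nonneg_nonneg) (auto simp: power_le_one)
  also have "\<dots> \<le> ennreal (3 * c * R powr s * e)"
    using c e by (intro ennreal_leI) (simp add: algebra_simps)
  also have "\<dots> = ennreal ?K * ?E"
    unfolding e(1) using c e by (subst ennreal_mult[symmetric]) (auto simp: c_def)
  finally show ?thesis .
qed

section \<open>Grids of cubes and averages over their cells\<close>

definition half_open_cube :: "real ^ 'n::finite \<Rightarrow> real \<Rightarrow> (real ^ 'n) set" where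
  "half_open_cube c s = {y. \<forall>i. c $ i \<le> y $ i \<and> y $ i < c $ i + s}"

text \<open>The cell that contains \<open>x\<close> in the grid of mesh \<open>s\<close> through \<open>a\<close>. Indexing cells by their points makes
  the indicator of "same cell" a symmetric kernel on pairs of points, so that sums over cells become
  integrals and Fubini replaces all bookkeeping.\<close>

definition grid_cell :: "real ^ 'n::finite \<Rightarrow> real \<Rightarrow> real ^ 'n \<Rightarrow> (real ^ 'n) set" where
  "grid_cell a s x = {y. \<forall>i. \<lfloor>(y $ i - a $ i) / s\<rfloor> = \<lfloor>(x $ i - a $ i) / s\<rfloor>}"

lemma half_open_cube_eq_Inter:
  "half_open_cube c s = (\<Inter>i. {y. c $ i \<le> y $ i} \<inter> {y. y $ i < c $ i + s})"
  by (auto simp: half_open_cube_def)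

lemma half_open_cube_measurable [measurable]: "half_open_cube c s \<in> sets borel"
  unfolding half_open_cube_eq_Inter
  by (intro sets.countable_INT'' sets.Int countable_finite) auto

lemma convex_half_open_cube: "convex (half_open_cube c s)"
proof -
  have 1: "convex {y :: real ^ 'n. c $ i \<le> y $ i}" for c :: "real ^ 'n" and i
    using convex_halfspace_ge[of "c $ i" "axis i 1 :: real ^ 'n"]
    by (simp add: inner_axis' )
  have 2: "convex {y :: real ^ 'n. y $ i < c $ i + s}" for c :: "real ^ 'n" and i
    using convex_halfspace_lt[of "axis i 1 :: real ^ 'n" "c $ i + s"]
    by (simp add: inner_axis')
  show ?thesis unfolding half_open_cube_eq_Inter
    by (intro convex_INT convex_Int 1 2)
qed

lemma half_open_cube_diam:
  fixes x y c :: "real ^ 'n::finite"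
  assumes "x \<in> half_open_cube c s" "y \<in> half_open_cube c s"
  shows "norm (x - y) < real CARD('n) * s"
proof -
  have "norm (x - y) \<le> (\<Sum>i\<in>UNIV. \<bar>(x - y) $ i\<bar>)" by (rule norm_le_l1_cart)
  also have "\<dots> < (\<Sum>i\<in>(UNIV :: 'n set). s)"
  proof (intro sum_strict_mono)
    fix i
    have "c $ i \<le> x $ i" "x $ i < c $ i + s" "c $ i \<le> y $ i" "y $ i < c $ i + s"
      using assms by (auto simp: half_open_cube_def)
    then show "\<bar>(x - y) $ i\<bar> < s" by (simp add: abs_less_iff)
  qed auto
  finally show ?thesis by simp
qed

lemma emeasure_half_open_cube:
  fixes c :: "real ^ 'n::finite"
  assumes "0 \<le> s"
  shows "emeasure lborel (half_open_cube c s) = ennreal (s ^ CARD('n))"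
proof -
  define d :: "real ^ 'n" where "d = (\<chi> i. c $ i + s)"
  have b: "(d - c) \<bullet> b = s" if "b \<in> Basis" for b
    using that by (auto simp: Basis_vec_def d_def inner_axis)
  have le: "c \<bullet> b \<le> d \<bullet> b" if "b \<in> Basis" for b
    using b[OF that] assms by (simp add: inner_diff_left)
  have vol: "(\<Prod>b\<in>Basis. (d - c) \<bullet> b) = s ^ CARD('n)" using b by simp
  have "box c d \<subseteq> half_open_cube c s" "half_open_cube c s \<subseteq> cbox c d"
    by (auto simp: half_open_cube_def mem_box_cart d_def) (meson less_imp_le)+
  then have "emeasure lborel (box c d) \<le> emeasure lborel (half_open_cube c s)"
    "emeasure lborel (half_open_cube c s) \<le> emeasure lborel (cbox c d)"
    by (auto intro!: emeasure_mono)
  then show ?thesis using le vol by (simp add: antisym)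
qed

lemma grid_cell_sym: "y \<in> grid_cell a s x \<longleftrightarrow> x \<in> grid_cell a s y"
  by (auto simp: grid_cell_def)

lemma grid_cell_self [simp]: "x \<in> grid_cell a s x"
  by (auto simp: grid_cell_def)

lemma grid_cell_eq: "y \<in> grid_cell a s x \<Longrightarrow> grid_cell a s y = grid_cell a s x"
  by (auto simp: grid_cell_def)

lemma floor_eq_iff_scaled:
  fixes y a s :: real and k :: int
  assumes "0 < s"
  shows "\<lfloor>(y - a) / s\<rfloor> = k \<longleftrightarrow> a + s * of_int k \<le> y \<and> y < a + s * of_int k + s"
proof -
  have "\<lfloor>(y - a) / s\<rfloor> = k \<longleftrightarrow> of_int k \<le> (y - a) / s \<and> (y - a) / s < of_int k + 1"
    by (rule floor_eq_iff)
  then show ?thesis using assms by (simp add: field_simps)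
qed

lemma grid_cell_eq_half_open_cube:
  assumes "0 < s"
  shows "grid_cell a s x = half_open_cube (\<chi> i. a $ i + s * of_int \<lfloor>(x $ i - a $ i) / s\<rfloor>) s"
  using assms unfolding grid_cell_def half_open_cube_def
  by (simp add: floor_eq_iff_scaled)

lemma grid_cell_diam:
  fixes x y a :: "real ^ 'n::finite"
  assumes s: "0 < s" and y: "y \<in> grid_cell a s x"
  shows "norm (x - y) < real CARD('n) * s"
proof -
  let ?c = "(\<chi> i. a $ i + s * of_int \<lfloor>(x $ i - a $ i) / s\<rfloor>) :: real ^ 'n"
  have "x \<in> half_open_cube ?c s" "y \<in> half_open_cube ?c s"
    using y grid_cell_self[of x a s] by (simp_all add: grid_cell_eq_half_open_cube[OF s])
  then show ?thesis by (rule half_open_cube_diam)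
qed

lemma grid_cell_corner:
  assumes "0 < s" "x \<in> half_open_cube a s"
  shows "grid_cell a s x = half_open_cube a s"
proof -
  have "\<lfloor>(x $ i - a $ i) / s\<rfloor> = 0" for i
    using assms by (subst floor_eq_iff_scaled) (auto simp: half_open_cube_def)
  then show ?thesis using assms by (simp add: grid_cell_eq_half_open_cube)
qed

lemma grid_cell_refine:
  assumes "0 < m"
  shows "grid_cell a (s / real m) x \<subseteq> grid_cell a s x"
proof -
  have fl: "\<lfloor>t / s\<rfloor> = \<lfloor>t / (s / real m)\<rfloor> div int m" for t
  proof -
    have "t / s = (t / (s / real m)) / real m" using assms by (simp add: field_simps)
    then show ?thesis using floor_divide_real_eq_div[of "int m" "t / (s / real m)"] by simp
  qed
  show ?thesis by (rule subsetI) (simp only: grid_cell_def fl mem_Collect_eq simp_thms)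
qed

lemma grid_cell_subset_cube:
  assumes "0 < s" "0 < m" "x \<in> half_open_cube a s"
  shows "grid_cell a (s / real m) x \<subseteq> half_open_cube a s"
  using grid_cell_refine[OF assms(2), of a s x] grid_cell_corner[OF assms(1,3)] by simp

lemma grid_cell_measurable [measurable]: "0 < s \<Longrightarrow> grid_cell a s x \<in> sets borel"
  by (simp add: grid_cell_eq_half_open_cube)

lemma emeasure_grid_cell:
  "0 < s \<Longrightarrow> emeasure lborel (grid_cell a s x :: (real ^ 'n::finite) set) = ennreal (s ^ CARD('n))"
  by (simp add: grid_cell_eq_half_open_cube emeasure_half_open_cube)

lemma indicator_grid_cell_measurable [measurable]:
  assumes [measurable]: "f \<in> measurable M borel" "g \<in> measurable M borel"
  shows "(\<lambda>z. indicator (grid_cell a s (f z)) (g z :: real ^ 'n::finite) :: ennreal) \<in> borel_measurable M"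
proof -
  have comp [measurable]: "(\<lambda>z. h z $ i) \<in> borel_measurable M"
    if "h \<in> measurable M borel" for h :: "'a \<Rightarrow> real ^ 'n" and i
    using measurable_compose[OF that borel_measurable_nth] .
  have fl [measurable]: "(\<lambda>z. real_of_int \<lfloor>(h z $ i - a $ i) / s\<rfloor>) \<in> borel_measurable M"
    if [measurable]: "h \<in> measurable M borel" for h :: "'a \<Rightarrow> real ^ 'n" and i
    by (rule measurable_compose[OF _ borel_measurable_real_floor]) measurable
  have "Measurable.pred M (\<lambda>z. real_of_int \<lfloor>(g z $ i - a $ i) / s\<rfloor> = real_of_int \<lfloor>(f z $ i - a $ i) / s\<rfloor>)" for i
    by measurable
  then have [measurable]: "Measurable.pred M (\<lambda>z. \<lfloor>(g z $ i - a $ i) / s\<rfloor> = \<lfloor>(f z $ i - a $ i) / s\<rfloor>)" for i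
    by simp
  have "Measurable.pred M (\<lambda>z. \<forall>i\<in>UNIV. \<lfloor>(g z $ i - a $ i) / s\<rfloor> = \<lfloor>(f z $ i - a $ i) / s\<rfloor>)"
    by (intro pred_intros_finite) auto
  then have [measurable]: "Measurable.pred M (\<lambda>z. g z \<in> grid_cell a s (f z))"
    by (simp add: grid_cell_def)
  have "(\<lambda>z. indicator (grid_cell a s (f z)) (g z) :: ennreal)
     = (\<lambda>z. if g z \<in> grid_cell a s (f z) then 1 else 0)"
    by (auto simp: indicator_def)
  then show ?thesis by simp
qed

text \<open>The conditional expectation of \<open>f\<close> on the grid.\<close>

definition cell_avg :: "real ^ 'n::finite \<Rightarrow> real \<Rightarrow> (real ^ 'n \<Rightarrow> ennreal) \<Rightarrow> real ^ 'n \<Rightarrow> ennreal" where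
  "cell_avg a s f x =
     ennreal (1 / s ^ CARD('n)) * (\<integral>\<^sup>+y. indicator (grid_cell a s x) y * f y \<partial>lborel)"

lemma cell_avg_measurable [measurable]:
  assumes [measurable]: "f \<in> borel_measurable borel"
  shows "cell_avg a s f \<in> borel_measurable borel"
  unfolding cell_avg_def by measurable

lemma cell_avg_measurable2 [measurable]:
  assumes [measurable]: "(\<lambda>(x, y). f x y) \<in> borel_measurable (M \<Otimes>\<^sub>M lborel)" "g \<in> measurable M borel"
  shows "(\<lambda>x. cell_avg a s (f x) (g x)) \<in> borel_measurable M"
  unfolding cell_avg_def by measurable

text \<open>The kernel of the averaging operator is symmetric.\<close>

lemma cell_avg_self_adjoint:
  assumes [measurable]: "f \<in> borel_measurable borel" "g \<in> borel_measurable borel"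
  shows "(\<integral>\<^sup>+x. cell_avg a s f x * g x \<partial>lborel) = (\<integral>\<^sup>+x. f x * cell_avg a s g x \<partial>lborel)"
proof -
  let ?c = "ennreal (1 / s ^ CARD('a))"
  let ?k = "\<lambda>x y. indicator (grid_cell a s x) y :: ennreal"
  have "(\<integral>\<^sup>+x. cell_avg a s f x * g x \<partial>lborel)
      = (\<integral>\<^sup>+x. (\<integral>\<^sup>+y. ?c * (?k x y * f y) * g x \<partial>lborel) \<partial>lborel)"
    unfolding cell_avg_def
    by (intro nn_integral_cong) (simp add: nn_integral_cmult nn_integral_multc)
  also have "\<dots> = (\<integral>\<^sup>+y. (\<integral>\<^sup>+x. ?c * (?k x y * f y) * g x \<partial>lborel) \<partial>lborel)"
    by (rule lborel_pair.Fubini') measurable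
  also have "\<dots> = (\<integral>\<^sup>+y. (\<integral>\<^sup>+x. (?c * f y) * (?k y x * g x) \<partial>lborel) \<partial>lborel)"
    by (intro nn_integral_cong) (auto simp: indicator_def grid_cell_sym mult_ac)
  also have "\<dots> = (\<integral>\<^sup>+y. f y * cell_avg a s g y \<partial>lborel)"
    unfolding cell_avg_def
    by (intro nn_integral_cong) (subst nn_integral_cmult, auto simp: mult_ac)
  finally show ?thesis .
qed

lemma cell_avg_const [simp]:
  fixes x :: "real ^ 'n::finite"
  assumes "0 < s" shows "cell_avg a s (\<lambda>_. c) x = c"
proof -
  have "ennreal (1 / s ^ CARD('n)) * ennreal (s ^ CARD('n)) = 1"
    using assms by (subst ennreal_mult[symmetric]) auto
  then show ?thesis
    using assms by (simp add: cell_avg_def nn_integral_multc emeasure_grid_cell mult.assoc[symmetric])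
qed

lemma cell_avg_cong:
  assumes "\<And>y. y \<in> grid_cell a s x \<Longrightarrow> f y = g y"
  shows "cell_avg a s f x = cell_avg a s g x"
proof -
  have "indicator (grid_cell a s x) y * f y = indicator (grid_cell a s x) y * g y" for y
    using assms[of y] by (auto simp: indicator_def)
  then show ?thesis by (simp add: cell_avg_def)
qed

lemma cell_avg_mono:
  assumes "\<And>y. y \<in> grid_cell a s x \<Longrightarrow> f y \<le> g y"
  shows "cell_avg a s f x \<le> cell_avg a s g x"
proof -
  have "indicator (grid_cell a s x) y * f y \<le> indicator (grid_cell a s x) y * g y" for y
    using assms[of y] by (auto simp: indicator_def)
  then have "(\<integral>\<^sup>+y. indicator (grid_cell a s x) y * f y \<partial>lborel)
      \<le> (\<integral>\<^sup>+y. indicator (grid_cell a s x) y * g y \<partial>lborel)"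
    by (rule nn_integral_mono)
  then show ?thesis unfolding cell_avg_def by (rule mult_left_mono) simp
qed

lemma cell_avg_cmult:
  assumes [measurable]: "f \<in> borel_measurable borel" and "0 < s"
  shows "cell_avg a s (\<lambda>y. c * f y) x = c * cell_avg a s f x"
proof -
  have [measurable]: "grid_cell a s x \<in> sets borel" using assms by measurable
  have "(\<integral>\<^sup>+y. indicator (grid_cell a s x) y * (c * f y) \<partial>lborel)
      = (\<integral>\<^sup>+y. c * (indicator (grid_cell a s x) y * f y) \<partial>lborel)"
    by (simp add: mult_ac)
  also have "\<dots> = c * (\<integral>\<^sup>+y. indicator (grid_cell a s x) y * f y \<partial>lborel)"
    by (rule nn_integral_cmult) measurable
  finally show ?thesis by (simp add: cell_avg_def mult_ac)
qed

lemma cell_avg_add: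
  assumes [measurable]: "f \<in> borel_measurable borel" "g \<in> borel_measurable borel" and "0 < s"
  shows "cell_avg a s (\<lambda>y. f y + g y) x = cell_avg a s f x + cell_avg a s g x"
proof -
  have [measurable]: "grid_cell a s x \<in> sets borel" using assms by measurable
  show ?thesis
    by (simp add: cell_avg_def distrib_left nn_integral_add)
qed

lemma cell_avg_indicator:
  assumes "\<And>x. x \<in> Q \<Longrightarrow> grid_cell a s x \<subseteq> Q"
  shows "cell_avg a s (\<lambda>y. indicator Q y * f y) x = indicator Q x * cell_avg a s f x"
proof (cases "x \<in> Q")
  case True
  then have "cell_avg a s (\<lambda>y. indicator Q y * f y) x = cell_avg a s f x"
    using assms by (intro cell_avg_cong) (auto simp: indicator_def)
  then show ?thesis using True by simp
next
  case False
  then have "y \<in> grid_cell a s x \<Longrightarrow> y \<notin> Q" for y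
    using assms[of y] by (auto simp: grid_cell_sym)
  then have "cell_avg a s (\<lambda>y. indicator Q y * f y) x = cell_avg a s (\<lambda>_. 0) x"
    by (intro cell_avg_cong) (auto simp: indicator_def)
  then show ?thesis using False by (simp add: cell_avg_def)
qed

text \<open>Cells of a finer grid lie inside cells of the coarser one, so the finer average fixes the indicator of
  a coarse cell; self-adjointness moves the finer average from \<open>f\<close> onto this indicator.\<close>

lemma cell_avg_tower:
  assumes [measurable]: "f \<in> borel_measurable borel" and "0 < s" "0 < m"
  shows "cell_avg a s (cell_avg a (s / real m) f) x = cell_avg a s f x"
proof -
  have [measurable]: "grid_cell a s x \<in> sets borel" using assms by measurable
  have sub: "grid_cell a (s / real m) y \<subseteq> grid_cell a s x" if "y \<in> grid_cell a s x" for y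
    using grid_cell_refine[OF \<open>0 < m\<close>, of a s y] grid_cell_eq[OF that] by simp
  have ind: "cell_avg a (s / real m) (indicator (grid_cell a s x)) y = indicator (grid_cell a s x) y" for y
    using cell_avg_indicator[of "grid_cell a s x" a "s / real m" "\<lambda>_. 1" y, OF sub] assms by simp
  have "(\<integral>\<^sup>+y. indicator (grid_cell a s x) y * cell_avg a (s / real m) f y \<partial>lborel)
      = (\<integral>\<^sup>+y. indicator (grid_cell a s x) y * f y \<partial>lborel)"
    by (subst cell_avg_self_adjoint[symmetric]) (auto simp: ind)
  then show ?thesis by (simp add: cell_avg_def)
qed

lemma cell_avg_refine_le:
  fixes x :: "real ^ 'n::finite"
  assumes "0 < s" "0 < m"
  shows "cell_avg a (s / real m) f x \<le> ennreal (real m ^ CARD('n)) * cell_avg a s f x"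
proof -
  have "cell_avg a (s / real m) f x
     \<le> ennreal (1 / (s / real m) ^ CARD('n)) * (\<integral>\<^sup>+y. indicator (grid_cell a s x) y * f y \<partial>lborel)"
    unfolding cell_avg_def using grid_cell_refine[OF assms(2), of a s x]
    by (intro mult_left_mono nn_integral_mono) (auto simp: indicator_def)
  also have "ennreal (1 / (s / real m) ^ CARD('n)) = ennreal (real m ^ CARD('n)) * ennreal (1 / s ^ CARD('n))"
    using assms by (subst ennreal_mult[symmetric]) (auto simp: power_divide)
  finally show ?thesis by (simp add: cell_avg_def mult.assoc)
qed

text \<open>The \<open>A\<^sub>1\<close> condition with the essential infimum spelled out as an inequality almost everywhere. Only
  half-open cubes are tested, since these tile space.\<close>

definition A1_ae :: "(real ^ 'n::finite \<Rightarrow> ennreal) \<Rightarrow> real \<Rightarrow> bool" where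
  "A1_ae W C \<longleftrightarrow> (\<forall>c s. 0 < s \<longrightarrow> (AE x in lborel. x \<in> half_open_cube c s \<longrightarrow>
     (\<integral>\<^sup>+y\<in>half_open_cube c s. W y \<partial>lborel) \<le> ennreal (C * s ^ CARD('n)) * W x))"

text \<open>The exceptional null set in the \<open>A\<^sub>1\<close> condition depends on the cube, but a grid has only countably many
  cells.\<close>

lemma cell_avg_le_of_A1_ae:
  fixes W :: "real ^ 'n::finite \<Rightarrow> ennreal"
  assumes A1: "A1_ae W C" and s: "0 < s" and C: "0 \<le> C"
  shows "AE x in lborel. cell_avg a s W x \<le> ennreal C * W x"
proof -
  define corner where "corner k = (\<chi> i. a $ i + s * of_int (k i))" for k :: "'n \<Rightarrow> int"
  have "AE x in lborel. \<forall>k. x \<in> half_open_cube (corner k) s \<longrightarrow>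
     (\<integral>\<^sup>+y\<in>half_open_cube (corner k) s. W y \<partial>lborel) \<le> ennreal (C * s ^ CARD('n)) * W x"
    unfolding AE_all_countable using A1 s by (auto simp: A1_ae_def)
  then show ?thesis
  proof eventually_elim
    case (elim x)
    define k where "k i = \<lfloor>(x $ i - a $ i) / s\<rfloor>" for i
    have cell: "grid_cell a s x = half_open_cube (corner k) s"
      using s by (simp add: grid_cell_eq_half_open_cube corner_def k_def)
    then have "x \<in> half_open_cube (corner k) s" using grid_cell_self[of x a s] by simp
    then have "(\<integral>\<^sup>+y. indicator (grid_cell a s x) y * W y \<partial>lborel) \<le> ennreal (C * s ^ CARD('n)) * W x"
      using elim cell by (simp add: mult.commute)
    then have "cell_avg a s W x \<le> ennreal (1 / s ^ CARD('n)) * (ennreal (C * s ^ CARD('n)) * W x)"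
      unfolding cell_avg_def by (intro mult_left_mono) auto
    also have "\<dots> = ennreal C * W x"
      unfolding mult.assoc[symmetric] using s C by (subst ennreal_mult[symmetric]) auto
    finally show ?case .
  qed
qed

section \<open>A weighted fractional Poincare inequality\<close>

definition frac_energy ::
  "real \<Rightarrow> real \<Rightarrow> ('a::euclidean_space \<Rightarrow> real) \<Rightarrow> ('a \<Rightarrow> ennreal) \<Rightarrow> 'a set \<Rightarrow> ennreal" where
  "frac_energy p s v W Q = (\<integral>\<^sup>+y. indicator Q y * W y *
     (\<integral>\<^sup>+z. indicator Q z * ennreal (frac_kernel p s v y z) \<partial>lborel) \<partial>lborel)"

text \<open>The \<open>L\<^sup>p(W)\<close> distance, to the power \<open>p\<close>, between \<open>v\<close> and its values at a random point of the same
  cell.\<close>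

definition osc :: "real \<Rightarrow> (real ^ 'n::finite \<Rightarrow> real) \<Rightarrow> (real ^ 'n \<Rightarrow> ennreal) \<Rightarrow> (real ^ 'n) set
    \<Rightarrow> real ^ 'n \<Rightarrow> real \<Rightarrow> ennreal" where
  "osc p v W Q a s = (\<integral>\<^sup>+y. indicator Q y * W y *
     cell_avg a s (\<lambda>z. ennreal (\<bar>v y - v z\<bar> powr p)) y \<partial>lborel)"

lemma ennreal_powr_add_le_weighted:
  assumes "1 \<le> p" "0 < a" "0 < b" "\<bar>z\<bar> \<le> \<bar>x\<bar> + \<bar>y\<bar>"
  shows "ennreal (\<bar>z\<bar> powr p) \<le> ennreal ((a + b) powr (p - 1) * a powr (1 - p)) * ennreal (\<bar>x\<bar> powr p)
     + ennreal ((a + b) powr (p - 1) * b powr (1 - p)) * ennreal (\<bar>y\<bar> powr p)"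
proof -
  have "\<bar>z\<bar> powr p \<le> (\<bar>x\<bar> + \<bar>y\<bar>) powr p"
    using assms by (intro powr_mono2) auto
  also have "\<dots> \<le> (a + b) powr (p - 1) * (a powr (1 - p) * \<bar>x\<bar> powr p + b powr (1 - p) * \<bar>y\<bar> powr p)"
    using assms by (intro powr_add_le_weighted) auto
  finally show ?thesis
    by (simp add: ennreal_mult[symmetric] ennreal_plus[symmetric] distrib_left mult.assoc ennreal_leI
        del: ennreal_plus)
qed

text \<open>One refinement of the weight. Compare \<open>v y\<close> with \<open>v z\<close> for \<open>z\<close> in the cell of \<open>y\<close> and average over \<open>z\<close>: the
  term with \<open>v y - v z\<close> is an oscillation, and in the term with \<open>v z\<close> the average moves onto the
  weight by self-adjointness. So a bound for \<open>\<integral> |v|\<^sup>p\<close> against the averaged weight becomes one against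
  \<open>W\<close>. The averages fall on the weight, so that only powers of \<open>|v|\<close> are ever integrated.\<close>

lemma cell_step:
  assumes [measurable]: "v \<in> borel_measurable borel" "W \<in> borel_measurable borel" "Q \<in> sets borel"
    and s: "0 < s" and cl: "\<And>x. x \<in> Q \<Longrightarrow> grid_cell a s x \<subseteq> Q"
    and p: "1 \<le> p" and ab: "0 < \<alpha>" "0 < \<beta>"
    and 1: "(\<integral>\<^sup>+y. indicator Q y * cell_avg a s W y * ennreal (\<bar>v y\<bar> powr p) \<partial>lborel) \<le> ennreal (\<alpha> powr p) * B"
    and 2: "osc p v W Q a s \<le> ennreal (\<beta> powr p) * B"
  shows "(\<integral>\<^sup>+y. indicator Q y * W y * ennreal (\<bar>v y\<bar> powr p) \<partial>lborel) \<le> ennreal ((\<alpha> + \<beta>) powr p) * B"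
proof -
  define c1 where "c1 = (\<alpha> + \<beta>) powr (p - 1) * \<alpha> powr (1 - p)"
  define c2 where "c2 = (\<alpha> + \<beta>) powr (p - 1) * \<beta> powr (1 - p)"
  let ?f = "\<lambda>y. ennreal (\<bar>v y\<bar> powr p)"
  let ?d = "\<lambda>y. cell_avg a s (\<lambda>z. ennreal (\<bar>v y - v z\<bar> powr p)) y"
  have pw: "?f y \<le> ennreal c1 * cell_avg a s ?f y + ennreal c2 * ?d y" for y
  proof -
    have "?f y = cell_avg a s (\<lambda>_. ?f y) y" using s by simp
    also have "\<dots> \<le> cell_avg a s (\<lambda>z. ennreal c1 * ?f z + ennreal c2 * ennreal (\<bar>v y - v z\<bar> powr p)) y"
      unfolding c1_def c2_def using p ab
      by (intro cell_avg_mono ennreal_powr_add_le_weighted) auto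
    also have "\<dots> = ennreal c1 * cell_avg a s ?f y + ennreal c2 * ?d y"
      using s by (simp add: cell_avg_add cell_avg_cmult)
    finally show ?thesis .
  qed
  have "(\<integral>\<^sup>+y. indicator Q y * W y * ?f y \<partial>lborel)
     \<le> (\<integral>\<^sup>+y. ennreal c1 * ((indicator Q y * W y) * cell_avg a s ?f y)
          + ennreal c2 * (indicator Q y * W y * ?d y) \<partial>lborel)"
  proof (rule nn_integral_mono)
    fix y
    from mult_left_mono[OF pw[of y], of "indicator Q y * W y"]
    show "indicator Q y * W y * ?f y \<le> ennreal c1 * ((indicator Q y * W y) * cell_avg a s ?f y)
          + ennreal c2 * (indicator Q y * W y * ?d y)"
      by (simp add: distrib_left mult_ac)
  qed
  also have "\<dots> = ennreal c1 * (\<integral>\<^sup>+y. (indicator Q y * W y) * cell_avg a s ?f y \<partial>lborel)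
       + ennreal c2 * osc p v W Q a s"
    unfolding osc_def by (simp add: nn_integral_add nn_integral_cmult)
  also have "(\<integral>\<^sup>+y. (indicator Q y * W y) * cell_avg a s ?f y \<partial>lborel)
      = (\<integral>\<^sup>+y. indicator Q y * cell_avg a s W y * ?f y \<partial>lborel)"
    by (subst cell_avg_self_adjoint[symmetric]) (auto simp: cell_avg_indicator[OF cl])
  also have "ennreal c1 * (\<integral>\<^sup>+y. indicator Q y * cell_avg a s W y * ?f y \<partial>lborel) + ennreal c2 * osc p v W Q a s
     \<le> ennreal c1 * (ennreal (\<alpha> powr p) * B) + ennreal c2 * (ennreal (\<beta> powr p) * B)"
    by (intro add_mono mult_left_mono 1 2) auto
  also have "\<dots> = ennreal (c1 * \<alpha> powr p + c2 * \<beta> powr p) * B"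
    by (simp add: c1_def c2_def ennreal_mult mult.assoc distrib_right)
  also have "c1 * \<alpha> powr p + c2 * \<beta> powr p = (\<alpha> + \<beta>) powr p"
  proof -
    have "\<alpha> powr (1 - p) * \<alpha> powr p = \<alpha>" "\<beta> powr (1 - p) * \<beta> powr p = \<beta>"
      using ab by (simp_all add: powr_add[symmetric])
    then have "c1 * \<alpha> powr p + c2 * \<beta> powr p = (\<alpha> + \<beta>) powr (p - 1) * (\<alpha> + \<beta>)"
      by (simp add: c1_def c2_def mult.assoc distrib_left)
    then show ?thesis using ab by (simp add: powr_diff)
  qed
  finally show ?thesis .
qed

lemma powr_diff_le_frac_kernel:
  assumes "norm (x - y) \<le> R" "0 \<le> s" "1 \<le> p"
  shows "\<bar>v x - v y\<bar> powr p \<le> R powr s * frac_kernel p s v x y"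
proof (cases "x = y")
  case False
  then have "1 \<le> R powr s / norm (x - y) powr s"
    using assms by (simp add: powr_mono2)
  from mult_right_mono[OF this, of "\<bar>v x - v y\<bar> powr p"]
  show ?thesis by (simp add: frac_kernel_def)
qed (auto simp: frac_kernel_def)

text \<open>Points of one cell are at distance less than \<open>n r\<close>, so the kernel is bounded below there.\<close>

lemma osc_le_frac_energy:
  fixes v :: "real ^ 'n::finite \<Rightarrow> real"
  assumes [measurable]: "v \<in> borel_measurable borel" "W \<in> borel_measurable borel" "Q \<in> sets borel"
    and r: "0 < r" and cl: "\<And>x. x \<in> Q \<Longrightarrow> grid_cell a r x \<subseteq> Q"
    and p: "1 \<le> p" and s: "0 \<le> s"
  shows "osc p v W Q a r
    \<le> ennreal (real CARD('n) powr s * r powr (s - real CARD('n))) * frac_energy p s v W Q"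
proof -
  let ?n = "real CARD('n)"
  let ?k = "\<lambda>y z. ennreal (frac_kernel p s v y z)"
  have "cell_avg a r (\<lambda>z. ennreal (\<bar>v y - v z\<bar> powr p)) y
     \<le> ennreal (?n powr s * r powr (s - ?n)) * (\<integral>\<^sup>+z. indicator Q z * ?k y z \<partial>lborel)" if "y \<in> Q" for y
  proof -
    have "cell_avg a r (\<lambda>z. ennreal (\<bar>v y - v z\<bar> powr p)) y
      \<le> cell_avg a r (\<lambda>z. ennreal ((?n * r) powr s) * ?k y z) y"
    proof (rule cell_avg_mono)
      fix z assume "z \<in> grid_cell a r y"
      then have "norm (y - z) < ?n * r"
        by (rule grid_cell_diam[OF r])
      then have "\<bar>v y - v z\<bar> powr p \<le> (?n * r) powr s * frac_kernel p s v y z"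
        using p s by (intro powr_diff_le_frac_kernel) auto
      then show "ennreal (\<bar>v y - v z\<bar> powr p) \<le> ennreal ((?n * r) powr s) * ?k y z"
        by (simp add: ennreal_mult[symmetric] ennreal_leI)
    qed
    also have "\<dots> = ennreal ((?n * r) powr s) * cell_avg a r (?k y) y"
      using r by (intro cell_avg_cmult) auto
    also have "\<dots> \<le> ennreal ((?n * r) powr s) * (ennreal (1 / r ^ CARD('n)) *
          (\<integral>\<^sup>+z. indicator Q z * ?k y z \<partial>lborel))"
      unfolding cell_avg_def using cl[OF that]
      by (intro mult_left_mono nn_integral_mono) (auto simp: indicator_def)
    also have "\<dots> = ennreal ((?n * r) powr s * (1 / r ^ CARD('n))) * (\<integral>\<^sup>+z. indicator Q z * ?k y z \<partial>lborel)"
      using r by (subst ennreal_mult) (auto simp: mult.assoc)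
    also have "(?n * r) powr s * (1 / r ^ CARD('n)) = ?n powr s * r powr (s - ?n)"
      using r by (simp add: powr_mult powr_diff powr_realpow)
    finally show ?thesis .
  qed
  then have "osc p v W Q a r \<le> (\<integral>\<^sup>+y. ennreal (?n powr s * r powr (s - ?n)) *
      (indicator Q y * W y * (\<integral>\<^sup>+z. indicator Q z * ?k y z \<partial>lborel)) \<partial>lborel)"
    unfolding osc_def
    by (intro nn_integral_mono) (auto simp: indicator_def mult.left_commute intro!: mult_left_mono)
  also have "\<dots> = ennreal (?n powr s * r powr (s - ?n)) * frac_energy p s v W Q"
    unfolding frac_energy_def by (rule nn_integral_cmult) measurable
  finally show ?thesis .
qed

text \<open>A weight that is constant on cells can be pulled out of the integrals over each cell, where
  \<open>fractional_poincare_convex\<close> applies; afterwards the \<open>A\<^sub>1\<close> condition replaces the averaged weight by \<open>C W\<close>. The sum over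
  cells is written as an average over \<open>x\<close> of double integrals over the cell of \<open>x\<close>.\<close>

lemma osc_averaged_weight_le:
  fixes v :: "real ^ 'n::finite \<Rightarrow> real"
  assumes [measurable]: "v \<in> borel_measurable borel" "W \<in> borel_measurable borel" "Q \<in> sets borel"
    and r: "0 < r" and cl: "\<And>x. x \<in> Q \<Longrightarrow> grid_cell a r x \<subseteq> Q"
    and p: "1 \<le> p" and \<delta>: "0 < \<delta>" "\<delta> < 1" and s: "s = real CARD('n) + p * \<delta>"
    and A1: "AE x in lborel. cell_avg a r W x \<le> ennreal C * W x" and C: "0 \<le> C"
  shows "osc p v (cell_avg a r W) Q a r
    \<le> ennreal (3 * (p * (1 - \<delta>)) * real CARD('n) powr s * r powr (p * \<delta>) * C) * frac_energy p s v W Q"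
proof -
  let ?n = "real CARD('n)"
  define \<kappa> where "\<kappa> = 3 * (p * (1 - \<delta>)) * (?n * r) powr s"
  have \<kappa>: "0 \<le> \<kappa>" using p \<delta> by (simp add: \<kappa>_def)
  define f where "f y z = ennreal (\<bar>v y - v z\<bar> powr p)" for y z
  define k where "k y z = ennreal (frac_kernel p s v y z)" for y z
  have [measurable]: "(\<lambda>(y, z). f y z) \<in> borel_measurable (borel \<Otimes>\<^sub>M borel)"
    "(\<lambda>(y, z). k y z) \<in> borel_measurable (borel \<Otimes>\<^sub>M borel)"
    unfolding f_def k_def by measurable
  have [measurable]: "(\<lambda>y. cell_avg a r (f y) y) \<in> borel_measurable borel"
    "(\<lambda>y. cell_avg a r (k y) y) \<in> borel_measurable borel"
    unfolding f_def k_def by measurable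
  have swap: "(\<integral>\<^sup>+y. indicator Q y * cell_avg a r W y * g y \<partial>lborel)
      = (\<integral>\<^sup>+x. W x * (indicator Q x * cell_avg a r g x) \<partial>lborel)"
    if [measurable]: "g \<in> borel_measurable borel" for g
  proof -
    have "(\<integral>\<^sup>+y. cell_avg a r W y * (indicator Q y * g y) \<partial>lborel)
        = (\<integral>\<^sup>+x. W x * cell_avg a r (\<lambda>y. indicator Q y * g y) x \<partial>lborel)"
      by (rule cell_avg_self_adjoint) measurable
    then show ?thesis by (simp add: cell_avg_indicator[OF cl] mult.left_commute mult.assoc)
  qed
  have cell: "cell_avg a r (\<lambda>y. cell_avg a r (f y) y) x
      \<le> ennreal \<kappa> * cell_avg a r (\<lambda>y. cell_avg a r (k y) y) x" for x
  proof -
    let ?D = "grid_cell a r x"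
    let ?c = "ennreal (1 / r ^ CARD('n))"
    have [measurable]: "?D \<in> sets borel" using r by measurable
    have D: "?D = half_open_cube (\<chi> i. a $ i + r * of_int \<lfloor>(x $ i - a $ i) / r\<rfloor>) r"
      using r by (rule grid_cell_eq_half_open_cube)
    have exp: "cell_avg a r (\<lambda>y. cell_avg a r (g y) y) x = ?c * (?c * (\<integral>\<^sup>+y\<in>?D. (\<integral>\<^sup>+z\<in>?D. g y z \<partial>lborel) \<partial>lborel))"
      if [measurable]: "(\<lambda>(y, z). g y z) \<in> borel_measurable (borel \<Otimes>\<^sub>M borel)"
      for g :: "real ^ 'n \<Rightarrow> real ^ 'n \<Rightarrow> ennreal"
    proof -
      have "cell_avg a r (\<lambda>y. cell_avg a r (g y) y) x
          = cell_avg a r (\<lambda>y. ?c * (\<integral>\<^sup>+z. indicator ?D z * g y z \<partial>lborel)) x"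
        by (intro cell_avg_cong) (simp add: cell_avg_def[of a r "g _"] grid_cell_eq)
      also have "\<dots> = ?c * cell_avg a r (\<lambda>y. (\<integral>\<^sup>+z. indicator ?D z * g y z \<partial>lborel)) x"
        using r by (intro cell_avg_cmult) measurable
      finally show ?thesis by (simp add: cell_avg_def mult.commute)
    qed
    have "(\<integral>\<^sup>+y\<in>?D. (\<integral>\<^sup>+z\<in>?D. f y z \<partial>lborel) \<partial>lborel)
      \<le> ennreal \<kappa> * (\<integral>\<^sup>+y\<in>?D. (\<integral>\<^sup>+z\<in>?D. k y z \<partial>lborel) \<partial>lborel)"
      unfolding f_def k_def \<kappa>_def using r p \<delta> s
      by (intro fractional_poincare_convex) (auto simp: D convex_half_open_cube half_open_cube_diam)
    then have "?c * (?c * (\<integral>\<^sup>+y\<in>?D. (\<integral>\<^sup>+z\<in>?D. f y z \<partial>lborel) \<partial>lborel))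
      \<le> ?c * (?c * (ennreal \<kappa> * (\<integral>\<^sup>+y\<in>?D. (\<integral>\<^sup>+z\<in>?D. k y z \<partial>lborel) \<partial>lborel)))"
      by (intro mult_left_mono) auto
    then show ?thesis by (simp add: exp mult_ac)
  qed
  have "osc p v (cell_avg a r W) Q a r
      = (\<integral>\<^sup>+x. W x * (indicator Q x * cell_avg a r (\<lambda>y. cell_avg a r (f y) y) x) \<partial>lborel)"
    unfolding osc_def f_def[symmetric] by (rule swap) measurable
  also have "\<dots> \<le> (\<integral>\<^sup>+x. ennreal \<kappa> * (W x * (indicator Q x * cell_avg a r (\<lambda>y. cell_avg a r (k y) y) x)) \<partial>lborel)"
  proof (rule nn_integral_mono)
    fix x
    show "W x * (indicator Q x * cell_avg a r (\<lambda>y. cell_avg a r (f y) y) x)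
      \<le> ennreal \<kappa> * (W x * (indicator Q x * cell_avg a r (\<lambda>y. cell_avg a r (k y) y) x))"
      using mult_left_mono[OF cell[of x], of "W x * indicator Q x"] by (simp add: mult_ac)
  qed
  also have "\<dots> = ennreal \<kappa> * (\<integral>\<^sup>+y. indicator Q y * cell_avg a r W y * cell_avg a r (k y) y \<partial>lborel)"
    by (subst swap) (auto simp: nn_integral_cmult)
  also have "\<dots> \<le> ennreal \<kappa> * (\<integral>\<^sup>+y. ennreal (C / r ^ CARD('n)) *
     (indicator Q y * W y * (\<integral>\<^sup>+z. indicator Q z * k y z \<partial>lborel)) \<partial>lborel)"
  proof (intro mult_left_mono nn_integral_mono_AE)
    show "AE y in lborel. indicator Q y * cell_avg a r W y * cell_avg a r (k y) y
      \<le> ennreal (C / r ^ CARD('n)) * (indicator Q y * W y * (\<integral>\<^sup>+z. indicator Q z * k y z \<partial>lborel))"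
      using A1
    proof eventually_elim
      case (elim y)
      show ?case
      proof (cases "y \<in> Q")
        case True
        have "cell_avg a r (k y) y \<le> ennreal (1 / r ^ CARD('n)) * (\<integral>\<^sup>+z. indicator Q z * k y z \<partial>lborel)"
          unfolding cell_avg_def using cl[OF True]
          by (intro mult_left_mono nn_integral_mono) (auto simp: indicator_def)
        then have "cell_avg a r W y * cell_avg a r (k y) y \<le> (ennreal C * W y) *
            (ennreal (1 / r ^ CARD('n)) * (\<integral>\<^sup>+z. indicator Q z * k y z \<partial>lborel))"
          using elim by (intro mult_mono) auto
        also have "\<dots> = (ennreal C * ennreal (1 / r ^ CARD('n))) * (W y * (\<integral>\<^sup>+z. indicator Q z * k y z \<partial>lborel))"
          by (simp only: ac_simps)
        also have "ennreal C * ennreal (1 / r ^ CARD('n)) = ennreal (C / r ^ CARD('n))"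
          using C r by (subst ennreal_mult[symmetric]) auto
        finally show ?thesis using True by simp
      qed simp
    qed
  qed auto
  also have "\<dots> = ennreal \<kappa> * (ennreal (C / r ^ CARD('n)) * frac_energy p s v W Q)"
    unfolding frac_energy_def k_def by (subst nn_integral_cmult) auto
  also have "\<dots> = ennreal (\<kappa> * (C / r ^ CARD('n))) * frac_energy p s v W Q"
    using \<kappa> C r by (subst ennreal_mult) (auto simp: mult.assoc)
  also have "\<kappa> * (C / r ^ CARD('n)) = 3 * (p * (1 - \<delta>)) * ?n powr s * r powr (p * \<delta>) * C"
    using r by (simp add: \<kappa>_def s powr_mult powr_add powr_realpow)
  finally show ?thesis .
qed

text \<open>At least half of the points \<open>z\<close> in the cell of \<open>y\<close> satisfy \<open>|v y - v z| = |v y|\<close>.\<close>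

lemma zero_set_osc:
  fixes v :: "real ^ 'n::finite \<Rightarrow> real"
  assumes [measurable]: "v \<in> borel_measurable borel" "W \<in> borel_measurable borel" "Q \<in> sets borel"
    and r: "0 < r"
    and zero: "\<And>x. x \<in> Q \<Longrightarrow> ennreal (r ^ CARD('n) / 2) \<le> emeasure lborel (grid_cell a r x \<inter> {z. v z = 0})"
  shows "(\<integral>\<^sup>+y. indicator Q y * W y * ennreal (\<bar>v y\<bar> powr p) \<partial>lborel) \<le> 2 * osc p v W Q a r"
proof -
  have pw: "ennreal (\<bar>v y\<bar> powr p) \<le> 2 * cell_avg a r (\<lambda>z. ennreal (\<bar>v y - v z\<bar> powr p)) y" if "y \<in> Q" for y
  proof -
    let ?Z = "grid_cell a r y \<inter> {z. v z = 0}"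
    have [measurable]: "grid_cell a r y \<in> sets borel" using r by measurable
    have "ennreal (\<bar>v y\<bar> powr p) = ennreal (2 * (1 / r ^ CARD('n)) * (r ^ CARD('n) / 2)) * ennreal (\<bar>v y\<bar> powr p)"
      using r by simp
    also have "\<dots> = 2 * ennreal (1 / r ^ CARD('n)) * ennreal (r ^ CARD('n) / 2) * ennreal (\<bar>v y\<bar> powr p)"
      using r by (subst ennreal_mult, simp, simp, subst ennreal_mult) auto
    also have "\<dots> \<le> 2 * ennreal (1 / r ^ CARD('n)) * emeasure lborel ?Z * ennreal (\<bar>v y\<bar> powr p)"
      using zero[OF that] by (intro mult_right_mono mult_left_mono) auto
    also have "\<dots> = 2 * (ennreal (1 / r ^ CARD('n)) * (\<integral>\<^sup>+z. indicator ?Z z * ennreal (\<bar>v y\<bar> powr p) \<partial>lborel))"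
      by (simp add: nn_integral_multc mult.assoc)
    also have "\<dots> \<le> 2 * cell_avg a r (\<lambda>z. ennreal (\<bar>v y - v z\<bar> powr p)) y"
      unfolding cell_avg_def by (intro mult_left_mono nn_integral_mono) (auto simp: indicator_def)
    finally show ?thesis .
  qed
  have "(\<integral>\<^sup>+y. indicator Q y * W y * ennreal (\<bar>v y\<bar> powr p) \<partial>lborel)
     \<le> (\<integral>\<^sup>+y. 2 * (indicator Q y * W y * cell_avg a r (\<lambda>z. ennreal (\<bar>v y - v z\<bar> powr p)) y) \<partial>lborel)"
    using pw by (intro nn_integral_mono) (auto simp: indicator_def mult.left_commute intro!: mult_left_mono)
  also have "\<dots> = 2 * osc p v W Q a r"
    unfolding osc_def by (rule nn_integral_cmult) measurable
  finally show ?thesis .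
qed

lemma le_three_powr: "p \<le> 3 powr p" if "0 \<le> p" for p :: real
proof -
  have "ln (exp 1) \<le> ln (3 :: real)" using exp_le by (subst ln_le_cancel_iff) auto
  then have "p * 1 \<le> p * ln 3" using that by (intro mult_left_mono) auto
  moreover have "1 + p * ln 3 \<le> exp (p * ln 3)" by (rule exp_ge_add_one_self)
  ultimately have "p \<le> exp (p * ln 3)" by linarith
  then show ?thesis by (simp add: powr_def)
qed

text \<open>For \<open>\<delta> \<le> 1/2\<close> this combines \<open>zero_set_osc\<close> and \<open>osc_le_frac_energy\<close>. For \<open>\<delta> > 1/2\<close> the weight is replaced by its
  average over cells of side \<open>r / 2 ^ k\<close>. The case \<open>k = 0\<close> follows from \<open>zero_set_osc\<close> and \<open>osc_averaged_weight_le\<close>, each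
  refinement is a \<open>cell_step\<close>, and after finitely many steps one more \<open>cell_step\<close>, with the crude bound
  \<open>osc_le_frac_energy\<close> on a mesh so fine that it beats the factor \<open>1 - \<delta>\<close>, reaches \<open>W\<close> itself.\<close>

theorem fractional_poincare_cells:
  fixes v :: "real ^ 'n::finite \<Rightarrow> real"
  assumes [measurable]: "v \<in> borel_measurable borel" "W \<in> borel_measurable borel" "Q \<in> sets borel"
    and r: "0 < r" and cl: "\<And>x. x \<in> Q \<Longrightarrow> grid_cell a r x \<subseteq> Q"
    and p: "1 \<le> p" and \<delta>: "0 < \<delta>" "\<delta> < 1" "p * \<delta> < real CARD('n)"
    and s: "s = real CARD('n) + p * \<delta>"
    and A1: "A1_ae W C" and C: "1 \<le> C"
    and zero: "\<And>x. x \<in> Q \<Longrightarrow> ennreal (r ^ CARD('n) / 2) \<le> emeasure lborel (grid_cell a r x \<inter> {z. v z = 0})"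
    and K: "K = 18 powr p * (6 * 2 ^ CARD('n) * real CARD('n) powr (2 * real CARD('n)))"
  shows "(\<integral>\<^sup>+y. indicator Q y * W y * ennreal (\<bar>v y\<bar> powr p) \<partial>lborel)
    \<le> ennreal (K * (1 - \<delta>) * C * r powr (p * \<delta>)) * frac_energy p s v W Q"
proof -
  let ?n = "real CARD('n)"
  let ?E = "frac_energy p s v W Q"
  have n1: "1 \<le> ?n" by (simp add: Suc_le_eq)
  have s0: "0 \<le> s" and sn: "s - ?n = p * \<delta>" using s p \<delta> by auto
  have ns: "?n powr s \<le> ?n powr (2 * ?n)" using n1 s \<delta> by (intro powr_mono) auto
  have rp: "0 < r powr (p * \<delta>)" using r by simp
  show ?thesis
  proof (cases "\<delta> \<le> 1 / 2")
    case True
    have "(\<integral>\<^sup>+y. indicator Q y * W y * ennreal (\<bar>v y\<bar> powr p) \<partial>lborel) \<le> 2 * osc p v W Q a r"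
      using r zero by (intro zero_set_osc) auto
    also have "\<dots> \<le> 2 * (ennreal (?n powr s * r powr (s - ?n)) * ?E)"
      using r cl p s0 by (intro mult_left_mono osc_le_frac_energy) auto
    also have "\<dots> = ennreal (2 * (?n powr s * r powr (p * \<delta>))) * ?E"
      by (simp add: sn ennreal_mult mult.assoc)
    also have "\<dots> \<le> ennreal (K * (1 - \<delta>) * C * r powr (p * \<delta>)) * ?E"
    proof (intro mult_right_mono ennreal_leI)
      have a: "2 * ?n powr s \<le> 2 * ?n powr (2 * ?n)" using ns by simp
      have "1 * (6 * 1) \<le> 18 powr p * (6 * 2 ^ CARD('n))"
        using p by (intro mult_mono ge_one_powr_ge_zero mult_left_mono one_le_power) auto
      then have "6 * ?n powr (2 * ?n) \<le> K"
        unfolding K mult.assoc[symmetric] by (intro mult_right_mono) auto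
      then have "(6 * ?n powr (2 * ?n)) * (1 / 2) * 1 \<le> K * (1 - \<delta>) * C"
        using True C \<delta> by (intro mult_mono) (auto simp: K)
      moreover have "0 \<le> ?n powr (2 * ?n)" by simp
      ultimately have "2 * ?n powr s \<le> K * (1 - \<delta>) * C"
        using a by linarith
      then show "2 * (?n powr s * r powr (p * \<delta>)) \<le> K * (1 - \<delta>) * C * r powr (p * \<delta>)"
        unfolding mult.assoc[symmetric] by (intro mult_right_mono) auto
    qed auto
    finally show ?thesis .
  next
    case False
    define b where "b = 6 * (p * (1 - \<delta>)) * 2 ^ CARD('n) * ?n powr s * r powr (p * \<delta>) * C"
    define \<sigma> where "\<sigma> k = r / 2 ^ k" for k :: nat
    define B where "B = ennreal b * ?E"
    have b0: "0 \<le> b" using p \<delta> C by (simp add: b_def)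
    have \<sigma>0: "0 < \<sigma> k" for k using r by (simp add: \<sigma>_def)
    have \<sigma>Suc: "\<sigma> (Suc k) = \<sigma> k / real 2" for k by (simp add: \<sigma>_def field_simps)
    have clk: "grid_cell a (\<sigma> k) x \<subseteq> Q" if "x \<in> Q" for k x
      using grid_cell_refine[of "2 ^ k" a r x] cl[OF that] by (simp add: \<sigma>_def)
    have A1k: "AE x in lborel. cell_avg a (\<sigma> k) W x \<le> ennreal C * W x" for k
      using A1 \<sigma>0 C by (intro cell_avg_le_of_A1_ae) auto
    \<comment> \<open>As \<open>\<delta> > 1/2\<close>, each halving of the mesh gains at least \<open>2 powr (- 1/2) \<le> 3/4\<close> in the \<open>p\<close>-th root.\<close>
    have \<sigma>p: "\<sigma> k powr (p * \<delta>) \<le> r powr (p * \<delta>) * ((3 / 4) ^ k) powr p" for k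
    proof -
      have "\<sigma> k powr (p * \<delta>) = r powr (p * \<delta>) * ((1 / 2) ^ k) powr (p * \<delta>)"
        using r by (simp add: \<sigma>_def powr_divide power_divide powr_mult)
      also have "((1 / 2 :: real) ^ k) powr (p * \<delta>) \<le> ((1 / 2) ^ k) powr (p / 2)"
        using False p by (intro powr_mono') (auto simp: power_le_one)
      also have "\<dots> \<le> (((3 / 4) ^ k) ^ 2) powr (p / 2)"
      proof (rule powr_mono2)
        have "(1 / 2 :: real) ^ k \<le> (3 / 4 * (3 / 4)) ^ k" by (rule power_mono) auto
        then show "(1 / 2 :: real) ^ k \<le> ((3 / 4) ^ k)\<^sup>2"
          unfolding power2_eq_square power_mult_distrib .
      qed (use p in auto)
      also have "\<dots> = ((3 / 4) ^ k) powr p"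
        by (simp add: powr_realpow[symmetric] powr_powr)
      finally show ?thesis using r by simp
    qed
    have oscB: "osc p v (cell_avg a (\<sigma> k) W) Q a (\<sigma> k)
        \<le> ennreal (b / 2 ^ Suc (CARD('n)) * ((3 / 4) ^ k) powr p) * ?E" for k
    proof -
      have "osc p v (cell_avg a (\<sigma> k) W) Q a (\<sigma> k)
          \<le> ennreal (3 * (p * (1 - \<delta>)) * ?n powr s * \<sigma> k powr (p * \<delta>) * C) * ?E"
        using \<sigma>0 clk p \<delta> s A1k C by (intro osc_averaged_weight_le) auto
      also have "\<dots> \<le> ennreal (b / 2 ^ Suc (CARD('n)) * ((3 / 4) ^ k) powr p) * ?E"
      proof (intro mult_right_mono ennreal_leI)
        have "3 * (p * (1 - \<delta>)) * ?n powr s * \<sigma> k powr (p * \<delta>) * C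
           \<le> 3 * (p * (1 - \<delta>)) * ?n powr s * (r powr (p * \<delta>) * ((3 / 4) ^ k) powr p) * C"
          using \<sigma>p[of k] p \<delta> C by (intro mult_right_mono mult_left_mono) auto
        moreover have "b / 2 ^ Suc (CARD('n)) = 3 * (p * (1 - \<delta>)) * ?n powr s * r powr (p * \<delta>) * C"
          by (simp add: b_def)
        ultimately show "3 * (p * (1 - \<delta>)) * ?n powr s * \<sigma> k powr (p * \<delta>) * C
           \<le> b / 2 ^ Suc (CARD('n)) * ((3 / 4) ^ k) powr p"
          by (simp only: mult_ac)
      qed auto
      finally show ?thesis .
    qed
    \<comment> \<open>The number \<open>5 - 4 * (3/4) ^ k\<close> is \<open>1\<close> plus the first \<open>k\<close> terms of the series of errors \<open>(3/4) ^ i\<close>.\<close>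
    have main: "(\<integral>\<^sup>+y. indicator Q y * cell_avg a (\<sigma> k) W y * ennreal (\<bar>v y\<bar> powr p) \<partial>lborel)
       \<le> ennreal ((5 - 4 * (3 / 4) ^ k) powr p) * B" for k
    proof (induction k)
      case 0
      have "(\<integral>\<^sup>+y. indicator Q y * cell_avg a r W y * ennreal (\<bar>v y\<bar> powr p) \<partial>lborel)
         \<le> 2 * osc p v (cell_avg a r W) Q a r"
        using r zero by (intro zero_set_osc) auto
      also have "\<dots> \<le> 2 * (ennreal (b / 2 ^ Suc (CARD('n))) * ?E)"
        using oscB[of 0] by (intro mult_left_mono) (auto simp: \<sigma>_def)
      also have "\<dots> = ennreal (2 * (b / 2 ^ Suc (CARD('n)))) * ?E"
        using b0 by (subst ennreal_mult) (simp_all only: mult.assoc ennreal_numeral, auto)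
      also have "\<dots> \<le> B"
        unfolding B_def using b0
        by (intro mult_right_mono ennreal_leI) (auto simp: field_simps intro: order_trans[OF _ mult_left_mono[of 1]])
      finally show ?case by (simp add: \<sigma>_def)
    next
      case (Suc k)
      have pw: "(3 / 4 :: real) ^ k \<le> 1" by (simp add: power_le_one)
      have "(\<integral>\<^sup>+y. indicator Q y * cell_avg a (\<sigma> (Suc k)) W y * ennreal (\<bar>v y\<bar> powr p) \<partial>lborel)
         \<le> ennreal (((5 - 4 * (3 / 4) ^ k) + (3 / 4) ^ k) powr p) * B"
      proof (rule cell_step[where s = "\<sigma> k" and a = a])
        show "(\<integral>\<^sup>+y. indicator Q y * cell_avg a (\<sigma> k) (cell_avg a (\<sigma> (Suc k)) W) y
            * ennreal (\<bar>v y\<bar> powr p) \<partial>lborel) \<le> ennreal ((5 - 4 * (3 / 4) ^ k) powr p) * B"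
        proof -
          have "cell_avg a (\<sigma> k) (cell_avg a (\<sigma> (Suc k)) W) y = cell_avg a (\<sigma> k) W y" for y
            unfolding \<sigma>Suc using \<sigma>0 by (intro cell_avg_tower) auto
          then show ?thesis using Suc by simp
        qed
        have "osc p v (cell_avg a (\<sigma> (Suc k)) W) Q a (\<sigma> k)
            \<le> (\<integral>\<^sup>+y. ennreal (real 2 ^ CARD('n)) * (indicator Q y * cell_avg a (\<sigma> k) W y *
               cell_avg a (\<sigma> k) (\<lambda>z. ennreal (\<bar>v y - v z\<bar> powr p)) y) \<partial>lborel)"
          unfolding osc_def
        proof (rule nn_integral_mono)
          fix y
          have "cell_avg a (\<sigma> (Suc k)) W y \<le> ennreal (real 2 ^ CARD('n)) * cell_avg a (\<sigma> k) W y"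
            unfolding \<sigma>Suc using \<sigma>0 by (intro cell_avg_refine_le) auto
          then have "indicator Q y * cell_avg a (\<sigma> (Suc k)) W y * cell_avg a (\<sigma> k) (\<lambda>z. ennreal (\<bar>v y - v z\<bar> powr p)) y
            \<le> indicator Q y * (ennreal (real 2 ^ CARD('n)) * cell_avg a (\<sigma> k) W y)
              * cell_avg a (\<sigma> k) (\<lambda>z. ennreal (\<bar>v y - v z\<bar> powr p)) y"
            by (intro mult_right_mono mult_left_mono) auto
          then show "indicator Q y * cell_avg a (\<sigma> (Suc k)) W y * cell_avg a (\<sigma> k) (\<lambda>z. ennreal (\<bar>v y - v z\<bar> powr p)) y
            \<le> ennreal (real 2 ^ CARD('n)) * (indicator Q y * cell_avg a (\<sigma> k) W y *
               cell_avg a (\<sigma> k) (\<lambda>z. ennreal (\<bar>v y - v z\<bar> powr p)) y)"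
            by (simp only: ac_simps)
        qed
        also have "\<dots> = ennreal (real 2 ^ CARD('n)) * osc p v (cell_avg a (\<sigma> k) W) Q a (\<sigma> k)"
          unfolding osc_def by (rule nn_integral_cmult) measurable
        also have "\<dots> \<le> ennreal (real 2 ^ CARD('n)) * (ennreal (b / 2 ^ Suc (CARD('n)) * ((3 / 4) ^ k) powr p) * ?E)"
          by (intro mult_left_mono oscB) auto
        also have "\<dots> = ennreal (real 2 ^ CARD('n) * (b / 2 ^ Suc (CARD('n)) * ((3 / 4) ^ k) powr p)) * ?E"
          using b0 by (subst ennreal_mult) (auto simp: mult.assoc)
        also have "\<dots> \<le> ennreal (((3 / 4) ^ k) powr p * b) * ?E"
          using b0 by (intro mult_right_mono ennreal_leI) (auto simp: field_simps)
        also have "\<dots> = ennreal (((3 / 4) ^ k) powr p) * B"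
          unfolding B_def using b0 by (subst ennreal_mult) (auto simp: mult.assoc)
        finally show "osc p v (cell_avg a (\<sigma> (Suc k)) W) Q a (\<sigma> k) \<le> ennreal (((3 / 4) ^ k) powr p) * B" .
      qed (use \<sigma>0 clk p pw in auto)
      also have "(5 - 4 * (3 / 4) ^ k) + (3 / 4) ^ k = 5 - 4 * (3 / 4 :: real) ^ Suc k" by simp
      finally show ?case .
    qed
    obtain k where k: "(3 / 4 :: real) ^ k < 1 - \<delta>"
      using real_arch_pow_inv[of "1 - \<delta>" "3/4"] \<delta> by auto
    have pw: "(3 / 4 :: real) ^ k \<le> 1" "0 < (3 / 4 :: real) ^ k" by (simp_all add: power_le_one)
    have "(\<integral>\<^sup>+y. indicator Q y * W y * ennreal (\<bar>v y\<bar> powr p) \<partial>lborel)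
       \<le> ennreal (((5 - 4 * (3 / 4) ^ k) + 1) powr p) * B"
    proof (rule cell_step[where s = "\<sigma> k" and a = a])
      have "osc p v W Q a (\<sigma> k) \<le> ennreal (?n powr s * \<sigma> k powr (s - ?n)) * ?E"
        using \<sigma>0 clk p s0 by (intro osc_le_frac_energy) auto
      also have "\<dots> \<le> ennreal b * ?E"
      proof (intro mult_right_mono ennreal_leI)
        have "((3 / 4) ^ k) powr p \<le> ((3 / 4 :: real) ^ k) powr 1"
          using p pw by (intro powr_mono') auto
        also have "\<dots> \<le> 1 - \<delta>" using k by simp
        finally have "?n powr s * \<sigma> k powr (p * \<delta>) \<le> ?n powr s * (r powr (p * \<delta>) * (1 - \<delta>))"
          using \<sigma>p[of k] rp by (intro mult_left_mono order_trans[OF \<sigma>p]) auto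
        also have "\<dots> = 1 * ((1 - \<delta>) * ?n powr s * r powr (p * \<delta>))" by simp
        also have "\<dots> \<le> (6 * p * 2 ^ CARD('n) * C) * ((1 - \<delta>) * ?n powr s * r powr (p * \<delta>))"
        proof (rule mult_right_mono)
          have "1 * 1 * 1 * 1 \<le> 6 * p * 2 ^ CARD('n) * C"
            using p C by (intro mult_mono) auto
          then show "1 \<le> 6 * p * 2 ^ CARD('n) * C" by simp
        qed (use \<delta> in auto)
        also have "\<dots> = b" by (simp add: b_def mult_ac)
        finally show "?n powr s * \<sigma> k powr (s - ?n) \<le> b" by (simp add: sn)
      qed auto
      finally show "osc p v W Q a (\<sigma> k) \<le> ennreal (1 powr p) * B" by (simp add: B_def)
      show "(\<integral>\<^sup>+y. indicator Q y * cell_avg a (\<sigma> k) W y * ennreal (\<bar>v y\<bar> powr p) \<partial>lborel)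
         \<le> ennreal ((5 - 4 * (3 / 4) ^ k) powr p) * B" by (rule main)
    qed (use \<sigma>0 clk p pw in auto)
    also have "\<dots> \<le> ennreal (6 powr p) * B"
      using p pw by (intro mult_right_mono ennreal_leI powr_mono2) auto
    also have "\<dots> = ennreal (6 powr p * b) * ?E"
      unfolding B_def using b0 by (subst ennreal_mult) (auto simp: mult.assoc)
    also have "\<dots> \<le> ennreal (K * (1 - \<delta>) * C * r powr (p * \<delta>)) * ?E"
    proof (intro mult_right_mono ennreal_leI)
      have "p * ?n powr s \<le> 3 powr p * ?n powr (2 * ?n)"
        using p ns le_three_powr[of p] by (intro mult_mono) auto
      then have "(p * ?n powr s) * (6 powr p * (6 * 2 ^ CARD('n) * (1 - \<delta>) * C * r powr (p * \<delta>)))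
         \<le> (3 powr p * ?n powr (2 * ?n)) * (6 powr p * (6 * 2 ^ CARD('n) * (1 - \<delta>) * C * r powr (p * \<delta>)))"
        using \<delta> C by (intro mult_right_mono) auto
      moreover have "(18 :: real) powr p = 3 powr p * 6 powr p"
        by (subst powr_mult[symmetric]) auto
      ultimately show "6 powr p * b \<le> K * (1 - \<delta>) * C * r powr (p * \<delta>)"
        by (simp only: K b_def mult_ac)
    qed auto
    finally show ?thesis .
  qed
qed

section \<open>From estimates between levels to a strong bound\<close>

lemma sum_powr_le_powr_sum:
  fixes x :: "'i \<Rightarrow> real"
  assumes "finite I" "\<And>i. i \<in> I \<Longrightarrow> 0 \<le> x i" "1 \<le> r"
  shows "(\<Sum>i\<in>I. x i powr r) \<le> (\<Sum>i\<in>I. x i) powr r"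
  using assms
proof (induction I rule: finite_induct)
  case (insert j I)
  have two: "a powr r + b powr r \<le> (a + b) powr r" if "0 \<le> a" "0 \<le> b" for a b :: real
  proof (cases "a = 0 \<or> b = 0")
    case False
    then have pos: "0 < a" "0 < b" using that by auto
    have "a * a powr (r - 1) + b * b powr (r - 1) \<le> a * (a + b) powr (r - 1) + b * (a + b) powr (r - 1)"
      using pos \<open>1 \<le> r\<close> by (intro add_mono mult_left_mono powr_mono2) auto
    also have "\<dots> = (a + b) * (a + b) powr (r - 1)" by (simp add: algebra_simps)
    finally show ?thesis using pos by (simp add: powr_mult_base)
  qed auto
  have "x j powr r + (\<Sum>i\<in>I. x i powr r) \<le> x j powr r + (\<Sum>i\<in>I. x i) powr r"
    using insert by auto
  also have "\<dots> \<le> (x j + (\<Sum>i\<in>I. x i)) powr r"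
    using insert by (intro two sum_nonneg) auto
  finally show ?case using insert by simp
qed simp

text \<open>With \<open>x = t powr p * b powr \<theta>\<close> at a level \<open>t\<close>, the estimate between the levels \<open>t\<close> and \<open>\<mu> t\<close> says that the new
  \<open>x\<close> is at most \<open>d powr \<theta>\<close> times the old \<open>x\<close> to the power \<open>1 - \<theta>\<close>, up to powers of \<open>\<mu>\<close>. Young's
  inequality makes this linear, and the powers of \<open>\<mu>\<close> are put entirely on \<open>d\<close>, so that the old \<open>x\<close> keeps
  a coefficient \<open>1 - \<theta> < 1\<close> and can be absorbed after summation.\<close>

lemma level_recursion:
  fixes b1 b0 t \<mu> :: real
  assumes p: "1 \<le> p" and \<theta>: "0 < \<theta>" "\<theta> < 1" and \<mu>: "1 < \<mu>" and t: "0 < t"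
    and b: "0 \<le> b0" "0 \<le> b1" and g: "0 \<le> g"
    and step: "(\<mu> * t - t) powr p * b1 \<le> g * b0 powr (1 - \<theta>)"
  shows "(\<mu> * t) powr p * b1 powr \<theta>
    \<le> \<theta> * (\<mu> powr (p / \<theta> - p) * (g * (\<mu> / (\<mu> - 1)) powr p)) + (1 - \<theta>) * (t powr p * b0 powr \<theta>)"
proof -
  define d where "d = g * (\<mu> / (\<mu> - 1)) powr p"
  have d0: "0 \<le> d" using g by (simp add: d_def)
  have 1: "(\<mu> * t) powr p * b1 \<le> d * b0 powr (1 - \<theta>)"
  proof -
    have "\<mu> * t = (\<mu> / (\<mu> - 1)) * (\<mu> * t - t)" using \<mu> by (simp add: field_simps)
    then have "(\<mu> * t) powr p = (\<mu> / (\<mu> - 1)) powr p * (\<mu> * t - t) powr p"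
      using \<mu> t powr_mult[of "\<mu> / (\<mu> - 1)" "\<mu> * t - t" p] by simp
    then have "(\<mu> * t) powr p * b1 = (\<mu> / (\<mu> - 1)) powr p * ((\<mu> * t - t) powr p * b1)"
      by simp
    also have "\<dots> \<le> (\<mu> / (\<mu> - 1)) powr p * (g * b0 powr (1 - \<theta>))"
      using step by (intro mult_left_mono) auto
    finally show ?thesis by (simp add: d_def mult_ac)
  qed
  have rhs0: "0 \<le> \<theta> * (\<mu> powr (p / \<theta> - p) * d) + (1 - \<theta>) * (t powr p * b0 powr \<theta>)"
    using \<theta> d0 by (intro add_nonneg_nonneg mult_nonneg_nonneg) auto
  show ?thesis
  proof (cases "b1 = 0 \<or> b0 = 0 \<or> d = 0")
    case True
    then have "b1 = 0"
    proof (elim disjE)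
      assume "b0 = 0"
      then have "(\<mu> * t) powr p * b1 \<le> 0" using 1 \<theta> by simp
      then show ?thesis using b \<mu> t by (simp add: mult_le_0_iff)
    next
      assume "d = 0"
      then have "(\<mu> * t) powr p * b1 \<le> 0" using 1 by simp
      then show ?thesis using b \<mu> t by (simp add: mult_le_0_iff)
    qed
    then show ?thesis using rhs0 by (simp add: d_def)
  next
    case False
    then have pos: "0 < b1" "0 < b0" "0 < d" using b d0 by auto
    have "(\<mu> * t) powr p * b1 powr \<theta> = ((\<mu> * t) powr p * b1) powr \<theta> * ((\<mu> * t) powr p) powr (1 - \<theta>)"
      using pos \<mu> t by (simp add: powr_mult powr_powr powr_add[symmetric] algebra_simps)
    also have "\<dots> \<le> (d * b0 powr (1 - \<theta>)) powr \<theta> * ((\<mu> * t) powr p) powr (1 - \<theta>)"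
      using 1 \<theta> pos by (intro mult_right_mono powr_mono2) auto
    also have "\<dots> = (\<mu> powr (p / \<theta> - p) * d) powr \<theta> * (t powr p * b0 powr \<theta>) powr (1 - \<theta>)"
    proof -
      have "\<mu> powr (p * (1 - \<theta>)) = (\<mu> powr (p / \<theta> - p)) powr \<theta>"
        using \<theta> by (simp add: powr_powr algebra_simps)
      then show ?thesis using pos \<mu> t
        by (simp add: powr_mult powr_powr mult_ac)
    qed
    also have "\<dots> \<le> \<theta> * (\<mu> powr (p / \<theta> - p) * d) + (1 - \<theta>) * (t powr p * b0 powr \<theta>)"
      using \<theta> pos \<mu> t by (intro Youngs_inequality_0) auto
    finally show ?thesis by (simp add: d_def)
  qed
qed

lemma level_sum:
  fixes b e :: "nat \<Rightarrow> real"
  assumes p: "1 \<le> p" and \<theta>: "0 < \<theta>" "\<theta> < 1" and q: "q = p / \<theta>" and \<mu>: "1 < \<mu>" and \<tau>: "0 < \<tau>"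
    and b: "\<And>k. 0 \<le> b k" and e: "\<And>k. 0 \<le> e k" and \<Gamma>: "0 \<le> \<Gamma>"
    and step: "\<And>k. (\<tau> * \<mu> ^ Suc k - \<tau> * \<mu> ^ k) powr p * b (Suc k) \<le> \<Gamma> * e k * b k powr (1 - \<theta>)"
    and E: "(\<Sum>k<K. e k) \<le> E"
  shows "(\<Sum>k<K. (\<tau> * \<mu> ^ Suc k) powr q * b (Suc k))
     \<le> (\<mu> powr (q - p) * (\<Gamma> * E * (\<mu> / (\<mu> - 1)) powr p)
          + (1 - \<theta>) / \<theta> * (\<tau> powr p * b 0 powr \<theta>)) powr (1 / \<theta>)"
proof -
  define x where "x k = (\<tau> * \<mu> ^ k) powr p * b k powr \<theta>" for k
  define L where "L = \<mu> powr (q - p) * (\<mu> / (\<mu> - 1)) powr p"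
  have x0: "0 \<le> x k" for k by (simp add: x_def)
  have L0: "0 \<le> L" by (simp add: L_def)
  have rec: "x (Suc k) \<le> \<theta> * (L * \<Gamma> * e k) + (1 - \<theta>) * x k" for k
    using level_recursion[of p \<theta> \<mu> "\<tau> * \<mu> ^ k" "b k" "b (Suc k)" "\<Gamma> * e k"]
      p \<theta> \<mu> \<tau> b e \<Gamma> step[of k]
    by (simp add: x_def L_def q mult_ac)
  have shift: "(\<Sum>k<K. x k) \<le> x 0 + (\<Sum>k<K. x (Suc k))"
  proof -
    have "(\<Sum>k<K. x k) \<le> (\<Sum>k<Suc K. x k)" using x0 by simp
    then show ?thesis by (simp only: sum.lessThan_Suc_shift)
  qed
  have "(\<Sum>k<K. x (Suc k)) \<le> (\<Sum>k<K. \<theta> * (L * \<Gamma>) * e k + (1 - \<theta>) * x k)"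
    using rec by (intro sum_mono) (simp add: mult.assoc)
  also have "\<dots> = \<theta> * (L * \<Gamma>) * (\<Sum>k<K. e k) + (1 - \<theta>) * (\<Sum>k<K. x k)"
    by (simp only: sum.distrib sum_distrib_left)
  also have "\<dots> \<le> \<theta> * (L * \<Gamma>) * E + (1 - \<theta>) * (x 0 + (\<Sum>k<K. x (Suc k)))"
    using \<theta> L0 \<Gamma> E shift by (intro add_mono mult_left_mono) auto
  finally have "\<theta> * (\<Sum>k<K. x (Suc k)) \<le> \<theta> * (L * \<Gamma> * E) + (1 - \<theta>) * x 0"
    by (simp add: algebra_simps)
  also have "(1 - \<theta>) * x 0 = \<theta> * ((1 - \<theta>) / \<theta> * x 0)" using \<theta> by simp
  finally have "\<theta> * (\<Sum>k<K. x (Suc k)) \<le> \<theta> * (L * \<Gamma> * E + (1 - \<theta>) / \<theta> * x 0)"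
    by (simp only: distrib_left)
  then have X: "(\<Sum>k<K. x (Suc k)) \<le> L * \<Gamma> * E + (1 - \<theta>) / \<theta> * x 0"
    using \<theta> by simp
  have "(\<Sum>k<K. (\<tau> * \<mu> ^ Suc k) powr q * b (Suc k)) = (\<Sum>k<K. x (Suc k) powr (1 / \<theta>))"
  proof (rule sum.cong)
    fix k
    show "(\<tau> * \<mu> ^ Suc k) powr q * b (Suc k) = x (Suc k) powr (1 / \<theta>)"
      using \<theta> \<tau> \<mu> b[of "Suc k"] by (simp add: x_def q powr_mult powr_powr)
  qed simp
  also have "\<dots> \<le> (\<Sum>k<K. x (Suc k)) powr (1 / \<theta>)"
    using x0 \<theta> by (intro sum_powr_le_powr_sum) auto
  also have "\<dots> \<le> (L * \<Gamma> * E + (1 - \<theta>) / \<theta> * x 0) powr (1 / \<theta>)"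
    using X x0 \<theta> by (intro powr_mono2 sum_nonneg) auto
  finally show ?thesis by (simp add: L_def x_def mult_ac)
qed

text \<open>This is why the ratio \<open>1 + 1 / q\<close> of consecutive levels is the right one: its \<open>q\<close>-th power stays bounded.\<close>

lemma one_plus_inverse_powr_le: "(1 + 1 / q) powr r \<le> exp 1" if "0 < q" "r \<le> q" for q r :: real
proof -
  have pos: "0 < 1 + 1 / q" using that by (simp add: add_pos_pos)
  have "(1 + 1 / q) powr r \<le> (1 + 1 / q) powr q" using that by (intro powr_mono) auto
  also have "\<dots> = exp (q * ln (1 + 1 / q))" using pos by (simp add: powr_def)
  also have "\<dots> \<le> exp (q * (1 / q))"
    using that by (subst exp_le_cancel_iff) (intro mult_left_mono ln_add_one_self_le_self, auto)
  finally show ?thesis using that by simp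
qed

text \<open>The function \<open>e s t\<close> stands for the energy of the layer of \<open>f\<close> between the levels \<open>s\<close> and \<open>t\<close>. The levels
  are \<open>\<tau> (1 + 1/q) ^ k\<close> for \<open>k \<ge> 0\<close>. Starting at a positive level \<open>\<tau>\<close> makes all sums finite, as
  the absorption in the recursion requires; the cost of the part of \<open>f\<close> below \<open>\<tau>\<close> tends to 0 with \<open>\<tau>\<close>.
  The gap between consecutive levels is \<open>1 / (q + 1)\<close> of the upper one, which is the source of the factor
  \<open>(q + 1) powr p\<close>.\<close>

theorem strong_type_from_levels:
  fixes f :: "'a \<Rightarrow> real" and e :: "real \<Rightarrow> real \<Rightarrow> real"
  assumes "finite_measure M" and [measurable]: "f \<in> borel_measurable M"
    and f0: "\<And>x. x \<in> space M \<Longrightarrow> 0 \<le> f x"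
    and p: "1 \<le> p" and \<theta>: "0 < \<theta>" "\<theta> < 1" and q: "q = p / \<theta>"
    and e: "\<And>s t. 0 \<le> e s t" and \<Gamma>: "0 \<le> \<Gamma>"
    and step: "\<And>s t. 0 < s \<Longrightarrow> s < t \<Longrightarrow> (t - s) powr p * measure M {x \<in> space M. t < f x}
        \<le> \<Gamma> * e s t * measure M {x \<in> space M. s < f x} powr (1 - \<theta>)"
    and E: "\<And>t K. 0 < t 0 \<Longrightarrow> strict_mono t \<Longrightarrow> (\<Sum>k<K. e (t k) (t (Suc k))) \<le> E"
  shows "(\<integral>\<^sup>+x. ennreal (f x powr q) \<partial>M)
     \<le> ennreal (exp 1 * (exp 1 * \<Gamma> * E * (q + 1) powr p) powr (1 / \<theta>))"
proof -
  interpret finite_measure M by fact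
  have qp: "p < q" "0 < q"
    using p \<theta> mult_strict_left_mono[of \<theta> 1 p] by (auto simp: q field_simps)
  define \<mu> where "\<mu> = 1 + 1 / q"
  have \<mu>: "1 < \<mu>" and \<mu>q: "\<mu> powr q \<le> exp 1" and \<mu>qp: "\<mu> powr (q - p) \<le> exp 1"
    using qp p one_plus_inverse_powr_le[of q q] one_plus_inverse_powr_le[of q "q - p"] by (auto simp: \<mu>_def)
  have \<mu>f: "\<mu> / (\<mu> - 1) = q + 1" using qp by (simp add: \<mu>_def field_simps)
  have E0: "0 \<le> E" using E[of "\<lambda>k. real (Suc k)" 0] by (simp add: strict_mono_def)
  define b where "b s = measure M {x \<in> space M. s < f x}" for s
  define w where "w = measure M (space M)"
  define A where "A = exp 1 * \<Gamma> * E * (q + 1) powr p"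
  have A0: "0 \<le> A" using \<Gamma> E0 by (simp add: A_def)
  define bd where "bd \<tau> = (\<tau> * \<mu>) powr q * w
      + exp 1 * (A + (1 - \<theta>) / \<theta> * (\<tau> powr p * w powr \<theta>)) powr (1 / \<theta>)" for \<tau>
  have bound: "(\<integral>\<^sup>+x. ennreal (f x powr q) \<partial>M) \<le> ennreal (bd \<tau>)" if \<tau>: "0 < \<tau>" for \<tau>
  proof -
    define t where "t k = \<tau> * \<mu> ^ k" for k
    have tpos: "0 < t k" for k using \<tau> \<mu> by (simp add: t_def)
    have tmono: "strict_mono t"
      unfolding strict_mono_Suc_iff using \<tau> \<mu> by (simp add: t_def)
    define S where "S = (A + (1 - \<theta>) / \<theta> * (\<tau> powr p * w powr \<theta>)) powr (1 / \<theta>)"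
    have partial: "(\<Sum>k<K. t (Suc k) powr q * b (t (Suc k))) \<le> S" for K
    proof -
      have "(\<Sum>k<K. t (Suc k) powr q * b (t (Suc k)))
         \<le> (\<mu> powr (q - p) * (\<Gamma> * E * (\<mu> / (\<mu> - 1)) powr p)
          + (1 - \<theta>) / \<theta> * (\<tau> powr p * b (t 0) powr \<theta>)) powr (1 / \<theta>)"
        unfolding t_def
      proof (rule level_sum[where e = "\<lambda>k. e (t k) (t (Suc k))"])
        fix k
        show "(\<tau> * \<mu> ^ Suc k - \<tau> * \<mu> ^ k) powr p * b (\<tau> * \<mu> ^ Suc k)
            \<le> \<Gamma> * e (t k) (t (Suc k)) * b (\<tau> * \<mu> ^ k) powr (1 - \<theta>)"
          using step[of "t k" "t (Suc k)"] tpos[of k] strict_monoD[OF tmono, of k "Suc k"]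
          by (simp add: b_def t_def)
      qed (use p \<theta> q \<mu> \<tau> e \<Gamma> E[OF _ tmono, of K] tpos[of 0] in \<open>auto simp: b_def\<close>)
      also have "\<dots> \<le> S"
        unfolding S_def
      proof (rule powr_mono2)
        have "\<mu> powr (q - p) * (\<Gamma> * E * (\<mu> / (\<mu> - 1)) powr p) \<le> exp 1 * (\<Gamma> * E * (\<mu> / (\<mu> - 1)) powr p)"
          using \<mu>qp \<Gamma> E0 by (intro mult_right_mono) auto
        also have "\<dots> = A" by (simp add: A_def \<mu>f mult.assoc)
        finally have 1: "\<mu> powr (q - p) * (\<Gamma> * E * (\<mu> / (\<mu> - 1)) powr p) \<le> A" .
        have "b (t 0) powr \<theta> \<le> w powr \<theta>"
          using \<theta> by (intro powr_mono2) (auto simp: b_def w_def intro!: finite_measure_mono)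
        then have "(1 - \<theta>) / \<theta> * (\<tau> powr p * b (t 0) powr \<theta>) \<le> (1 - \<theta>) / \<theta> * (\<tau> powr p * w powr \<theta>)"
          using \<theta> by (intro mult_left_mono) auto
        with 1 show "\<mu> powr (q - p) * (\<Gamma> * E * (\<mu> / (\<mu> - 1)) powr p)
            + (1 - \<theta>) / \<theta> * (\<tau> powr p * b (t 0) powr \<theta>)
          \<le> A + (1 - \<theta>) / \<theta> * (\<tau> powr p * w powr \<theta>)" by linarith
      qed (use \<theta> \<Gamma> E0 in auto)
      finally show ?thesis .
    qed
    have pw: "ennreal (f x powr q) \<le> ennreal (t 1 powr q) +
       (\<Sum>k. ennreal (\<mu> powr q * t (Suc k) powr q) * indicator {x \<in> space M. t (Suc k) < f x} x)"
      (is "_ \<le> _ + (\<Sum>k. ?g k)") if x: "x \<in> space M" for x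
    proof (cases "f x \<le> t 1")
      case True
      then have "f x powr q \<le> t 1 powr q" using f0[OF x] qp by (intro powr_mono2) auto
      then show ?thesis by (auto intro!: order_trans[OF ennreal_leI] simp: add_increasing2)
    next
      case False
      have "\<exists>n. f x / \<tau> < \<mu> ^ n" using \<mu> by (rule real_arch_pow)
      then have ex: "\<exists>n. f x \<le> t n" using \<tau> by (auto simp: t_def field_simps intro: less_imp_le)
      define N where "N = (LEAST n. f x \<le> t n)"
      have N: "f x \<le> t N" unfolding N_def using ex by (rule LeastI_ex)
      have "t 0 < t 1" using tmono by (simp add: strict_monoD)
      then have N2: "N \<noteq> 0" "N \<noteq> 1" using N False by (metis less_le_not_le order_trans, metis)
      then obtain k where k: "N = Suc (Suc k)" by (metis One_nat_def not0_implies_Suc)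
      have lt: "t (Suc k) < f x"
        using not_less_Least[of "Suc k" "\<lambda>n. f x \<le> t n"] k by (auto simp: N_def not_le)
      have "f x powr q \<le> t (Suc (Suc k)) powr q" using f0[OF x] qp N k by (intro powr_mono2) auto
      also have "\<dots> = \<mu> powr q * t (Suc k) powr q"
        using \<mu> \<tau> by (simp add: t_def powr_mult)
      finally have "ennreal (f x powr q) \<le> ?g k" using lt x by (simp add: ennreal_leI)
      also have "\<dots> \<le> (\<Sum>k. ?g k)"
      proof -
        have single: "g k \<le> suminf g" for g :: "nat \<Rightarrow> ennreal"
          using sum_le_suminf[of g "{k}"] by simp
        show ?thesis by (rule single)
      qed
      finally show ?thesis by (simp add: add_increasing)
    qed
    have "(\<integral>\<^sup>+x. ennreal (f x powr q) \<partial>M) \<le> (\<integral>\<^sup>+x. ennreal (t 1 powr q) +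
       (\<Sum>k. ennreal (\<mu> powr q * t (Suc k) powr q) * indicator {x \<in> space M. t (Suc k) < f x} x) \<partial>M)"
      using pw by (rule nn_integral_mono)
    also have "\<dots> = ennreal (t 1 powr q) * emeasure M (space M) +
       (\<Sum>k. ennreal (\<mu> powr q * t (Suc k) powr q) * emeasure M {x \<in> space M. t (Suc k) < f x})"
      by (simp add: nn_integral_add nn_integral_suminf nn_integral_cmult_indicator)
    also have "\<dots> = ennreal (t 1 powr q * w) + (\<Sum>k. ennreal (\<mu> powr q * (t (Suc k) powr q * b (t (Suc k)))))"
      by (simp add: emeasure_eq_measure w_def b_def ennreal_mult[symmetric] mult.assoc)
    also have "(\<Sum>k. ennreal (\<mu> powr q * (t (Suc k) powr q * b (t (Suc k))))) \<le> ennreal (exp 1 * S)"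
    proof (rule suminf_le_const)
      fix K
      have "(\<Sum>k<K. ennreal (\<mu> powr q * (t (Suc k) powr q * b (t (Suc k)))))
         = ennreal (\<mu> powr q * (\<Sum>k<K. t (Suc k) powr q * b (t (Suc k))))"
        by (simp add: sum_distrib_left b_def sum_ennreal)
      also have "\<dots> \<le> ennreal (exp 1 * S)"
        using partial[of K] \<mu>q by (intro ennreal_leI mult_mono) (auto simp: b_def intro!: sum_nonneg)
      finally show "(\<Sum>k<K. ennreal (\<mu> powr q * (t (Suc k) powr q * b (t (Suc k))))) \<le> ennreal (exp 1 * S)" .
    qed auto
    also have "ennreal (t 1 powr q * w) + ennreal (exp 1 * S) = ennreal (bd \<tau>)"
      by (subst ennreal_plus[symmetric]) (auto simp: bd_def S_def t_def w_def)
    finally show ?thesis by simp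
  qed
  have "((\<lambda>\<tau>. bd \<tau>) \<longlongrightarrow> exp 1 * A powr (1 / \<theta>)) (at_right 0)"
  proof -
    have p0: "((\<lambda>\<tau>::real. (\<tau> * c) powr r) \<longlongrightarrow> (0 * c) powr r) (at_right 0)" if "0 < c" "0 < r" for c r :: real
      using that by (intro tendsto_powr' tendsto_intros)
        (auto simp: eventually_at_filter)
    have t1: "((\<lambda>\<tau>. (\<tau> * \<mu>) powr q) \<longlongrightarrow> 0) (at_right 0)"
      using p0[of \<mu> q] \<mu> qp by simp
    have t2: "((\<lambda>\<tau>. \<tau> powr p) \<longlongrightarrow> 0) (at_right 0)"
      using p0[of 1 p] p by simp
    have "((\<lambda>\<tau>. A + (1 - \<theta>) / \<theta> * (\<tau> powr p * w powr \<theta>))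
        \<longlongrightarrow> A + (1 - \<theta>) / \<theta> * (0 * w powr \<theta>)) (at_right 0)"
      by (intro tendsto_intros t2)
    then have t3: "((\<lambda>\<tau>. (A + (1 - \<theta>) / \<theta> * (\<tau> powr p * w powr \<theta>)) powr (1 / \<theta>))
        \<longlongrightarrow> (A + (1 - \<theta>) / \<theta> * (0 * w powr \<theta>)) powr (1 / \<theta>)) (at_right 0)"
      using A0 \<theta> by (intro tendsto_powr' tendsto_const)
        (auto intro!: always_eventually add_nonneg_nonneg)
    have "((\<lambda>\<tau>. bd \<tau>) \<longlongrightarrow> 0 * w
      + exp 1 * (A + (1 - \<theta>) / \<theta> * (0 * w powr \<theta>)) powr (1 / \<theta>)) (at_right 0)"
      unfolding bd_def by (intro tendsto_add tendsto_mult tendsto_const t1 t3)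
    then show ?thesis by simp
  qed
  then have "((\<lambda>\<tau>. ennreal (bd \<tau>)) \<longlongrightarrow> ennreal (exp 1 * A powr (1 / \<theta>))) (at_right 0)"
    by (rule tendsto_ennrealI)
  moreover have "\<forall>\<^sub>F \<tau> in at_right 0. (\<integral>\<^sup>+x. ennreal (f x powr q) \<partial>M) \<le> ennreal (bd \<tau>)"
    unfolding eventually_at_filter by (rule always_eventually) (simp add: bound)
  ultimately have "(\<integral>\<^sup>+x. ennreal (f x powr q) \<partial>M) \<le> ennreal (exp 1 * A powr (1 / \<theta>))"
    by (rule tendsto_lowerbound) simp
  then show ?thesis by (simp add: A_def)
qed

section \<open>Truncations of a function\<close>

text \<open>The part of the value \<open>y\<close> between the levels \<open>s\<close> and \<open>t\<close>, measured from \<open>s\<close>.\<close>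

definition layer :: "real \<Rightarrow> real \<Rightarrow> real \<Rightarrow> real" where
  "layer s t y = max 0 (min (y - s) (t - s))"

lemma layer_measurable [measurable]: "layer s t \<in> borel_measurable borel"
  unfolding layer_def by measurable

lemma layer_mono: "z \<le> y \<Longrightarrow> layer s t z \<le> layer s t y"
  by (auto simp: layer_def)

lemma layer_contraction: "\<bar>layer s t y - layer s t z\<bar> \<le> \<bar>y - z\<bar>"
  by (auto simp: layer_def max_def min_def)

lemma sum_layer:
  assumes "mono t"
  shows "(\<Sum>k<K. layer (t k) (t (Suc k)) y) = layer (t 0) (t K) y"
proof (induction K)
  case 0
  then show ?case by (auto simp: layer_def)
next
  case (Suc K)
  have "t 0 \<le> t K" "t K \<le> t (Suc K)" using assms by (auto simp: monoD)
  then show ?case using Suc by (auto simp: layer_def)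
qed

text \<open>The layers are monotone functions that sum to a contraction, so the increments of the layers have the
  same sign and add up to at most the increment \<open>y - z\<close>; the \<open>p\<close>-th powers are superadditive.\<close>

lemma sum_layer_powr_le:
  assumes "mono t" "1 \<le> p"
  shows "(\<Sum>k<K. \<bar>layer (t k) (t (Suc k)) y - layer (t k) (t (Suc k)) z\<bar> powr p) \<le> \<bar>y - z\<bar> powr p"
proof -
  let ?L = "\<lambda>k. layer (t k) (t (Suc k))"
  have main: "(\<Sum>k<K. \<bar>?L k y - ?L k z\<bar> powr p) \<le> \<bar>y - z\<bar> powr p" if "z \<le> y" for y z
  proof -
    have "(\<Sum>k<K. \<bar>?L k y - ?L k z\<bar> powr p) \<le> (\<Sum>k<K. \<bar>?L k y - ?L k z\<bar>) powr p"
      using assms by (intro sum_powr_le_powr_sum) auto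
    also have "(\<Sum>k<K. \<bar>?L k y - ?L k z\<bar>) = (\<Sum>k<K. ?L k y) - (\<Sum>k<K. ?L k z)"
      using layer_mono[OF that] by (simp add: sum_subtractf[symmetric] cong: sum.cong)
    also have "\<dots> = layer (t 0) (t K) y - layer (t 0) (t K) z"
      using assms by (simp add: sum_layer)
    also have "\<dots> powr p \<le> \<bar>y - z\<bar> powr p"
      using assms layer_mono[OF that] layer_contraction[of "t 0" "t K" y z]
      by (intro powr_mono2) auto
    finally show ?thesis .
  qed
  show ?thesis
  proof (cases "z \<le> y")
    case False
    then have "(\<Sum>k<K. \<bar>?L k z - ?L k y\<bar> powr p) \<le> \<bar>z - y\<bar> powr p" by (intro main) auto
    then show ?thesis by (simp add: abs_minus_commute)
  qed (rule main)
qed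

lemma frac_energy_mono:
  assumes "\<And>y z. \<bar>f y - f z\<bar> \<le> \<bar>u y - u z\<bar>" "0 \<le> p"
  shows "frac_energy p s f W Q \<le> frac_energy p s u W Q"
  unfolding frac_energy_def frac_kernel_def
  by (intro nn_integral_mono mult_left_mono ennreal_leI divide_right_mono powr_mono2 assms) auto

lemma sum_frac_energy_layer:
  assumes [measurable]: "f \<in> borel_measurable borel" "W \<in> borel_measurable borel" "Q \<in> sets borel"
    and "mono t" "1 \<le> p"
  shows "(\<Sum>k<K. frac_energy p s (\<lambda>x. layer (t k) (t (Suc k)) (f x)) W Q) \<le> frac_energy p s f W Q"
proof -
  let ?v = "\<lambda>k x. layer (t k) (t (Suc k)) (f x)"
  have "(\<Sum>k<K. frac_energy p s (?v k) W Q) = (\<integral>\<^sup>+y. indicator Q y * W y *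
     (\<integral>\<^sup>+z. indicator Q z * (\<Sum>k<K. ennreal (frac_kernel p s (?v k) y z)) \<partial>lborel) \<partial>lborel)"
  proof -
    have "(\<integral>\<^sup>+z. indicator Q z * (\<Sum>k<K. ennreal (frac_kernel p s (?v k) y z)) \<partial>lborel)
        = (\<Sum>k<K. \<integral>\<^sup>+z. indicator Q z * ennreal (frac_kernel p s (?v k) y z) \<partial>lborel)" for y
      unfolding sum_distrib_left by (rule nn_integral_sum) measurable
    then show ?thesis
      unfolding frac_energy_def
      by (simp only: sum_distrib_left) (rule nn_integral_sum[symmetric], measurable)
  qed
  also have "\<dots> \<le> frac_energy p s f W Q"
    unfolding frac_energy_def
  proof (intro nn_integral_mono mult_left_mono)
    fix y z
    have "(\<Sum>k<K. frac_kernel p s (?v k) y z) \<le> frac_kernel p s f y z"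
      unfolding frac_kernel_def sum_divide_distrib[symmetric]
      using assms by (intro divide_right_mono sum_layer_powr_le) auto
    then show "(\<Sum>k<K. ennreal (frac_kernel p s (?v k) y z)) \<le> ennreal (frac_kernel p s f y z)"
      by (simp add: ennreal_leI)
  qed auto
  finally show ?thesis .
qed

text \<open>The mesh must divide the side \<open>l\<close>, so the volume \<open>2 A\<close> can be matched only up to a factor \<open>2 ^ n\<close>.\<close>

lemma exists_grid_size:
  fixes A l :: real and n :: nat
  assumes "0 < A" "0 < l" "0 < n" "A \<le> l ^ n / 2"
  shows "\<exists>m. 0 < m \<and> 2 * A \<le> (l / real m) ^ n \<and> (l / real m) ^ n \<le> 2 ^ (n + 1) * A"
proof -
  define y where "y = root n (l ^ n / (2 * A))"
  have yn: "y ^ n = l ^ n / (2 * A)" using assms by (simp add: y_def)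
  have y1: "1 \<le> y" unfolding y_def using assms by (simp add: field_simps)
  define m where "m = nat \<lfloor>y\<rfloor>"
  have m: "0 < m" "real m \<le> y" "y < real m + 1" using y1 by (auto simp: m_def)
  have "1 \<le> real m" using m by simp
  then have y2: "y \<le> 2 * real m" using m by linarith
  have "real m ^ n \<le> y ^ n" using m by (intro power_mono) auto
  then have 1: "2 * A \<le> (l / real m) ^ n"
    using m assms yn by (simp add: power_divide field_simps)
  have "y ^ n \<le> (2 * real m) ^ n" using y1 y2 by (intro power_mono) auto
  then have "(l / real m) ^ n \<le> 2 ^ (n + 1) * A"
    using m assms yn by (simp add: power_divide power_mult_distrib field_simps)
  with 1 m show ?thesis by blast
qed

text \<open>Let \<open>S\<close> be the set where \<open>f > \<sigma>\<close>, with Lebesgue measure \<open>A\<close>. On a grid with cells of volume between \<open>2 A\<close>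
  and a multiple of \<open>A\<close>, the layer vanishes on at least half of every cell, and it equals \<open>\<tau> - \<sigma>\<close> where
  \<open>f > \<tau>\<close>. The Poincare inequality contributes \<open>r powr (p \<delta>)\<close>, which is comparable to \<open>A powr \<eta>\<close>, and the
  \<open>A\<^sub>1\<close> condition on the whole cube bounds \<open>A\<close> by the weight of \<open>S\<close>. The assumption on the set where
  \<open>f > 0\<close> ensures that the required cells fit into the cube.\<close>

lemma level_estimate:
  fixes f :: "real ^ 'n::finite \<Rightarrow> real"
  assumes [measurable]: "f \<in> borel_measurable borel" "W \<in> borel_measurable borel"
    and l: "0 < l" and Q: "Q = half_open_cube a l"
    and p: "1 \<le> p" and \<delta>: "0 < \<delta>" "\<delta> < 1" "p * \<delta> < real CARD('n)"
    and s: "s = real CARD('n) + p * \<delta>"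
    and A1: "A1_ae W C" and C: "1 \<le> C"
    and K: "K = 18 powr p * (6 * 2 ^ CARD('n) * real CARD('n) powr (2 * real CARD('n)))"
    and w: "(\<integral>\<^sup>+x. indicator Q x * W x \<partial>lborel) = ennreal w" "0 < w"
    and half: "emeasure lborel (Q \<inter> {x. 0 < f x}) \<le> ennreal (l ^ CARD('n) / 2)"
    and st: "0 \<le> \<sigma>" "\<sigma> < \<tau>"
    and fin: "frac_energy p s (\<lambda>x. layer \<sigma> \<tau> (f x)) W Q < \<infinity>"
    and M: "M = density lborel (\<lambda>x. indicator Q x * W x)"
    and \<eta>: "\<eta> = p * \<delta> / real CARD('n)"
    and \<Gamma>: "\<Gamma> = K * (1 - \<delta>) * C * 2 ^ (CARD('n) + 1) * (C * l ^ CARD('n) / w) powr \<eta>"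
  shows "(\<tau> - \<sigma>) powr p * measure M {x \<in> space M. \<tau> < f x}
    \<le> \<Gamma> * enn2real (frac_energy p s (\<lambda>x. layer \<sigma> \<tau> (f x)) W Q) * measure M {x \<in> space M. \<sigma> < f x} powr \<eta>"
proof -
  let ?n = "CARD('n)"
  define v where "v x = layer \<sigma> \<tau> (f x)" for x
  define S where "S = Q \<inter> {x. \<sigma> < f x}"
  define b where "b t = measure M {x \<in> space M. t < f x}" for t
  define e where "e = enn2real (frac_energy p s v W Q)"
  have [measurable]: "Q \<in> sets borel" "S \<in> sets borel" "v \<in> borel_measurable borel"
    unfolding Q S_def v_def by measurable
  have K0: "0 \<le> K" by (simp add: K)
  have \<Gamma>0: "0 \<le> \<Gamma>" using K0 \<delta> C by (simp add: \<Gamma>)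
  have \<eta>01: "0 < \<eta>" "\<eta> < 1" using p \<delta> by (auto simp: \<eta>)
  have e: "frac_energy p s v W Q = ennreal e" "0 \<le> e"
    using fin by (auto simp: e_def v_def[abs_def] less_top)
  have MQ: "emeasure M (space M) = ennreal w" by (simp add: M emeasure_density w)
  interpret finite_measure M by (rule finite_measureI) (simp add: MQ)
  have bI: "(\<integral>\<^sup>+x. indicator Q x * W x * indicator {x. t < f x} x \<partial>lborel) = ennreal (b t)" for t
  proof -
    have "ennreal (b t) = emeasure M {x \<in> space M. t < f x}"
      by (simp add: b_def emeasure_eq_measure)
    also have "\<dots> = (\<integral>\<^sup>+x. indicator Q x * W x * indicator {x. t < f x} x \<partial>lborel)"
      unfolding M by (subst emeasure_density) auto
    finally show ?thesis by simp
  qed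
  have b0: "0 \<le> b t" for t by (simp add: b_def)
  have SQ: "emeasure lborel S \<le> emeasure lborel (Q \<inter> {x. 0 < f x})"
    using st by (intro emeasure_mono) (auto simp: S_def)
  then have Shalf: "emeasure lborel S \<le> ennreal (l ^ ?n / 2)" using half by simp
  define A where "A = measure lborel S"
  have A: "emeasure lborel S = ennreal A" "0 \<le> A"
    using Shalf unfolding A_def
    by (auto simp: emeasure_eq_ennreal_measure top_unique intro!: emeasure_eq_ennreal_measure)
  have Al: "A \<le> l ^ ?n / 2" using Shalf A l by simp
  \<comment> \<open>Integrate the \<open>A\<^sub>1\<close> inequality for the whole cube over \<open>S\<close>.\<close>
  have Aw: "A * w \<le> C * l ^ ?n * b \<sigma>"
  proof -
    have "ennreal (A * w) = (\<integral>\<^sup>+x. indicator S x * ennreal w \<partial>lborel)"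
      using A w by (simp add: nn_integral_multc ennreal_mult)
    also have "\<dots> \<le> (\<integral>\<^sup>+x. ennreal (C * l ^ ?n) * (indicator Q x * W x * indicator {x. \<sigma> < f x} x) \<partial>lborel)"
    proof (rule nn_integral_mono_AE)
      have "AE x in lborel. x \<in> half_open_cube a l \<longrightarrow>
         (\<integral>\<^sup>+y\<in>half_open_cube a l. W y \<partial>lborel) \<le> ennreal (C * l ^ ?n) * W x"
        using A1 l by (simp add: A1_ae_def)
      then show "AE x in lborel. indicator S x * ennreal w
          \<le> ennreal (C * l ^ ?n) * (indicator Q x * W x * indicator {x. \<sigma> < f x} x)"
        by eventually_elim (auto simp: S_def w(1)[symmetric] Q indicator_def mult.commute)
    qed
    also have "\<dots> = ennreal (C * l ^ ?n) * ennreal (b \<sigma>)"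
      by (subst nn_integral_cmult) (auto simp: bI)
    also have "\<dots> = ennreal (C * l ^ ?n * b \<sigma>)"
      using C l b0 by (subst ennreal_mult[symmetric]) auto
    finally show ?thesis using C l b0 by (subst (asm) ennreal_le_iff) auto
  qed
  have goal: "(\<tau> - \<sigma>) powr p * b \<tau> \<le> \<Gamma> * e * b \<sigma> powr \<eta>"
  proof (cases "A = 0")
    case True
    have notS: "AE x in lborel. x \<notin> S"
      using A True by (intro AE_not_in) (auto simp: null_sets_def)
    have "(\<integral>\<^sup>+x. indicator Q x * W x * indicator {x. \<tau> < f x} x \<partial>lborel) = (\<integral>\<^sup>+(x :: real ^ 'n). 0 \<partial>lborel)"
    proof (rule nn_integral_cong_AE)
      show "AE x in lborel. indicator Q x * W x * indicator {x. \<tau> < f x} x = 0"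
        using notS
        by eventually_elim (use st in \<open>auto simp: S_def indicator_def\<close>)
    qed
    then have "b \<tau> = 0" using b0[of \<tau>] by (simp add: bI)
    then show ?thesis using \<Gamma>0 e by simp
  next
    case False
    then have Apos: "0 < A" using A by simp
    obtain m where m: "0 < m" "2 * A \<le> (l / real m) ^ ?n" "(l / real m) ^ ?n \<le> 2 ^ (?n + 1) * A"
      using exists_grid_size[OF Apos l _ Al] by auto
    define r where "r = l / real m"
    have r: "0 < r" using l m by (simp add: r_def)
    have cl: "grid_cell a r x \<subseteq> Q" if "x \<in> Q" for x
      using grid_cell_subset_cube[of l m x a] l m that by (simp add: Q r_def)
    have zero: "ennreal (r ^ ?n / 2) \<le> emeasure lborel (grid_cell a r x \<inter> {z. v z = 0})" if "x \<in> Q" for x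
    proof -
      let ?D = "grid_cell a r x"
      have [measurable]: "?D \<in> sets borel" using r by measurable
      have "ennreal (r ^ ?n) \<le> emeasure lborel ((?D \<inter> {z. v z = 0}) \<union> S)"
        unfolding emeasure_grid_cell[OF r, of a x, symmetric] using cl[OF that] st
        by (intro emeasure_mono) (auto simp: S_def v_def layer_def)
      also have "\<dots> \<le> emeasure lborel (?D \<inter> {z. v z = 0}) + emeasure lborel S"
        by (intro emeasure_subadditive) auto
      also have "\<dots> \<le> emeasure lborel (?D \<inter> {z. v z = 0}) + ennreal (r ^ ?n / 2)"
        using A m by (intro add_left_mono) (simp add: r_def ennreal_leI)
      finally have "ennreal (r ^ ?n / 2) + ennreal (r ^ ?n / 2)
          \<le> emeasure lborel (?D \<inter> {z. v z = 0}) + ennreal (r ^ ?n / 2)"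
        using r by (simp add: ennreal_plus[symmetric] del: ennreal_plus)
      then show ?thesis
        by (simp add: ennreal_add_left_cancel_le add.commute)
    qed
    have "ennreal ((\<tau> - \<sigma>) powr p * b \<tau>)
        = (\<integral>\<^sup>+x. ennreal ((\<tau> - \<sigma>) powr p) * (indicator Q x * W x * indicator {x. \<tau> < f x} x) \<partial>lborel)"
      using b0 by (subst nn_integral_cmult) (auto simp: bI ennreal_mult)
    also have "\<dots> \<le> (\<integral>\<^sup>+x. indicator Q x * W x * ennreal (\<bar>v x\<bar> powr p) \<partial>lborel)"
      using st by (intro nn_integral_mono) (auto simp: indicator_def v_def layer_def mult.commute min_def)
    also have "\<dots> \<le> ennreal (K * (1 - \<delta>) * C * r powr (p * \<delta>)) * frac_energy p s v W Q"
      using r cl p \<delta> s A1 C zero K by (intro fractional_poincare_cells) auto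
    also have "\<dots> = ennreal (K * (1 - \<delta>) * C * r powr (p * \<delta>) * e)"
      using e K0 \<delta> C by (subst e(1), subst ennreal_mult[symmetric]) auto
    finally have "(\<tau> - \<sigma>) powr p * b \<tau> \<le> K * (1 - \<delta>) * C * r powr (p * \<delta>) * e"
      using K0 \<delta> C e by (subst (asm) ennreal_le_iff) auto
    also have "\<dots> \<le> K * (1 - \<delta>) * C * (2 ^ (?n + 1) * ((C * l ^ ?n / w) powr \<eta> * b \<sigma> powr \<eta>)) * e"
    proof (intro mult_right_mono mult_left_mono)
      have "r powr (p * \<delta>) = (r ^ ?n) powr \<eta>"
        using r by (simp add: powr_realpow[symmetric] powr_powr \<eta>)
      also have "\<dots> \<le> (2 ^ (?n + 1) * A) powr \<eta>"
        using m r \<eta>01 by (intro powr_mono2) (auto simp: r_def)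
      also have "\<dots> = (2 ^ (?n + 1)) powr \<eta> * A powr \<eta>"
        using A by (simp add: powr_mult)
      also have "\<dots> \<le> (2 ^ (?n + 1)) powr 1 * ((C * l ^ ?n / w) * b \<sigma>) powr \<eta>"
      proof (intro mult_mono)
        show "((2 :: real) ^ (?n + 1)) powr \<eta> \<le> (2 ^ (?n + 1)) powr 1"
        proof (rule powr_mono)
          show "(1 :: real) \<le> 2 ^ (?n + 1)" by (rule one_le_power) simp
        qed (use \<eta>01 in auto)
        show "A powr \<eta> \<le> ((C * l ^ ?n / w) * b \<sigma>) powr \<eta>"
          using Aw w \<eta>01 A by (intro powr_mono2) (auto simp: field_simps)
      qed auto
      also have "\<dots> = 2 ^ (?n + 1) * ((C * l ^ ?n / w) powr \<eta> * b \<sigma> powr \<eta>)"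
        by (simp only: powr_mult) simp
      finally show "r powr (p * \<delta>) \<le> 2 ^ (?n + 1) * ((C * l ^ ?n / w) powr \<eta> * b \<sigma> powr \<eta>)" .
    qed (use K0 \<delta> C e in auto)
    also have "\<dots> = \<Gamma> * e * b \<sigma> powr \<eta>" by (simp only: \<Gamma> mult_ac)
    finally show ?thesis .
  qed
  then show ?thesis by (simp add: b_def e_def v_def[abs_def])
qed

section \<open>Medians\<close>

text \<open>The median is the infimum of all \<open>t\<close> for which \<open>{u > t}\<close> has at most half of the mass; continuity of the
  measure along monotone sequences gives both inequalities.\<close>

lemma (in finite_measure) median_exists:
  fixes u :: "'a \<Rightarrow> real"
  assumes [measurable]: "u \<in> borel_measurable M"
  shows "\<exists>m. measure M {x \<in> space M. m < u x} \<le> measure M (space M) / 2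
    \<and> measure M {x \<in> space M. u x < m} \<le> measure M (space M) / 2"
proof (cases "measure M (space M) = 0")
  case True
  then have "measure M A = 0" for A
    using bounded_measure[of A] measure_nonneg[of M A] by linarith
  then show ?thesis by simp
next
  case False
  define V where "V = measure M (space M)"
  have V: "0 < V" using False by (simp add: V_def less_le)
  define G where "G t = measure M {x \<in> space M. t < u x}" for t
  have anti: "G t \<le> G s" if "s \<le> t" for s t
    unfolding G_def using that by (intro finite_measure_mono) auto
  have compl: "measure M {x \<in> space M. u x \<le> t} = V - G t" for t
  proof -
    have "{x \<in> space M. u x \<le> t} = space M - {x \<in> space M. t < u x}" by auto
    then show ?thesis unfolding V_def G_def by (simp add: finite_measure_compl)
  qed
  define S where "S = {t. G t \<le> V / 2}"
  have "(\<lambda>n. G (real n)) \<longlonglongrightarrow> measure M (\<Inter>n. {x \<in> space M. real n < u x})"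
    unfolding G_def by (rule finite_Lim_measure_decseq) (auto simp: decseq_def)
  moreover have "(\<Inter>n. {x \<in> space M. real n < u x}) = {}"
  proof -
    have "\<not> (\<forall>n. real n < y)" for y
      using reals_Archimedean2[of y] by (meson less_asym)
    then show ?thesis by blast
  qed
  ultimately have "(\<lambda>n. G (real n)) \<longlonglongrightarrow> 0" by simp
  then have "\<forall>\<^sub>F n in sequentially. G (real n) < V / 2"
    by (rule order_tendstoD) (use V in simp)
  then obtain n where "G (real n) < V / 2" by (auto simp: eventually_sequentially)
  then have ne: "S \<noteq> {}" by (auto simp: S_def intro: less_imp_le)
  have "(\<lambda>n. G (- real n)) \<longlonglongrightarrow> measure M (\<Union>n. {x \<in> space M. - real n < u x})"
    unfolding G_def by (rule finite_Lim_measure_incseq) (auto simp: incseq_def)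
  moreover have "(\<Union>n. {x \<in> space M. - real n < u x}) = space M"
  proof -
    have "\<exists>n. - real n < y" for y
      using reals_Archimedean2[of "- y"] by (metis minus_less_iff)
    then show ?thesis by auto
  qed
  ultimately have "(\<lambda>n. G (- real n)) \<longlonglongrightarrow> V" by (simp add: V_def)
  then have "\<forall>\<^sub>F n in sequentially. V / 2 < G (- real n)"
    by (rule order_tendstoD) (use V in simp)
  then obtain k where k: "V / 2 < G (- real k)" by (auto simp: eventually_sequentially)
  have bdd: "bdd_below S"
  proof (rule bdd_belowI)
    fix t assume "t \<in> S"
    then show "- real k \<le> t" using k anti[of t "- real k"] by (cases "t \<le> - real k") (auto simp: S_def)
  qed
  define m where "m = Inf S"
  have above: "G t \<le> V / 2" if t: "m < t" for t
  proof -
    obtain s where "s \<in> S" "s < t" using t cInf_lessD[OF ne, of t] unfolding m_def by blast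
    then show ?thesis using anti[of s t] by (auto simp: S_def)
  qed
  have below: "V / 2 < G t" if "t < m" for t
  proof (rule ccontr)
    assume "\<not> V / 2 < G t"
    then have "m \<le> t" unfolding m_def using bdd by (intro cInf_lower) (auto simp: S_def)
    then show False using that by simp
  qed
  have ex: "\<exists>n. inverse (real (Suc n)) < d" if "0 < d" for d
    using reals_Archimedean[OF that] .
  have "(\<lambda>n. G (m + inverse (real (Suc n)))) \<longlonglongrightarrow> measure M (\<Union>n. {x \<in> space M. m + inverse (real (Suc n)) < u x})"
    unfolding G_def
  proof (rule finite_Lim_measure_incseq)
    show "incseq (\<lambda>n. {x \<in> space M. m + inverse (real (Suc n)) < u x})"
    proof (rule incseq_SucI, safe)
      fix n x assume "m + inverse (real (Suc n)) < u x"
      moreover have "inverse (real (Suc (Suc n))) \<le> inverse (real (Suc n))" by (rule le_imp_inverse_le) auto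
      ultimately show "m + inverse (real (Suc (Suc n))) < u x" by linarith
    qed
  qed auto
  moreover have "(\<Union>n. {x \<in> space M. m + inverse (real (Suc n)) < u x}) = {x \<in> space M. m < u x}"
  proof -
    have "m < y \<longleftrightarrow> (\<exists>n. m + inverse (real (Suc n)) < y)" for y
    proof
      assume "m < y"
      then show "\<exists>n. m + inverse (real (Suc n)) < y" using ex[of "y - m"] by (auto simp: algebra_simps)
    next
      assume "\<exists>n. m + inverse (real (Suc n)) < y"
      then obtain n where n: "m + inverse (real (Suc n)) < y" by blast
      have "0 < inverse (real (Suc n))" by simp
      then show "m < y" using n by linarith
    qed
    then show ?thesis by auto
  qed
  moreover have "G (m + inverse (real (Suc n))) \<le> V / 2" for n
    by (rule above) simp
  ultimately have 1: "measure M {x \<in> space M. m < u x} \<le> V / 2"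
    by (intro LIMSEQ_le_const2) auto
  have "(\<lambda>n. measure M {x \<in> space M. u x \<le> m - inverse (real (Suc n))})
      \<longlonglongrightarrow> measure M (\<Union>n. {x \<in> space M. u x \<le> m - inverse (real (Suc n))})"
  proof (rule finite_Lim_measure_incseq)
    show "incseq (\<lambda>n. {x \<in> space M. u x \<le> m - inverse (real (Suc n))})"
    proof (rule incseq_SucI, safe)
      fix n x assume "u x \<le> m - inverse (real (Suc n))"
      moreover have "inverse (real (Suc (Suc n))) \<le> inverse (real (Suc n))" by (rule le_imp_inverse_le) auto
      ultimately show "u x \<le> m - inverse (real (Suc (Suc n)))" by linarith
    qed
  qed auto
  moreover have "(\<Union>n. {x \<in> space M. u x \<le> m - inverse (real (Suc n))}) = {x \<in> space M. u x < m}"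
  proof -
    have "y < m \<longleftrightarrow> (\<exists>n. y \<le> m - inverse (real (Suc n)))" for y
    proof
      assume "y < m"
      then show "\<exists>n. y \<le> m - inverse (real (Suc n))"
        using ex[of "m - y"] by (auto simp: algebra_simps intro: less_imp_le)
    next
      assume "\<exists>n. y \<le> m - inverse (real (Suc n))"
      then obtain n where n: "y \<le> m - inverse (real (Suc n))" by blast
      have "0 < inverse (real (Suc n))" by simp
      then show "y < m" using n by linarith
    qed
    then show ?thesis by auto
  qed
  moreover have "measure M {x \<in> space M. u x \<le> m - inverse (real (Suc n))} \<le> V / 2" for n
    using below[of "m - inverse (real (Suc n))"] by (simp add: compl)
  ultimately have 2: "measure M {x \<in> space M. u x < m} \<le> V / 2"
    by (intro LIMSEQ_le_const2) auto
  show ?thesis using 1 2 unfolding V_def by blast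
qed

lemma median_on_cube:
  fixes u :: "real ^ 'n::finite \<Rightarrow> real"
  assumes [measurable]: "u \<in> borel_measurable borel" and l: "0 < l"
  shows "\<exists>m. emeasure lborel (half_open_cube a l \<inter> {x. m < u x}) \<le> ennreal (l ^ CARD('n) / 2)
    \<and> emeasure lborel (half_open_cube a l \<inter> {x. u x < m}) \<le> ennreal (l ^ CARD('n) / 2)"
proof -
  let ?Q = "half_open_cube a l"
  define M where "M = density lborel (indicator ?Q :: real ^ 'n \<Rightarrow> ennreal)"
  have em: "emeasure M {x \<in> space M. P x} = emeasure lborel (?Q \<inter> {x. P x})"
    if [measurable]: "Measurable.pred borel P" for P
  proof -
    have "emeasure M {x \<in> space M. P x} = (\<integral>\<^sup>+x. indicator ?Q x * indicator {x. P x} x \<partial>lborel)"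
      unfolding M_def by (subst emeasure_density) auto
    also have "\<dots> = (\<integral>\<^sup>+x. indicator (?Q \<inter> {x. P x}) x \<partial>lborel)"
      by (intro nn_integral_cong) (auto simp: indicator_def)
    also have "\<dots> = emeasure lborel (?Q \<inter> {x. P x})" by (rule nn_integral_indicator) simp
    finally show ?thesis .
  qed
  have sp: "emeasure M (space M) = ennreal (l ^ CARD('n))"
    using em[of "\<lambda>_. True"] l by (simp add: emeasure_half_open_cube)
  interpret M: finite_measure M by (rule finite_measureI) (simp add: sp)
  have V: "measure M (space M) = l ^ CARD('n)" using sp l by (simp add: measure_def)
  have "u \<in> borel_measurable M" by (simp add: M_def)
  from M.median_exists[OF this] obtain m where
    "measure M {x \<in> space M. m < u x} \<le> l ^ CARD('n) / 2"
    "measure M {x \<in> space M. u x < m} \<le> l ^ CARD('n) / 2" unfolding V by blast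
  then have "emeasure M {x \<in> space M. m < u x} \<le> ennreal (l ^ CARD('n) / 2)"
    "emeasure M {x \<in> space M. u x < m} \<le> ennreal (l ^ CARD('n) / 2)"
    unfolding M.emeasure_eq_measure by (auto intro: ennreal_leI)
  then show ?thesis
    using em[of "\<lambda>x. m < u x"] em[of "\<lambda>x. u x < m"] by (intro exI[of _ m]) simp
qed

section \<open>The inequality on half-open cubes\<close>

lemma one_sided_sobolev:
  fixes f u :: "real ^ 'n::finite \<Rightarrow> real"
  assumes [measurable]: "f \<in> borel_measurable borel" "W \<in> borel_measurable borel"
    and f0: "\<And>x. 0 \<le> f x" and fu: "\<And>x y. \<bar>f x - f y\<bar> \<le> \<bar>u x - u y\<bar>"
    and l: "0 < l" and Q: "Q = half_open_cube a l"
    and p: "1 \<le> p" and \<delta>: "0 < \<delta>" "\<delta> < 1" "p * \<delta> < real CARD('n)"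
    and s: "s = real CARD('n) + p * \<delta>"
    and A1: "A1_ae W C" and C: "1 \<le> C"
    and K: "K = 18 powr p * (6 * 2 ^ CARD('n) * real CARD('n) powr (2 * real CARD('n)))"
    and w: "(\<integral>\<^sup>+x. indicator Q x * W x \<partial>lborel) = ennreal w" "0 < w"
    and half: "emeasure lborel (Q \<inter> {x. 0 < f x}) \<le> ennreal (l ^ CARD('n) / 2)"
    and e: "frac_energy p s u W Q = ennreal e" "0 \<le> e"
    and \<eta>: "\<eta> = p * \<delta> / real CARD('n)" and q: "q = p / (1 - \<eta>)"
    and \<Gamma>: "\<Gamma> = K * (1 - \<delta>) * C * 2 ^ (CARD('n) + 1) * (C * l ^ CARD('n) / w) powr \<eta>"
  shows "(\<integral>\<^sup>+x. indicator Q x * W x * ennreal (f x powr q) \<partial>lborel)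
    \<le> ennreal (exp 1 * (exp 1 * \<Gamma> * e * (q + 1) powr p) powr (1 / (1 - \<eta>)))"
proof -
  have [measurable]: "Q \<in> sets borel" unfolding Q by measurable
  define M where "M = density lborel (\<lambda>x. indicator Q x * W x)"
  define en where "en \<sigma> \<tau> = frac_energy p s (\<lambda>x. layer \<sigma> \<tau> (f x)) W Q" for \<sigma> \<tau>
  have \<eta>01: "0 < \<eta>" "\<eta> < 1" using p \<delta> by (auto simp: \<eta>)
  have fin: "en \<sigma> \<tau> < \<infinity>" for \<sigma> \<tau>
  proof -
    have "en \<sigma> \<tau> \<le> frac_energy p s u W Q"
      unfolding en_def using p
      by (intro frac_energy_mono order_trans[OF layer_contraction fu]) auto
    then show ?thesis using e by (auto intro: le_less_trans)
  qed
  have MQ: "emeasure M (space M) = ennreal w" by (simp add: M_def emeasure_density w)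
  have "(\<integral>\<^sup>+x. indicator Q x * W x * ennreal (f x powr q) \<partial>lborel) = (\<integral>\<^sup>+x. ennreal (f x powr q) \<partial>M)"
    unfolding M_def by (subst nn_integral_density) auto
  also have "\<dots> \<le> ennreal (exp 1 * (exp 1 * \<Gamma> * e * (q + 1) powr p) powr (1 / (1 - \<eta>)))"
  proof (rule strong_type_from_levels[where e = "\<lambda>\<sigma> \<tau>. enn2real (en \<sigma> \<tau>)"])
    show "finite_measure M" by (rule finite_measureI) (simp add: MQ)
    show "f \<in> borel_measurable M" by (simp add: M_def)
    show "0 \<le> \<Gamma>" using \<delta> C by (simp add: \<Gamma> K)
    show "(\<tau> - \<sigma>) powr p * measure M {x \<in> space M. \<tau> < f x}
      \<le> \<Gamma> * enn2real (en \<sigma> \<tau>) * measure M {x \<in> space M. \<sigma> < f x} powr (1 - (1 - \<eta>))"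
      if "0 < \<sigma>" "\<sigma> < \<tau>" for \<sigma> \<tau>
      using level_estimate[OF _ _ l Q p \<delta> s A1 C K w half _ _ _ M_def \<eta> \<Gamma>, of \<sigma> \<tau>] that fin[of \<sigma> \<tau>]
      by (simp add: en_def)
    show "(\<Sum>k<K. enn2real (en (t k) (t (Suc k)))) \<le> e" if "strict_mono t" for t :: "nat \<Rightarrow> real" and K
    proof -
      have "ennreal (\<Sum>k<K. enn2real (en (t k) (t (Suc k)))) = (\<Sum>k<K. en (t k) (t (Suc k)))"
        using fin by (simp add: sum_ennreal[symmetric] less_top)
      also have "\<dots> \<le> frac_energy p s f W Q"
        unfolding en_def using p strict_mono_mono[OF that] by (intro sum_frac_energy_layer) auto
      also have "\<dots> \<le> ennreal e"
        unfolding e(1)[symmetric] using p fu by (intro frac_energy_mono) auto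
      finally show ?thesis using e by (simp add: ennreal_le_iff)
    qed
  qed (use f0 p \<eta>01 q in auto)
  finally show ?thesis .
qed

text \<open>The powers of \<open>w\<close> combine because \<open>1/q + \<delta>/n = 1/p\<close>. The numbers \<open>k\<close> and \<open>h\<close> collect dimensional constants
  that occur under a \<open>p\<close>-th root; they are at least 1, so the root is dropped.\<close>

lemma final_constant:
  fixes n :: real
  assumes p: "1 \<le> p" and \<delta>: "0 < \<delta>" "\<delta> < 1" "p * \<delta> < n" and n: "1 \<le> n"
    and \<eta>: "\<eta> = p * \<delta> / n" and q: "q = p / (1 - \<eta>)"
    and C: "1 \<le> C" and l: "0 < l" and w: "0 < w" and e: "0 \<le> e"
    and k: "1 \<le> k" and h: "1 \<le> h"
    and \<Gamma>: "\<Gamma> = 18 powr p * k * (1 - \<delta>) * C * h * (C * l powr n / w) powr \<eta>"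
    and I: "0 \<le> I" "I \<le> 2 * (exp 1 * (exp 1 * \<Gamma> * e * (q + 1) powr p) powr (1 / (1 - \<eta>)))"
  shows "(1 / w * I) powr (1 / q)
    \<le> (72 * exp 1 ^ 2 * k * h) * q * (1 - \<delta>) powr (1 / p) * C powr (\<delta> / n + 1 / p) * l powr \<delta>
        * (1 / w * e) powr (1 / p)"
proof -
  have \<eta>01: "0 < \<eta>" "\<eta> < 1" using p \<delta> n by (auto simp: \<eta>)
  have q1: "1 \<le> q" using p \<eta>01 by (simp add: q field_simps)
  have \<Gamma>0: "0 \<le> \<Gamma>" using \<delta> C k h by (simp add: \<Gamma>)
  have qi: "1 / (1 - \<eta>) * (1 / q) = 1 / p" using \<eta>01 p by (simp add: q)
  have \<eta>p: "\<eta> * (1 / p) = \<delta> / n" using p by (simp add: \<eta>)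
  have wq: "(1 / w) powr (1 / q) * (1 / w) powr (\<delta> / n) = (1 / w) powr (1 / p)"
  proof -
    have "1 / q + \<delta> / n = 1 / p" using p \<eta>01 n by (simp add: q \<eta> field_simps)
    then show ?thesis by (simp add: powr_add[symmetric])
  qed
  have \<Gamma>p: "\<Gamma> powr (1 / p) = 18 * (k powr (1 / p) * h powr (1 / p)) *
      ((1 - \<delta>) powr (1 / p) * C powr (\<delta> / n + 1 / p) * l powr \<delta> * (1 / w) powr (\<delta> / n))"
  proof -
    have "((C * l powr n / w) powr \<eta>) powr (1 / p) = (C * l powr n * (1 / w)) powr (\<delta> / n)"
      by (simp only: powr_powr \<eta>p) simp
    also have "\<dots> = C powr (\<delta> / n) * l powr \<delta> * (1 / w) powr (\<delta> / n)"
      using C l w n by (simp add: powr_mult powr_powr powr_divide)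
    finally have 1: "((C * l powr n / w) powr \<eta>) powr (1 / p) = C powr (\<delta> / n) * l powr \<delta> * (1 / w) powr (\<delta> / n)" .
    have 2: "(18 powr p) powr (1 / p) = (18 :: real)" using p by (simp add: powr_powr)
    show ?thesis
      unfolding \<Gamma> using \<delta> C k h l w
      by (simp add: powr_mult 1 2 powr_add del: powr_powr) 
  qed
  have "(1 / w * I) powr (1 / q)
     \<le> (1 / w * (2 * (exp 1 * (exp 1 * \<Gamma> * e * (q + 1) powr p) powr (1 / (1 - \<eta>))))) powr (1 / q)"
    using I w q1 by (intro powr_mono2 mult_left_mono) auto
  also have "\<dots> = (1 / w) powr (1 / q) * ((2 * exp 1) powr (1 / q) *
      (exp 1 * \<Gamma> * e * (q + 1) powr p) powr (1 / p))"
    by (simp only: powr_mult powr_powr qi mult.assoc)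
  also have "\<dots> = (1 / w) powr (1 / q) * ((2 * exp 1) powr (1 / q) *
      (exp 1 powr (1 / p) * \<Gamma> powr (1 / p) * e powr (1 / p) * (q + 1)))"
    using \<Gamma>0 e q1 p by (simp add: powr_mult powr_powr)
  also have "\<dots> = ((2 * exp 1) powr (1 / q) * exp 1 powr (1 / p) * 18 * (k powr (1 / p) * h powr (1 / p)) * (q + 1))
      * ((1 - \<delta>) powr (1 / p) * C powr (\<delta> / n + 1 / p) * l powr \<delta>
         * (((1 / w) powr (1 / q) * (1 / w) powr (\<delta> / n)) * e powr (1 / p)))"
    unfolding \<Gamma>p by (simp only: mult_ac)
  also have "((1 / w) powr (1 / q) * (1 / w) powr (\<delta> / n)) * e powr (1 / p) = (1 / w * e) powr (1 / p)"
    using w e by (simp only: wq, subst powr_mult) auto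
  also have "((2 * exp 1) powr (1 / q) * exp 1 powr (1 / p) * 18 * (k powr (1 / p) * h powr (1 / p)) * (q + 1))
      * ((1 - \<delta>) powr (1 / p) * C powr (\<delta> / n + 1 / p) * l powr \<delta> * (1 / w * e) powr (1 / p))
     \<le> ((2 * exp 1) * exp 1 * 18 * (k * h) * (2 * q))
      * ((1 - \<delta>) powr (1 / p) * C powr (\<delta> / n + 1 / p) * l powr \<delta> * (1 / w * e) powr (1 / p))"
  proof -
    have root: "x powr (1 / r) \<le> x" if "1 \<le> x" "1 \<le> r" for x r :: real
      using powr_mono[of "1 / r" 1 x] that by simp
    have "(1 :: real) \<le> exp 1" by simp
    then have e2: "1 \<le> 2 * exp (1 :: real)" by linarith
    show ?thesis
      using p q1 k h e2 root[OF e2 q1] root[of "exp 1" p]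
      by (intro mult_right_mono mult_mono root mult_nonneg_nonneg) auto
  qed
  finally show ?thesis by (simp add: power2_eq_square mult_ac)
qed

text \<open>The one-sided bound is applied to the positive and the negative part of \<open>u - m\<close>; that \<open>m\<close> is a median
  means precisely that both have a zero set of at least half the cube.\<close>

theorem fractional_sobolev_half_open_cube:
  fixes u :: "real ^ 'n::finite \<Rightarrow> real"
  assumes [measurable]: "u \<in> borel_measurable borel" "W \<in> borel_measurable borel"
    and l: "0 < l" and Q: "Q = half_open_cube a l"
    and p: "1 \<le> p" and \<delta>: "0 < \<delta>" "\<delta> < 1" "p * \<delta> < real CARD('n)"
    and A1: "A1_ae W C" and C: "1 \<le> C"
    and w: "(\<integral>\<^sup>+x. indicator Q x * W x \<partial>lborel) = ennreal w" "0 < w"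
    and q: "1 / p - 1 / q = \<delta> / real CARD('n)"
    and half: "emeasure lborel (Q \<inter> {x. m < u x}) \<le> ennreal (l ^ CARD('n) / 2)"
      "emeasure lborel (Q \<inter> {x. u x < m}) \<le> ennreal (l ^ CARD('n) / 2)"
    and c: "c = 72 * exp 1 ^ 2 * (6 * 2 ^ CARD('n) * real CARD('n) powr (2 * real CARD('n))) * 2 ^ (CARD('n) + 1)"
  shows "ennpowr (ennreal (1 / w) *
      (\<integral>\<^sup>+x. indicator Q x * W x * ennreal (\<bar>u x - m\<bar> powr q) \<partial>lborel)) (1 / q)
    \<le> ennreal (c * q * (1 - \<delta>) powr (1 / p) * C powr (\<delta> / real CARD('n) + 1 / p) * l powr \<delta>)
       * ennpowr (ennreal (1 / w) * frac_energy p (real CARD('n) + p * \<delta>) u W Q) (1 / p)"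
proof -
  let ?n = "real CARD('n)"
  let ?E = "frac_energy p (?n + p * \<delta>) u W Q"
  have n1: "1 \<le> ?n" by (simp add: Suc_le_eq)
  define \<eta> where "\<eta> = p * \<delta> / ?n"
  have \<eta>01: "0 < \<eta>" "\<eta> < 1" using p \<delta> by (auto simp: \<eta>_def)
  have q': "q = p / (1 - \<eta>)"
  proof -
    have "1 / q = (1 - \<eta>) / p"
      using q p by (simp add: \<eta>_def diff_divide_distrib)
    then show ?thesis by (metis inverse_divide inverse_eq_divide inverse_inverse_eq)
  qed
  have q0: "0 < q" using p \<eta>01 by (simp add: q')
  have c0: "0 < c" by (simp add: c)
  define R where "R = c * q * (1 - \<delta>) powr (1 / p) * C powr (\<delta> / ?n + 1 / p) * l powr \<delta>"
  have R0: "0 < R" using c0 q0 \<delta> C l by (simp add: R_def)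
  show ?thesis
  proof (cases "?E = \<infinity>")
    case True
    have "ennreal (1 / w) \<noteq> 0" "ennreal R \<noteq> 0" using w R0 by auto
    then have "ennreal R * ennpowr (ennreal (1 / w) * ?E) (1 / p) = \<infinity>"
      unfolding True by (simp add: ennpowr_def ennreal_mult_eq_top_iff)
    then show ?thesis by (simp add: R_def)
  next
    case False
    define e where "e = enn2real ?E"
    have e: "?E = ennreal e" "0 \<le> e" using False by (auto simp: e_def less_top)
    define k where "k = 6 * 2 ^ CARD('n) * ?n powr (2 * ?n)"
    define \<Gamma> where "\<Gamma> = 18 powr p * k * (1 - \<delta>) * C * 2 ^ (CARD('n) + 1) * (C * l ^ CARD('n) / w) powr \<eta>"
    define B where "B = exp 1 * (exp 1 * \<Gamma> * e * (q + 1) powr p) powr (1 / (1 - \<eta>))"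
    have B0: "0 \<le> B" by (simp add: B_def)
    have one: "(\<integral>\<^sup>+x. indicator Q x * W x * ennreal (f x powr q) \<partial>lborel) \<le> ennreal B"
      if [measurable]: "f \<in> borel_measurable borel" and "\<And>x. 0 \<le> f x"
        and "\<And>x y. \<bar>f x - f y\<bar> \<le> \<bar>u x - u y\<bar>"
        and "emeasure lborel (Q \<inter> {x. 0 < f x}) \<le> ennreal (l ^ CARD('n) / 2)" for f
      unfolding B_def
      by (rule one_sided_sobolev[OF _ _ that(2,3) l Q p \<delta> refl A1 C refl w that(4) e \<eta>_def q'])
         (auto simp: \<Gamma>_def k_def)
    have pos: "(\<integral>\<^sup>+x. indicator Q x * W x * ennreal (max 0 (u x - m) powr q) \<partial>lborel) \<le> ennreal B"
    proof (rule one)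
      show "emeasure lborel (Q \<inter> {x. 0 < max 0 (u x - m)}) \<le> ennreal (l ^ CARD('n) / 2)"
      proof -
        have "0 < max 0 (u x - m) \<longleftrightarrow> m < u x" for x by (auto simp: max_def)
        then show ?thesis using half by (simp only:)
      qed
    qed (auto simp: max_def)
    have neg: "(\<integral>\<^sup>+x. indicator Q x * W x * ennreal (max 0 (m - u x) powr q) \<partial>lborel) \<le> ennreal B"
    proof (rule one)
      show "emeasure lborel (Q \<inter> {x. 0 < max 0 (m - u x)}) \<le> ennreal (l ^ CARD('n) / 2)"
      proof -
        have "0 < max 0 (m - u x) \<longleftrightarrow> u x < m" for x by (auto simp: max_def)
        then show ?thesis using half by (simp only:)
      qed
    qed (auto simp: max_def)
    define I where "I = (\<integral>\<^sup>+x. indicator Q x * W x * ennreal (\<bar>u x - m\<bar> powr q) \<partial>lborel)"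
    have [measurable]: "Q \<in> sets borel" unfolding Q by measurable
    have "I \<le> (\<integral>\<^sup>+x. indicator Q x * W x * ennreal (max 0 (u x - m) powr q)
        + indicator Q x * W x * ennreal (max 0 (m - u x) powr q) \<partial>lborel)"
      unfolding I_def
    proof (rule nn_integral_mono)
      fix x
      have "\<bar>u x - m\<bar> powr q \<le> max 0 (u x - m) powr q + max 0 (m - u x) powr q"
        by (auto simp: max_def abs_if)
      then have "ennreal (\<bar>u x - m\<bar> powr q) \<le> ennreal (max 0 (u x - m) powr q) + ennreal (max 0 (m - u x) powr q)"
        by (simp add: ennreal_plus[symmetric] ennreal_leI del: ennreal_plus)
      then show "indicator Q x * W x * ennreal (\<bar>u x - m\<bar> powr q)
         \<le> indicator Q x * W x * ennreal (max 0 (u x - m) powr q)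
          + indicator Q x * W x * ennreal (max 0 (m - u x) powr q)"
        unfolding distrib_left[symmetric] by (rule mult_left_mono) simp
    qed
    also have "\<dots> = (\<integral>\<^sup>+x. indicator Q x * W x * ennreal (max 0 (u x - m) powr q) \<partial>lborel)
        + (\<integral>\<^sup>+x. indicator Q x * W x * ennreal (max 0 (m - u x) powr q) \<partial>lborel)"
      by (rule nn_integral_add) measurable
    also have "\<dots> \<le> ennreal B + ennreal B" by (intro add_mono pos neg)
    finally have IB: "I \<le> ennreal (2 * B)" using B0 by (simp add: ennreal_plus[symmetric] del: ennreal_plus)
    define i where "i = enn2real I"
    have i: "I = ennreal i" "0 \<le> i" using le_less_trans[OF IB ennreal_less_top] by (auto simp: i_def)
    have iB: "i \<le> 2 * B" using IB i B0 by simp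
    have "(1 / w * i) powr (1 / q) \<le> R * (1 / w * e) powr (1 / p)"
      unfolding R_def c k_def[symmetric]
    proof (rule final_constant[where \<Gamma> = \<Gamma> and \<eta> = \<eta>])
      show "\<Gamma> = 18 powr p * k * (1 - \<delta>) * C * 2 ^ (CARD('n) + 1) * (C * l powr ?n / w) powr \<eta>"
        using l by (simp add: \<Gamma>_def powr_realpow)
      show "1 \<le> k"
      proof -
        have "1 * 1 * 1 \<le> 6 * 2 ^ CARD('n) * ?n powr (2 * ?n)"
          using n1 by (intro mult_mono ge_one_powr_ge_zero one_le_power) auto
        then show ?thesis by (simp add: k_def)
      qed
      show "(1 :: real) \<le> 2 ^ (CARD('n) + 1)" by (rule one_le_power) simp
    qed (use p \<delta> n1 \<eta>_def q' C l w e i iB in \<open>auto simp: B_def\<close>)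
    then have "ennreal ((1 / w * i) powr (1 / q)) \<le> ennreal R * ennreal ((1 / w * e) powr (1 / p))"
      using R0 by (simp add: ennreal_mult[symmetric] ennreal_leI)
    moreover have "ennpowr (ennreal (1 / w) * ennreal x) r = ennreal ((1 / w * x) powr r)" if "0 \<le> x" for x r
      using that w by (simp add: ennpowr_def ennreal_mult[symmetric])
    ultimately show ?thesis
      unfolding I_def[symmetric] R_def[symmetric] i(1) e(1) using i e by simp
  qed
qed

section \<open>Lebesgue measurable functions, arbitrary cubes and the \<open>A\<^sub>1\<close> constant\<close>

lemma locally_L1_measurable:
  fixes f :: "real ^ 'n::finite \<Rightarrow> real"
  assumes "locally_L1 f"
  shows "f \<in> borel_measurable lebesgue"
proof (rule borel_measurable_LIMSEQ_real)
  fix n :: nat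
  have "set_integrable lebesgue (cball (0 :: real ^ 'n) (real n)) f"
    using assms by (simp add: locally_L1_def)
  then show "(\<lambda>x. indicator (cball (0 :: real ^ 'n) (real n)) x *\<^sub>R f x) \<in> borel_measurable lebesgue"
    unfolding set_integrable_def by (rule borel_measurable_integrable)
next
  fix x :: "real ^ 'n"
  obtain N where N: "norm x \<le> real N" using real_arch_simple by blast
  have "\<forall>\<^sub>F n in sequentially. indicator (cball (0 :: real ^ 'n) (real n)) x *\<^sub>R f x = f x"
    using eventually_ge_at_top[of N]
    by eventually_elim (use N in \<open>auto simp: indicator_def\<close>)
  then show "(\<lambda>n. indicator (cball (0 :: real ^ 'n) (real n)) x *\<^sub>R f x) \<longlonglongrightarrow> f x"
    by (rule tendsto_eventually)
qed

lemma locally_L1_borel_representative: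
  fixes f :: "real ^ 'n::finite \<Rightarrow> real"
  assumes "locally_L1 f"
  obtains g where "g \<in> borel_measurable borel" "AE x in lborel. f x = g x"
  using completion_ex_borel_measurable_real[OF locally_L1_measurable[OF assms]] by auto

lemma cube_of_side_half_open_cube: "0 < s \<Longrightarrow> cube_of_side s (half_open_cube c s)"
  unfolding cube_of_side_def half_open_cube_def
  by (intro conjI exI[of _ "\<lambda>i. {c $ i..<c $ i + s}"]) auto

text \<open>The cube and the half-open cube lie between the same open and closed boxes, whose volumes agree.\<close>

lemma cube_of_side_AE_half_open:
  fixes Q :: "(real ^ 'n::finite) set"
  assumes "cube_of_side l Q"
  obtains a where "AE x in lborel. x \<in> Q \<longleftrightarrow> x \<in> half_open_cube a l"
proof -
  obtain I where l: "0 < l" and I: "\<And>i. \<exists>a. I i \<in> {{a..a + l}, {a<..<a + l}, {a..<a + l}, {a<..a + l}}"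
    and Q: "Q = {x. \<forall>i. x $ i \<in> I i}"
    using assms unfolding cube_of_side_def by blast
  obtain c where c: "\<And>i. I i \<in> {{c i..c i + l}, {c i<..<c i + l}, {c i..<c i + l}, {c i<..c i + l}}"
    using I by metis
  define a :: "real ^ 'n" where "a = (\<chi> i. c i)"
  define d :: "real ^ 'n" where "d = (\<chi> i. c i + l)"
  have le: "a \<bullet> b \<le> d \<bullet> b" if "b \<in> Basis" for b
    using that l by (auto simp: Basis_vec_def a_def d_def inner_axis)
  have in1: "{c i<..<c i + l} \<subseteq> I i" and in2: "I i \<subseteq> {c i..c i + l}" for i
    using c[of i] by (elim insertE emptyE; simp only:; force)+
  have "box a d \<subseteq> Q" using in1 by (auto simp: Q mem_box_cart a_def d_def subset_iff)
  moreover have "Q \<subseteq> cbox a d" using in2 by (auto simp: Q mem_box_cart a_def d_def subset_iff)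
  moreover have "box a d \<subseteq> half_open_cube a l" "half_open_cube a l \<subseteq> cbox a d"
    by (auto simp: half_open_cube_def mem_box_cart a_def d_def less_imp_le)
  moreover have "AE x in lborel. x \<notin> cbox a d - box a d"
  proof (rule AE_not_in)
    have "emeasure lborel (cbox a d - box a d) = 0"
      using le by (subst emeasure_Diff) (auto simp: box_subset_cbox)
    then show "cbox a d - box a d \<in> null_sets lborel" by (auto simp: null_sets_def)
  qed
  ultimately have "AE x in lborel. x \<in> Q \<longleftrightarrow> x \<in> half_open_cube a l"
    by (elim eventually_mono) blast
  then show ?thesis using that by blast
qed

lemma half_open_cube_integrable:
  assumes "locally_L1 w" and s: "0 < s"
  shows "set_integrable lebesgue (half_open_cube c s) w"
proof (rule set_integrable_subset)
  define d where "d = (\<chi> i. c $ i + s)"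
  show "set_integrable lebesgue (cbox c d) w" using assms by (simp add: locally_L1_def)
  show "half_open_cube c s \<subseteq> cbox c d"
    by (auto simp: half_open_cube_def mem_box_cart d_def less_imp_le)
  show "half_open_cube c s \<in> sets lebesgue"
    by (intro sets_completionI_sets) (simp add: half_open_cube_measurable)
qed

lemma weight_nn_integral:
  fixes w w' :: "real ^ 'n::finite \<Rightarrow> real"
  assumes w: "weight w" and w': "AE x in lborel. w x = w' x" and s: "0 < s"
  shows "(\<integral>\<^sup>+x. indicator (half_open_cube c s) x * ennreal (w' x) \<partial>lborel)
     = ennreal (LINT x:half_open_cube c s|lebesgue. w x)"
    and "0 < (LINT x:half_open_cube c s|lebesgue. w x)"
proof -
  let ?D = "half_open_cube c s"
  have pos: "AE x in lborel. 0 < w x" using w by (simp add: weight_def AE_completion_iff)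
  have int: "integrable lebesgue (\<lambda>x. indicator ?D x *\<^sub>R w x)"
    using half_open_cube_integrable[of w s c] w s by (simp add: weight_def set_integrable_def)
  have posl: "AE x in lebesgue. 0 \<le> indicator ?D x *\<^sub>R w x"
    using pos by (auto simp: AE_completion_iff indicator_def elim!: eventually_mono)
  have "(\<integral>\<^sup>+x. indicator ?D x * ennreal (w' x) \<partial>lborel) = (\<integral>\<^sup>+x. ennreal (indicator ?D x *\<^sub>R w x) \<partial>lborel)"
    using w' by (intro nn_integral_cong_AE) (auto simp: indicator_def elim!: eventually_mono)
  also have "\<dots> = (\<integral>\<^sup>+x. ennreal (indicator ?D x *\<^sub>R w x) \<partial>lebesgue)"
    by (simp add: nn_integral_completion)
  also have "\<dots> = ennreal (\<integral>x. indicator ?D x *\<^sub>R w x \<partial>lebesgue)"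
    by (rule nn_integral_eq_integral[OF int posl])
  finally show eq: "(\<integral>\<^sup>+x. indicator ?D x * ennreal (w' x) \<partial>lborel) = ennreal (LINT x:?D|lebesgue. w x)"
    by (simp add: set_lebesgue_integral_def)
  show "0 < (LINT x:?D|lebesgue. w x)"
  proof (rule ccontr)
    assume "\<not> 0 < (LINT x:?D|lebesgue. w x)"
    then have "(\<integral>\<^sup>+x. ennreal (indicator ?D x *\<^sub>R w x) \<partial>lebesgue) = 0"
      using nn_integral_eq_integral[OF int posl] by (simp add: set_lebesgue_integral_def ennreal_neg)
    then have "AE x in lebesgue. ennreal (indicator ?D x *\<^sub>R w x) = 0"
      using borel_measurable_integrable[OF int] by (subst (asm) nn_integral_0_iff_AE) auto
    then have "AE x in lborel. ennreal (indicator ?D x *\<^sub>R w x) = 0"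
      by (simp add: AE_completion_iff)
    then have "AE x in lborel. x \<notin> ?D"
      using pos by eventually_elim (auto simp: indicator_def ennreal_eq_0_iff)
    then have "emeasure lborel ?D = 0"
      by (subst (asm) AE_iff_measurable[of ?D]) auto
    then show False using s by (simp add: emeasure_half_open_cube)
  qed
qed

lemma A1_bound_AE:
  fixes w :: "real ^ 'n::finite \<Rightarrow> real"
  assumes w: "weight w" and C: "A1_bound w C" and s: "0 < s"
  shows "AE x in lborel. x \<in> half_open_cube c s \<longrightarrow>
    (LINT y:half_open_cube c s|lebesgue. w y) \<le> C * s ^ CARD('n) * w x"
proof -
  let ?D = "half_open_cube c s"
  let ?L = "LINT y:?D|lebesgue. w y"
  have D: "?D \<in> sets lebesgue" by (intro sets_completionI_sets) (simp add: half_open_cube_measurable)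
  have mD: "measure lebesgue ?D = s ^ CARD('n)"
    using emeasure_half_open_cube[of s c] s by (simp add: measure_def)
  have C0: "0 < C" and bd: "ereal (1 / measure lebesgue ?D * ?L) \<le> ereal C * ess_inf_on ?D w"
    using C cube_of_side_half_open_cube[OF s, of c] unfolding A1_bound_def by blast+
  have "AE x in lebesgue_on ?D. - ereal (w x) \<le> esssup (lebesgue_on ?D) (\<lambda>x. - ereal (w x))"
    by (rule esssup_AE)
  then have "AE x in lebesgue. x \<in> ?D \<longrightarrow> - ereal (w x) \<le> esssup (lebesgue_on ?D) (\<lambda>x. - ereal (w x))"
    using D by (subst (asm) AE_restrict_space_iff) auto
  then have "AE x in lborel. x \<in> ?D \<longrightarrow> - ereal (w x) \<le> esssup (lebesgue_on ?D) (\<lambda>x. - ereal (w x))"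
    by (simp add: AE_completion_iff)
  then show ?thesis
  proof eventually_elim
    case (elim x)
    show ?case
    proof
      assume "x \<in> ?D"
      then have "- ereal (w x) \<le> - ess_inf_on ?D w" using elim by (simp add: ess_inf_on_def)
      then have "ess_inf_on ?D w \<le> ereal (w x)" by (simp only: ereal_minus_le_minus)
      then have "ereal C * ess_inf_on ?D w \<le> ereal C * ereal (w x)"
        using C0 by (intro ereal_mult_left_mono) auto
      then have "ereal (1 / s ^ CARD('n) * ?L) \<le> ereal (C * w x)"
        using bd unfolding mD by (metis order_trans times_ereal.simps(1))
      then show "?L \<le> C * s ^ CARD('n) * w x"
        using s by (simp add: field_simps)
    qed
  qed
qed

text \<open>The infimum in the definition of the \<open>A\<^sub>1\<close> constant is attained: the inequality holds almost everywhere
  for each of countably many constants decreasing to the infimum.\<close>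

lemma A1_const_AE:
  fixes w :: "real ^ 'n::finite \<Rightarrow> real"
  assumes "w \<in> A1" and s: "0 < s"
  shows "AE x in lborel. x \<in> half_open_cube c s \<longrightarrow>
    (LINT y:half_open_cube c s|lebesgue. w y) \<le> A1_const w * s ^ CARD('n) * w x"
proof -
  let ?L = "LINT y:half_open_cube c s|lebesgue. w y"
  have w: "weight w" and ne: "{C. A1_bound w C} \<noteq> {}" using assms by (auto simp: A1_def)
  have pos: "AE x in lborel. 0 < w x" using w by (simp add: weight_def AE_completion_iff)
  have "AE x in lborel. x \<in> half_open_cube c s \<longrightarrow> ?L \<le> (A1_const w + 1 / real (Suc m)) * s ^ CARD('n) * w x" for m
  proof -
    have "A1_const w < A1_const w + 1 / real (Suc m)" by simp
    then obtain C where C: "A1_bound w C" "C < A1_const w + 1 / real (Suc m)"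
      using cInf_lessD[OF ne] unfolding A1_const_def by blast
    from A1_bound_AE[OF w C(1) s, of c] pos show ?thesis
    proof eventually_elim
      case (elim x)
      have "C * s ^ CARD('n) * w x \<le> (A1_const w + 1 / real (Suc m)) * s ^ CARD('n) * w x"
        using C elim(2) s by (intro mult_right_mono) auto
      then show ?case using elim(1) by auto
    qed
  qed
  then have "AE x in lborel. \<forall>m. x \<in> half_open_cube c s \<longrightarrow>
      ?L \<le> (A1_const w + 1 / real (Suc m)) * s ^ CARD('n) * w x"
    by (simp only: AE_all_countable) simp
  then show ?thesis
  proof eventually_elim
    case (elim x)
    have "(\<lambda>m. (A1_const w + 1 / real (Suc m)) * s ^ CARD('n) * w x)
        \<longlonglongrightarrow> (A1_const w + 0) * s ^ CARD('n) * w x"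
      by (intro tendsto_intros LIMSEQ_Suc[OF lim_1_over_n])
    then show ?case using elim by (auto intro!: LIMSEQ_le_const)
  qed
qed

lemma A1_const_nonneg: "w \<in> A1 \<Longrightarrow> 0 \<le> A1_const w"
  unfolding A1_const_def by (intro cInf_greatest) (auto simp: A1_def A1_bound_def less_imp_le)

lemma A1_ae_A1_const:
  fixes w w' :: "real ^ 'n::finite \<Rightarrow> real"
  assumes w: "w \<in> A1" and w': "AE x in lborel. w x = w' x"
  shows "A1_ae (\<lambda>x. ennreal (w' x)) (A1_const w)"
  unfolding A1_ae_def
proof (intro allI impI)
  fix c :: "real ^ 'n" and s :: real assume s: "0 < s"
  have wt: "weight w" using w by (simp add: A1_def)
  have I: "(\<integral>\<^sup>+y\<in>half_open_cube c s. ennreal (w' y) \<partial>lborel)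
      = ennreal (LINT y:half_open_cube c s|lebesgue. w y)"
    using weight_nn_integral(1)[OF wt w' s, of c] by (simp add: mult.commute)
  show "AE x in lborel. x \<in> half_open_cube c s \<longrightarrow>
     (\<integral>\<^sup>+y\<in>half_open_cube c s. ennreal (w' y) \<partial>lborel)
       \<le> ennreal (A1_const w * s ^ CARD('n)) * ennreal (w' x)"
    using A1_const_AE[OF w s, of c] w'
  proof eventually_elim
    case (elim x)
    show ?case
      unfolding I using elim A1_const_nonneg[OF w] s
      by (auto simp: ennreal_mult'[symmetric] intro!: ennreal_leI)
  qed
qed

text \<open>Integrate the \<open>A\<^sub>1\<close> inequality over the unit cube.\<close>

lemma A1_const_ge_1:
  fixes w :: "real ^ 'n::finite \<Rightarrow> real"
  assumes w: "w \<in> A1"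
  shows "1 \<le> A1_const w"
proof -
  let ?D = "half_open_cube (0 :: real ^ 'n) 1"
  let ?L = "LINT y:?D|lebesgue. w y"
  have wt: "weight w" using w by (simp add: A1_def)
  have L: "0 < ?L" using weight_nn_integral(2)[OF wt, of w 1] by simp
  have "ennreal ?L = (\<integral>\<^sup>+x. indicator ?D x * ennreal ?L \<partial>lborel)"
    by (simp add: nn_integral_multc emeasure_half_open_cube)
  also have "\<dots> \<le> (\<integral>\<^sup>+x. ennreal (A1_const w) * (indicator ?D x * ennreal (w x)) \<partial>lborel)"
  proof (rule nn_integral_mono_AE)
    show "AE x in lborel. indicator ?D x * ennreal ?L \<le> ennreal (A1_const w) * (indicator ?D x * ennreal (w x))"
      using A1_const_AE[OF w, of 1 0]
    proof (simp, elim eventually_mono)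
      fix x assume "x \<in> ?D \<longrightarrow> ?L \<le> A1_const w * w x"
      then show "indicator ?D x * ennreal ?L \<le> ennreal (A1_const w) * (indicator ?D x * ennreal (w x))"
        using A1_const_nonneg[OF w]
        by (auto simp: indicator_def ennreal_mult'[symmetric] intro!: ennreal_leI)
    qed
  qed
  also have "\<dots> = (\<integral>\<^sup>+x. ennreal (A1_const w) * (indicator ?D x * ennreal (w x)) \<partial>lebesgue)"
    by (simp add: nn_integral_completion)
  also have "\<dots> = ennreal (A1_const w) * (\<integral>\<^sup>+x. indicator ?D x * ennreal (w x) \<partial>lebesgue)"
  proof (rule nn_integral_cmult)
    have [measurable]: "w \<in> borel_measurable lebesgue" "?D \<in> sets lebesgue"
      using wt by (auto simp: weight_def intro: locally_L1_measurable sets_completionI_sets)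
    show "(\<lambda>x. indicator ?D x * ennreal (w x)) \<in> borel_measurable lebesgue" by measurable
  qed
  also have "(\<integral>\<^sup>+x. indicator ?D x * ennreal (w x) \<partial>lebesgue) = ennreal ?L"
    using weight_nn_integral(1)[OF wt, of w 1 0] by (simp add: nn_integral_completion)
  finally have "?L \<le> A1_const w * ?L"
    using L A1_const_nonneg[OF w] by (simp add: ennreal_mult[symmetric] ennreal_le_iff)
  then show ?thesis using L by simp
qed

text \<open>It remains to replace \<open>u\<close> and \<open>w\<close> by Borel representatives and \<open>Q\<close> by a half-open cube, which changes
  none of the integrals, and to choose \<open>c\<close> as a median of \<open>u\<close>.\<close>

theorem theorem2p3:
  shows "\<exists>c_n::real. 0 < c_n \<and>
    (\<forall>(\<delta>::real) (p::real) (q::real) (w::real ^ 'n::finite \<Rightarrow> real).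
      0 < \<delta> \<longrightarrow> \<delta> < 1 \<longrightarrow> 1 \<le> p \<longrightarrow> p < real CARD('n) / \<delta> \<longrightarrow>
      w \<in> A1 \<longrightarrow> 1 / p - 1 / q = \<delta> / real CARD('n) \<longrightarrow>
      (\<forall>(l::real) (Q::(real ^ 'n) set) (u::real ^ 'n \<Rightarrow> real).
        cube_of_side l Q \<longrightarrow> locally_L1 u \<longrightarrow>
        (INF c::real. ennpowr
           (ennreal (1 / weight_of w Q) *
            (\<integral>\<^sup>+x\<in>Q. ennreal (\<bar>u x - c\<bar> powr q * w x) \<partial>lebesgue)) (1 / q))
        \<le> ennreal (c_n * q * (1 - \<delta>) powr (1 / p)
             * A1_const w powr (\<delta> / real CARD('n) + 1 + 1 / p) * l powr \<delta>)
          * ennpowr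
              (ennreal (1 / weight_of w Q) *
               (\<integral>\<^sup>+x\<in>Q. (\<integral>\<^sup>+y\<in>Q.
                   ennreal (\<bar>u x - u y\<bar> powr p / norm (x - y) powr (real CARD('n) + p * \<delta>))
                   \<partial>lebesgue) * ennreal (w x) \<partial>lebesgue)) (1 / p)))"
proof -
  define cn :: real where
    "cn = 72 * exp 1 ^ 2 * (6 * 2 ^ CARD('n) * real CARD('n) powr (2 * real CARD('n))) * 2 ^ (CARD('n) + 1)"
  have cn0: "0 < cn" by (simp add: cn_def)
  show ?thesis
  proof (intro exI[of _ cn] conjI cn0 allI impI)
    fix \<delta> p q :: real and w :: "real ^ 'n \<Rightarrow> real" and l :: real and Q :: "(real ^ 'n) set"
      and u :: "real ^ 'n \<Rightarrow> real"
    assume \<delta>: "0 < \<delta>" "\<delta> < 1" and p: "1 \<le> p" "p < real CARD('n) / \<delta>" and w: "w \<in> A1"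
      and q: "1 / p - 1 / q = \<delta> / real CARD('n)" and Q: "cube_of_side l Q" and u: "locally_L1 u"
    let ?n = "real CARD('n)"
    have l: "0 < l" using Q by (simp add: cube_of_side_def)
    have pd: "p * \<delta> < ?n" using p \<delta> by (simp add: field_simps)
    have q0: "0 < q"
    proof -
      have "1 / q = 1 / p - \<delta> / ?n" using q by simp
      also have "\<dots> > 0" using pd p by (simp add: field_simps)
      finally show ?thesis by simp
    qed
    have wt: "weight w" using w by (simp add: A1_def)
    obtain a where a: "AE x in lborel. x \<in> Q \<longleftrightarrow> x \<in> half_open_cube a l"
      using cube_of_side_AE_half_open[OF Q] .
    define D where "D = half_open_cube a l"
    have DQ: "AE x in lborel. indicator Q x = (indicator D x :: ennreal)"
      using a by eventually_elim (auto simp: D_def indicator_def)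
    have DQr: "AE x in lborel. indicator Q x = (indicator D x :: real)"
      using a by eventually_elim (auto simp: D_def indicator_def)
    obtain v where [measurable]: "v \<in> borel_measurable borel" and v: "AE x in lborel. u x = v x"
      using locally_L1_borel_representative[OF u] .
    obtain w' where [measurable]: "w' \<in> borel_measurable borel" and w': "AE x in lborel. w x = w' x"
      using locally_L1_borel_representative[of w] wt by (auto simp: weight_def)
    define W where "W x = ennreal (w' x)" for x
    have [measurable]: "W \<in> borel_measurable borel" unfolding W_def by measurable
    define w0 where "w0 = (LINT x:D|lebesgue. w x)"
    have w0: "(\<integral>\<^sup>+x. indicator D x * W x \<partial>lborel) = ennreal w0" "0 < w0"
      using weight_nn_integral[OF wt w' l, of a] by (auto simp: D_def W_def w0_def)
    have wQ: "weight_of w Q = w0"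
    proof -
      have "(\<integral>x. indicator Q x *\<^sub>R w x \<partial>lebesgue) = (\<integral>x. indicator D x *\<^sub>R w x \<partial>lebesgue)"
      proof (rule integral_cong_AE)
        have [measurable]: "w \<in> borel_measurable lebesgue" "D \<in> sets lebesgue"
          using wt by (auto simp: weight_def D_def intro: locally_L1_measurable sets_completionI_sets)
        have "AE x in lborel. \<not> (x \<in> Q \<longleftrightarrow> x \<notin> D)"
          using a by eventually_elim (simp add: D_def)
        then have [measurable]: "Measurable.pred lebesgue (\<lambda>x. x \<in> Q \<longleftrightarrow> x \<notin> D)"
          by (rule sets_completion_AE)
        have "{x \<in> space lebesgue. (x \<in> Q \<longleftrightarrow> x \<notin> D) \<longleftrightarrow> x \<notin> D} \<in> sets lebesgue" by measurable
        moreover have "{x \<in> space lebesgue. (x \<in> Q \<longleftrightarrow> x \<notin> D) \<longleftrightarrow> x \<notin> D} = Q" by auto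
        ultimately have [measurable]: "Q \<in> sets lebesgue" by simp
        show m: "(\<lambda>x. indicator D x *\<^sub>R w x) \<in> borel_measurable lebesgue" by measurable
        show ae: "AE x in lebesgue. indicator Q x *\<^sub>R w x = indicator D x *\<^sub>R w x"
          using DQr by (auto simp: AE_completion_iff elim!: eventually_mono)
        show "(\<lambda>x. indicator Q x *\<^sub>R w x) \<in> borel_measurable lebesgue" by measurable
      qed
      then show ?thesis by (simp add: weight_of_def w0_def set_lebesgue_integral_def)
    qed
    obtain m where m: "emeasure lborel (D \<inter> {x. m < v x}) \<le> ennreal (l ^ CARD('n) / 2)"
      "emeasure lborel (D \<inter> {x. v x < m}) \<le> ennreal (l ^ CARD('n) / 2)"
      using median_on_cube[of v l a] l by (auto simp: D_def)
    have lhs: "(\<integral>\<^sup>+x\<in>Q. ennreal (\<bar>u x - m\<bar> powr q * w x) \<partial>lebesgue)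
       = (\<integral>\<^sup>+x. indicator D x * W x * ennreal (\<bar>v x - m\<bar> powr q) \<partial>lborel)"
      unfolding nn_integral_completion
    proof (rule nn_integral_cong_AE)
      show "AE x in lborel. ennreal (\<bar>u x - m\<bar> powr q * w x) * indicator Q x
          = indicator D x * W x * ennreal (\<bar>v x - m\<bar> powr q)"
        using DQ v w' by eventually_elim (simp add: W_def ennreal_mult' ennreal_mult'' mult_ac)
    qed
    have rhs: "(\<integral>\<^sup>+x\<in>Q. (\<integral>\<^sup>+y\<in>Q.
           ennreal (\<bar>u x - u y\<bar> powr p / norm (x - y) powr (?n + p * \<delta>)) \<partial>lebesgue) * ennreal (w x) \<partial>lebesgue)
       = frac_energy p (?n + p * \<delta>) v W D"
      unfolding nn_integral_completion frac_energy_def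
    proof (rule nn_integral_cong_AE)
      have inner: "(\<integral>\<^sup>+y\<in>Q. ennreal (\<bar>c - u y\<bar> powr p / norm (x - y) powr (?n + p * \<delta>)) \<partial>lborel)
         = (\<integral>\<^sup>+y. indicator D y * ennreal (\<bar>c - v y\<bar> powr p / norm (x - y) powr (?n + p * \<delta>)) \<partial>lborel)" for c x
      proof (rule nn_integral_cong_AE)
        show "AE y in lborel. ennreal (\<bar>c - u y\<bar> powr p / norm (x - y) powr (?n + p * \<delta>)) * indicator Q y
           = indicator D y * ennreal (\<bar>c - v y\<bar> powr p / norm (x - y) powr (?n + p * \<delta>))"
          using DQ v by eventually_elim (simp add: mult.commute)
      qed
      show "AE x in lborel. (\<integral>\<^sup>+y\<in>Q. ennreal (\<bar>u x - u y\<bar> powr p / norm (x - y) powr (?n + p * \<delta>)) \<partial>lborel)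
            * ennreal (w x) * indicator Q x
         = indicator D x * W x * (\<integral>\<^sup>+y. indicator D y * ennreal (frac_kernel p (?n + p * \<delta>) v x y) \<partial>lborel)"
        using DQ v w' by eventually_elim (simp only: inner W_def frac_kernel_def, simp only: mult_ac)
    qed
    let ?C = "A1_const w"
    have C1: "1 \<le> ?C" using w by (rule A1_const_ge_1)
    have A1: "A1_ae W ?C" unfolding W_def using w w' by (rule A1_ae_A1_const)
    have "(INF c. ennpowr (ennreal (1 / weight_of w Q) *
            (\<integral>\<^sup>+x\<in>Q. ennreal (\<bar>u x - c\<bar> powr q * w x) \<partial>lebesgue)) (1 / q))
       \<le> ennpowr (ennreal (1 / weight_of w Q) *
            (\<integral>\<^sup>+x\<in>Q. ennreal (\<bar>u x - m\<bar> powr q * w x) \<partial>lebesgue)) (1 / q)"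
      by (rule INF_lower) simp
    also have "\<dots> \<le> ennreal (cn * q * (1 - \<delta>) powr (1 / p) * ?C powr (\<delta> / ?n + 1 / p) * l powr \<delta>)
       * ennpowr (ennreal (1 / w0) * frac_energy p (?n + p * \<delta>) v W D) (1 / p)"
      unfolding wQ lhs
      by (rule fractional_sobolev_half_open_cube[OF _ _ l D_def p(1) \<delta> pd A1 C1 w0 q m cn_def]) auto
    also have "\<dots> \<le> ennreal (cn * q * (1 - \<delta>) powr (1 / p) * ?C powr (\<delta> / ?n + 1 + 1 / p) * l powr \<delta>)
       * ennpowr (ennreal (1 / w0) * frac_energy p (?n + p * \<delta>) v W D) (1 / p)"
      using cn0 q0 C1 by (intro mult_right_mono ennreal_leI mult_left_mono powr_mono) auto
    finally show "(INF c. ennpowr (ennreal (1 / weight_of w Q) *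
            (\<integral>\<^sup>+x\<in>Q. ennreal (\<bar>u x - c\<bar> powr q * w x) \<partial>lebesgue)) (1 / q))
        \<le> ennreal (cn * q * (1 - \<delta>) powr (1 / p) * ?C powr (\<delta> / ?n + 1 + 1 / p) * l powr \<delta>)
          * ennpowr
              (ennreal (1 / weight_of w Q) *
               (\<integral>\<^sup>+x\<in>Q. (\<integral>\<^sup>+y\<in>Q.
                   ennreal (\<bar>u x - u y\<bar> powr p / norm (x - y) powr (?n + p * \<delta>))
                   \<partial>lebesgue) * ennreal (w x) \<partial>lebesgue)) (1 / p)"
      unfolding wQ rhs .
  qed
qed

end
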